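(* Let $N\ge1$, let $S$ be a height controlled set of endomorphisms of $\mathbb{P}^N(\overline{\mathbb{Q}})$ all defined over a fixed number field $K$, and let $\nu$ be a discrete probability measure on $S$ with $\nu(\phi)>0$ for all $\phi\in S$. Then the following statements hold. (1) For all $P\in\mathbb{P}^N(\overline{\mathbb{Q}})$ and all $\gamma\in\Phi_S$, both $$\liminf_{n\to\infty}\frac{h(\gamma_n^+(P))}{\deg(\gamma_n^+)}\quad\text{and}\quad\limsup_{n\to\infty}\frac{h(\gamma_n^+(P))}{\deg(\gamma_n^+)}$$ exist (as finite real numbers) and are $h(P)+O(1)$, where the implied constant depends only on $S$. (2) For all $P\in\mathbb{P}^N(\overline{\mathbb{Q}})$, the total orbit $\mathrm{Orb}_S(P)$ is infinite if and only if $$0<\limsup_{n\to\infty}\frac{h(\gamma_n^+(P))}{\deg(\gamma_n^+)}\quad\text{for }\bar\nu\text{-almost every }\gamma\in\Phi_S.$$ Hence, $\mathrm{Orb}_S(P)$ is finite if and only if $\mathrm{Orb}_\gamma^+(P)$ is finite with positive $\bar\nu$-probability. (3) If $P\in\mathbb{P}^N(\overline{\mathbb{Q}})$ is such that $\mathrm{Orb}_S(P)$ is infinite and if $\mathbb{E}_\nu[\log\deg(\phi)]$ exists (i.e. is finite), then $$\limsup_{n\to\infty}h(\gamma_n^+(P))^{1/n}=\delta_{S,\nu}\quad\text{for }\bar\nu\text{-almost every }\gamma\in\Phi_S.$$ Moreover, the dynamical degree is given explicitly by $\delta_{S,\nu}=\exp\big(\mathbb{E}_\nu[\log\deg(\p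hi)]\big)$.
   Context: $h:\mathbb{P}^N(\overline{\mathbb{Q}})\to\mathbb{R}_{\ge0}$ is the absolute logarithmic Weil height. For an endomorphism $\phi$ of $\mathbb{P}^N$ of degree $d_\phi=\deg(\phi)$ (degree of its defining homogeneous polynomials), $C(\phi)=\sup_{P\in\mathbb{P}^N(\overline{\mathbb{Q}})}|h(\phi(P))-d_\phi h(P)|$. A set $S$ of endomorphisms of $\mathbb{P}^N(\overline{\mathbb{Q}})$ is height controlled if $d_S:=\inf\{d_\phi:\phi\in S\}\ge2$ and $C_S:=\sup\{C(\phi):\phi\in S\}$ is finite. $\Phi_S=\prod_{i=1}^\infty S$ is the set of infinite sequences in $S$, with product measure $\bar\nu=\prod_{i=1}^\infty\nu$. For $\gamma=(\theta_1,\theta_2,\dots)\in\Phi_S$ and $n\ge1$: $\gamma_n^-=\theta_n\circ\cdots\circ\theta_1$, $\gamma_n^+=\theta_1\circ\cdots\circ\theta_n$, and $\gamma_0^\pm=\mathrm{Id}$. $\mathrm{Orb}_\gamma^+(P)=\{\gamma_n^+(P):n\ge0\}$. $M_S$ is the monoid generated by $S$ and the identity under composition, and $\mathrm{Orb}_S(P)=\{f(P):f\in M_S\}$. $\mathbb{E}_\nu[\log\deg(\phi)]=\sum_{\phi\in S}\nu(\phi)\log\deg(\phi)$. When this is finite, the dynamical degree $\delta_{S,\nu}$ is the constant (which exists) such that $\lim_{n\to\infty}\deg(\gamma_n^\pm)^{1/n}=\delta_{S,\nu}$ (both signs) for $\bar\nu$-almost every $\gamma$. *)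

theory Defs
  imports
    "HOL-Probability.Probability"
    "HOL-Algebra.Algebraic_Closure_Type"
    "HOL-Algebra.Embedded_Algebras"
    "HOL-Algebra.Generated_Fields"
    "HOL-Algebra.Ideal_Product"
    "HOL-Algebra.QuotRing"
    "HOL-Library.Poly_Mapping"
begin

section \<open>Projective space over the algebraic numbers\<close>

text \<open>
  The algebraic closure of the rationals is realised as the field of algebraic complex numbers.
  Points of \<open>N\<close>-dimensional projective space are represented by coordinate vectors indexed
  by a finite type \<open>'n\<close> with \<open>N + 1\<close> elements.
\<close>

definition hom_coords :: "complex ^ 'n::finite \<Rightarrow> bool" where
  "hom_coords x \<longleftrightarrow> x \<noteq> 0 \<and> (\<forall>i. algebraic (x $ i))"

definition proj_rel :: "complex ^ 'n::finite \<Rightarrow> complex ^ 'n \<Rightarrow> bool" where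
  "proj_rel x y \<longleftrightarrow> hom_coords x \<and> hom_coords y \<and> (\<exists>c. c \<noteq> 0 \<and> y = c *s x)"

lemma part_equivp_proj_rel: "part_equivp proj_rel"
proof (rule part_equivpI)
  have "algebraic (1 :: complex)"
    by (intro algebraic_int_imp_algebraic int_imp_algebraic_int) simp
  then have "hom_coords ((\<chi> i. 1) :: complex ^ 'n)"
    by (simp add: hom_coords_def vec_eq_iff)
  then have "proj_rel ((\<chi> i. 1) :: complex ^ 'n) (\<chi> i. 1)"
    unfolding proj_rel_def by (intro conjI exI[of _ 1]) simp_all
  then show "\<exists>x. proj_rel x (x :: complex ^ 'n)" by blast
  show "symp (proj_rel :: complex ^ 'n \<Rightarrow> _)"
  proof (rule sympI)
    fix x y :: "complex ^ 'n"
    assume "proj_rel x y"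
    then obtain c where "hom_coords x" "hom_coords y" "c \<noteq> 0" "y = c *s x"
      by (auto simp: proj_rel_def)
    moreover from this have "x = inverse c *s y" "inverse c \<noteq> 0"
      by (simp_all add: vector_smult_assoc)
    ultimately show "proj_rel y x"
      unfolding proj_rel_def by blast
  qed
  show "transp (proj_rel :: complex ^ 'n \<Rightarrow> _)"
  proof (rule transpI)
    fix x y z :: "complex ^ 'n"
    assume "proj_rel x y" "proj_rel y z"
    then obtain c d where "hom_coords x" "hom_coords z" "c \<noteq> 0" "d \<noteq> 0" "y = c *s x" "z = d *s y"
      by (auto simp: proj_rel_def)
    moreover from this have "z = (d * c) *s x" "d * c \<noteq> 0"
      by (simp_all add: vector_smult_assoc)
    ultimately show "proj_rel x z"
      unfolding proj_rel_def by blast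
  qed
qed

quotient_type 'n qproj = "complex ^ 'n::finite" / partial: proj_rel
  morphisms rep_qproj proj_point
  by (rule part_equivp_proj_rel)


section \<open>Endomorphisms of projective space\<close>

text \<open>A polynomial in the variables \<open>'n\<close> is a finitely supported family of coefficients
  indexed by exponent vectors.\<close>

type_synonym 'n cpoly = "('n \<Rightarrow>\<^sub>0 nat) \<Rightarrow>\<^sub>0 complex"

definition homogeneous :: "nat \<Rightarrow> 'n::finite cpoly \<Rightarrow> bool" where
  "homogeneous d p \<longleftrightarrow> (\<forall>m \<in> Poly_Mapping.keys p. (\<Sum>i\<in>UNIV. Poly_Mapping.lookup m i) = d)"

definition eval_cpoly :: "'n::finite cpoly \<Rightarrow> complex ^ 'n \<Rightarrow> complex" where
  "eval_cpoly p x = (\<Sum>m \<in> Poly_Mapping.keys p.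
     Poly_Mapping.lookup p m * (\<Prod>i\<in>UNIV. (x $ i) ^ Poly_Mapping.lookup m i))"

text \<open>\<open>proj_morphism A d \<phi>\<close>: the map \<open>\<phi>\<close> is given by homogeneous polynomials of common
  degree \<open>d\<close> with coefficients in \<open>A\<close> and without a common zero.\<close>

definition proj_morphism :: "complex set \<Rightarrow> nat \<Rightarrow> ('n::finite qproj \<Rightarrow> 'n qproj) \<Rightarrow> bool" where
  "proj_morphism A d \<phi> \<longleftrightarrow> (\<exists>F :: 'n \<Rightarrow> 'n cpoly.
     (\<forall>i m. Poly_Mapping.lookup (F i) m \<in> A) \<and>
     (\<forall>i. homogeneous d (F i)) \<and>
     (\<forall>x. hom_coords x \<longrightarrow> (\<exists>i. eval_cpoly (F i) x \<noteq> 0)) \<and>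
     (\<forall>x. hom_coords x \<longrightarrow> \<phi> (proj_point x) = proj_point (\<chi> i. eval_cpoly (F i) x)))"

definition endomorphism :: "('n::finite qproj \<Rightarrow> 'n qproj) \<Rightarrow> bool" where
  "endomorphism \<phi> \<longleftrightarrow> (\<exists>d. proj_morphism {z. algebraic z} d \<phi>)"

text \<open>For \<open>N \<ge> 1\<close> the degree of the defining polynomials is determined by the map.\<close>

definition endo_degree :: "('n::finite qproj \<Rightarrow> 'n qproj) \<Rightarrow> nat" where
  "endo_degree \<phi> = (THE d. proj_morphism {z. algebraic z} d \<phi>)"

definition defined_over :: "complex set \<Rightarrow> ('n::finite qproj \<Rightarrow> 'n qproj) \<Rightarrow> bool" where
  "defined_over K \<phi> \<longleftrightarrow> (\<exists>d. proj_morphism K d \<phi>)"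


section \<open>Number fields and their normalised absolute values\<close>

abbreviation CC :: "complex ring" where
  "CC \<equiv> ring_of_type_algebra"

definition number_field :: "complex set \<Rightarrow> bool" where
  "number_field F \<longleftrightarrow> subfield F CC \<and> ring.finite_dimension CC \<rat> F"

definition field_degree :: "complex set \<Rightarrow> nat" where
  "field_degree F = ring.dim CC \<rat> F"

definition ring_of_integers :: "complex set \<Rightarrow> complex ring" where
  "ring_of_integers F = CC\<lparr>carrier := {x \<in> F. algebraic_int x}\<rparr>"

definition complex_embeddings :: "complex set \<Rightarrow> (complex \<Rightarrow> complex) set" where
  "complex_embeddings F = ring_hom (CC\<lparr>carrier := F\<rparr>) CC \<inter> extensional F"

definition finite_places :: "complex set \<Rightarrow> complex set set" where
  "finite_places F = {\<pp>. primeideal \<pp> (ring_of_integers F) \<and> \<pp> \<noteq> {0}}"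

definition place_norm :: "complex set \<Rightarrow> complex set \<Rightarrow> nat" where
  "place_norm F \<pp> = card (carrier (ring_of_integers F Quot \<pp>))"

definition int_ord :: "complex set \<Rightarrow> complex set \<Rightarrow> complex \<Rightarrow> nat" where
  "int_ord F \<pp> a = Max {n::nat. a \<in> \<pp> [^]\<^bsub>ideals_set (ring_of_integers F)\<^esub> n}"

definition place_ord :: "complex set \<Rightarrow> complex set \<Rightarrow> complex \<Rightarrow> int" where
  "place_ord F \<pp> x = (THE k. \<exists>a b.
     a \<in> carrier (ring_of_integers F) \<and> b \<in> carrier (ring_of_integers F) \<and> a \<noteq> 0 \<and> b \<noteq> 0 \<and>
     x = a / b \<and> k = int (int_ord F \<pp> a) - int (int_ord F \<pp> b))"

definition place_abs :: "complex set \<Rightarrow> complex set \<Rightarrow> complex \<Rightarrow> real" where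
  "place_abs F \<pp> x = (if x = 0 then 0 else real (place_norm F \<pp>) powi (- place_ord F \<pp> x))"


section \<open>The absolute logarithmic Weil height\<close>

text \<open>
  This is \<open>1/[F:\<rat>] \<cdot> \<Sum>\<^sub>v log max\<^sub>i \<parallel>x\<^sub>i\<parallel>\<^sub>v\<close> over the places \<open>v\<close> of the number field \<open>F\<close>, where
  \<open>\<parallel>\<cdot>\<parallel>\<^sub>v\<close> is normalised by the local degree. Summing over complex embeddings counts a complex
  place twice, which is its local degree; for a prime \<open>\<pp>\<close> the normalised absolute value is
  \<open>N(\<pp>)\<close> to the power \<open>- ord\<^sub>\<pp>\<close>. All but finitely many terms of the infinite sum vanish.
\<close>

definition field_height :: "complex set \<Rightarrow> complex ^ 'n::finite \<Rightarrow> real" where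
  "field_height F x =
     ((\<Sum>\<sigma>\<in>complex_embeddings F. ln (Max {cmod (\<sigma> (x $ i)) | i. True})) +
      (\<Sum>\<^sub>\<infinity>\<pp>\<in>finite_places F. ln (Max {place_abs F \<pp> (x $ i) | i. True})))
     / real (field_degree F)"

text \<open>
  The height of a point does not depend on the homogeneous coordinates (product formula) nor
  on the number field containing them (degree formula). We evaluate it on coordinates one of
  which is \<open>1\<close>, and on the field they generate.
\<close>

definition weil_height :: "'n::finite qproj \<Rightarrow> real" where
  "weil_height P =
     (let x = (SOME x. hom_coords x \<and> proj_point x = P \<and> (\<exists>i. x $ i = 1))
      in field_height (generate_field CC {x $ i | i. True}) x)"


section \<open>Height controlled sets and orbits\<close>

definition height_defect :: "('n::finite qproj \<Rightarrow> 'n qproj) \<Rightarrow> ereal" where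
  "height_defect \<phi> =
     (SUP P. ereal \<bar>weil_height (\<phi> P) - real (endo_degree \<phi>) * weil_height P\<bar>)"

definition height_controlled :: "('n::finite qproj \<Rightarrow> 'n qproj) set \<Rightarrow> bool" where
  "height_controlled S \<longleftrightarrow>
     (\<forall>\<phi>\<in>S. endomorphism \<phi>) \<and>
     (INF \<phi>\<in>S. enat (endo_degree \<phi>)) \<ge> 2 \<and>
     (SUP \<phi>\<in>S. height_defect \<phi>) < \<infinity>"

inductive_set gen_monoid :: "('a \<Rightarrow> 'a) set \<Rightarrow> ('a \<Rightarrow> 'a) set" for S where
  id: "id \<in> gen_monoid S"
| gen: "\<phi> \<in> S \<Longrightarrow> \<phi> \<in> gen_monoid S"
| comp: "f \<in> gen_monoid S \<Longrightarrow> g \<in> gen_monoid S \<Longrightarrow> f \<circ> g \<in> gen_monoid S"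

definition total_orbit :: "('a \<Rightarrow> 'a) set \<Rightarrow> 'a \<Rightarrow> 'a set" where
  "total_orbit S P = {f P | f. f \<in> gen_monoid S}"

text \<open>Sequences are indexed from \<open>0\<close>, so \<open>\<gamma> i\<close> is the map \<open>\<theta>\<^bsub>i+1\<^esub>\<close>.\<close>

primrec minus_iter :: "(nat \<Rightarrow> 'a \<Rightarrow> 'a) \<Rightarrow> nat \<Rightarrow> 'a \<Rightarrow> 'a" where
  "minus_iter \<gamma> 0 = id"
| "minus_iter \<gamma> (Suc n) = \<gamma> n \<circ> minus_iter \<gamma> n"

primrec plus_iter :: "(nat \<Rightarrow> 'a \<Rightarrow> 'a) \<Rightarrow> nat \<Rightarrow> 'a \<Rightarrow> 'a" where
  "plus_iter \<gamma> 0 = id"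
| "plus_iter \<gamma> (Suc n) = plus_iter \<gamma> n \<circ> \<gamma> n"

definition plus_orbit :: "(nat \<Rightarrow> 'a \<Rightarrow> 'a) \<Rightarrow> 'a \<Rightarrow> 'a set" where
  "plus_orbit \<gamma> P = {plus_iter \<gamma> n P | n. True}"

definition height_ratio :: "(nat \<Rightarrow> 'n::finite qproj \<Rightarrow> 'n qproj) \<Rightarrow> 'n qproj \<Rightarrow> nat \<Rightarrow> real" where
  "height_ratio \<gamma> P n = weil_height (plus_iter \<gamma> n P) / real (endo_degree (plus_iter \<gamma> n))"


section \<open>Random sequences\<close>

definition sequences :: "'a set \<Rightarrow> (nat \<Rightarrow> 'a) set" where
  "sequences S = {\<gamma>. \<forall>i. \<gamma> i \<in> S}"

text \<open>
  Each factor is restricted to the countable support of \<open>\<nu>\<close>, so that the underlying space of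
  the product is the set of sequences in the support. Without the restriction, events
  depending on finitely many terms of the sequence might fail to be measurable, since the
  product of two power set algebras on a large type is not the full power set algebra.
\<close>

definition seq_measure :: "'a pmf \<Rightarrow> (nat \<Rightarrow> 'a) measure" where
  "seq_measure \<nu> = PiM UNIV (\<lambda>_. restrict_space (measure_pmf \<nu>) (set_pmf \<nu>))"

lemma space_seq_measure: "space (seq_measure \<nu>) = sequences (set_pmf \<nu>)"
  by (auto simp: seq_measure_def space_PiM space_restrict_space sequences_def PiE_def)

definition dynamical_degree :: "('n::finite qproj \<Rightarrow> 'n qproj) pmf \<Rightarrow> real" where
  "dynamical_degree \<nu> = (THE \<delta>.
     (AE \<gamma> in seq_measure \<nu>. (\<lambda>n. root n (real (endo_degree (minus_iter \<gamma> n)))) \<longlonglongrightarrow> \<delta>) \<and>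
     (AE \<gamma> in seq_measure \<nu>. (\<lambda>n. root n (real (endo_degree (plus_iter \<gamma> n)))) \<longlonglongrightarrow> \<delta>))"

end

theory Submission
  imports Defs "Jordan_Normal_Form.Char_Poly"
begin

text \<open>
  Writing \<open>C\<close> for the supremum of the defects of the maps in \<open>S\<close>, every \<open>f\<close> in the monoid satisfies
  \<open>\<bar>h (f P) - deg f * h P\<bar> \<le> C * (deg f - 1)\<close>, which gives (1).  If the total orbit of \<open>P\<close> is infinite, then
  Northcott's theorem yields a word \<open>w\<close> in \<open>S\<close> with composition \<open>f\<close> such that \<open>h (f P) \<ge> C + 1\<close>.  Almost every
  sequence contains \<open>w\<close> at infinitely many positions \<open>n\<close>, and there the composition
  \<open>\<gamma>\<^sub>n\<^sup>+ \<circ> f\<close> has height at least \<open>deg \<gamma>\<^sub>n\<^sup>+\<close> at \<open>P\<close>, so the height ratio is at least \<open>1 / deg f\<close>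
  infinitely often.  This gives (2) and reduces (3) to the growth of the degrees, where the strong law of large numbers
  applies since degrees are multiplicative.

  For Northcott's theorem, scale a point so that some coordinate is \<open>1\<close>.  A bound on the height
  bounds the norms of the primes in the denominators of the coordinates, hence these denominators, and the
  absolute values of all conjugates.  The numerators are then algebraic integers in a fixed number field with
  bounded conjugates, of which there are finitely many.
\<close>

section \<open>Algebraic integers\<close>

text \<open>The height sums over the places of a field that changes with the point, and its finite
  terms come from prime ideal powers through a maximum and a definite description. The work on
  number fields gives these terms their usual meaning. Its central step is that every nonzero prime
  is locally principal: this makes the exponent a valuation, and a number of nonnegative order at
  every prime integral. For coordinates containing the entry \<open>1\<close> every local term is
  nonnegative, so a bound on the height bounds each term; the degrees of the varying fields are
  bounded by that of a fixed one, which makes the estimates uniform. In \<open>plus_iter\<close>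
  later maps act first on the point. A word occurring late therefore lifts \<open>P\<close> to a
  large height before the long composition magnifies it. Only infinitely many such positions are
  guaranteed, hence the statements about limsup. In \<open>C + 1\<close> the part \<open>C\<close>
  absorbs the error of the outer map, at most \<open>C\<close> per unit of degree, and the
  \<open>1\<close> is the surplus that survives division by the degree.\<close>

definition int_acts :: "('i \<Rightarrow> complex) \<Rightarrow> 'i set \<Rightarrow> complex \<Rightarrow> bool" where
  "int_acts v I x \<longleftrightarrow> (\<exists>c :: 'i \<Rightarrow> 'i \<Rightarrow> int. \<forall>i\<in>I. x * v i = (\<Sum>j\<in>I. of_int (c i j) * v j))"

text \<open>Multiplication by \<open>x\<close> maps the integer span of \<open>v\<close> into
  itself, and multipliers with this property are closed under sums and products. Letting two
  algebraic integers act on one common family therefore handles both operations at once.\<close>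

lemma int_acts_add:
  assumes "int_acts v I x" "int_acts v I y"
  shows "int_acts v I (x + y)"
proof -
  obtain c d where "\<forall>i\<in>I. x * v i = (\<Sum>j\<in>I. of_int (c i j) * v j)"
    "\<forall>i\<in>I. y * v i = (\<Sum>j\<in>I. of_int (d i j) * v j)"
    using assms unfolding int_acts_def by blast
  then have "\<forall>i\<in>I. (x + y) * v i = (\<Sum>j\<in>I. of_int (c i j + d i j) * v j)"
    by (simp add: sum.distrib ring_distribs)
  then show ?thesis unfolding int_acts_def by (intro exI[of _ "\<lambda>i j. c i j + d i j"]) simp
qed

lemma int_acts_mult:
  assumes "int_acts v I x" "int_acts v I y"
  shows "int_acts v I (x * y)"
proof -
  obtain c d where c: "\<forall>i\<in>I. x * v i = (\<Sum>j\<in>I. of_int (c i j) * v j)" and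
    d: "\<forall>i\<in>I. y * v i = (\<Sum>j\<in>I. of_int (d i j) * v j)"
    using assms unfolding int_acts_def by blast
  have "(x * y) * v i = (\<Sum>k\<in>I. of_int (\<Sum>j\<in>I. d i j * c j k) * v k)" if "i \<in> I" for i
  proof -
    have "(x * y) * v i = x * (y * v i)" by simp
    also have "\<dots> = (\<Sum>j\<in>I. of_int (d i j) * (x * v j))"
      using d that by (simp add: sum_distrib_left mult_ac)
    also have "\<dots> = (\<Sum>j\<in>I. of_int (d i j) * (\<Sum>k\<in>I. of_int (c j k) * v k))"
      using c by simp
    also have "\<dots> = (\<Sum>j\<in>I. \<Sum>k\<in>I. of_int (d i j * c j k) * v k)"
      by (simp add: sum_distrib_left mult_ac)
    also have "\<dots> = (\<Sum>k\<in>I. \<Sum>j\<in>I. of_int (d i j * c j k) * v k)"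
      by (rule sum.swap)
    finally show ?thesis by (simp add: sum_distrib_right)
  qed
  then show ?thesis unfolding int_acts_def
    by (intro exI[of _ "\<lambda>i k. \<Sum>j\<in>I. d i j * c j k"]) simp
qed

text \<open>The family \<open>v\<close> is an eigenvector of an integer matrix with eigenvalue \<open>x\<close>.\<close>

lemma int_acts_imp_algebraic_int:
  assumes "int_acts v I x" "finite I" "i0 \<in> I" "v i0 \<noteq> 0"
  shows "algebraic_int x"
proof -
  obtain c where c: "\<forall>i\<in>I. x * v i = (\<Sum>j\<in>I. of_int (c i j) * v j)"
    using assms unfolding int_acts_def by blast
  define n where "n = card I"
  obtain e where e: "bij_betw e {..<n} I"
    unfolding n_def using assms(2) by (metis bij_betw_from_nat_into_finite)
  define M :: "int mat" where "M = mat n n (\<lambda>(i,j). c (e i) (e j))"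
  define w :: "complex Matrix.vec" where "w = Matrix.vec n (\<lambda>i. v (e i))"
  have M: "M \<in> carrier_mat n n" by (simp add: M_def)
  obtain k0 where k0: "k0 < n" "e k0 = i0"
    using e assms(3) by (auto simp: bij_betw_def)
  have "w \<noteq> 0\<^sub>v n"
  proof
    assume "w = 0\<^sub>v n"
    then have "vec_index w k0 = 0" using k0 by simp
    with k0 assms(4) show False by (simp add: w_def)
  qed
  moreover have "of_int_hom.mat_hom M *\<^sub>v w = x \<cdot>\<^sub>v w"
  proof (rule eq_vecI)
    fix i assume "i < dim_vec (x \<cdot>\<^sub>v w)"
    then have i: "i < n" by (simp add: w_def)
    then have "e i \<in> I" using e by (auto simp: bij_betw_def)
    with c have "x * v (e i) = (\<Sum>j\<in>I. of_int (c (e i) j) * v j)" by blast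
    also have "\<dots> = (\<Sum>j<n. of_int (c (e i) (e j)) * v (e j))"
      by (rule sum.reindex_bij_betw[OF e, symmetric])
    finally show "vec_index (of_int_hom.mat_hom M *\<^sub>v w) i = vec_index (x \<cdot>\<^sub>v w) i"
      using i by (simp add: M_def w_def scalar_prod_def atLeast0LessThan)
  qed (simp add: M_def w_def)
  ultimately have "eigenvector (of_int_hom.mat_hom M) w x"
    using M by (auto simp: eigenvector_def w_def)
  then have "poly (char_poly (of_int_hom.mat_hom M)) x = 0"
    using eigenvalue_root_char_poly[of "of_int_hom.mat_hom M" n x] M
    by (auto simp: eigenvalue_def)
  then have "poly (of_int_poly (char_poly M)) x = 0"
    using of_int_hom.char_poly_hom[OF M] by metis
  moreover have "Polynomial.lead_coeff (char_poly M) = 1"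
    using degree_monic_char_poly[OF M] by auto
  ultimately show ?thesis
    unfolding algebraic_int_altdef_ipoly by blast
qed

lemma algebraic_int_power_reduce:
  assumes "algebraic_int (x :: complex)"
  obtains m c where "m > 0" "x ^ m = (\<Sum>i<m. of_int (c i :: int) * x ^ i)"
proof -
  obtain p where p: "poly (map_poly of_int p) x = 0" "Polynomial.lead_coeff p = 1"
    using assms unfolding algebraic_int_altdef_ipoly by blast
  define m where "m = Polynomial.degree p"
  have "m > 0"
  proof (rule ccontr)
    assume "\<not> m > 0"
    then have "p = 1" using p(2) unfolding m_def
      by (metis degree_0_id gr0I of_nat_1 one_pCons)
    with p(1) show False by simp
  qed
  have "poly (map_poly of_int p) x = (\<Sum>i\<le>m. of_int (Polynomial.coeff p i) * x ^ i)"
    by (simp add: poly_altdef m_def degree_map_poly coeff_map_poly)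
  also have "\<dots> = (\<Sum>i<m. of_int (Polynomial.coeff p i) * x ^ i) + x ^ m"
    using p(2) unfolding lessThan_Suc_atMost[symmetric] m_def by simp
  finally have "x ^ m = (\<Sum>i<m. of_int (- Polynomial.coeff p i) * x ^ i)"
    using p(1) by (simp add: sum_negf add_eq_0_iff)
  then show ?thesis by (rule that[OF \<open>m > 0\<close>])
qed

text \<open>Multiplication by \<open>x\<close> raises the first exponent by one, and at
  \<open>i = m - 1\<close> the relation for \<open>x ^ m\<close> brings the result back into range.
  The second exponent is untouched, so \<open>y\<close> and \<open>n\<close> are arbitrary.\<close>

lemma int_acts_powers:
  assumes "x ^ m = (\<Sum>i<m. of_int (c i :: int) * x ^ i)"
  shows "int_acts (\<lambda>(i,j). x ^ i * y ^ j) ({..<m} \<times> {..<n}) x"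
proof -
  define d where "d = (\<lambda>(i::nat,j::nat) (k,l). if j = l then if Suc i = m then c k else if k = Suc i then 1 else 0 else (0::int))"
  have "x * (x ^ i * y ^ j) = (\<Sum>q\<in>{..<m} \<times> {..<n}. of_int (d (i,j) q) * (case q of (k,l) \<Rightarrow> x ^ k * y ^ l))"
    if ij: "i < m" "j < n" for i j
  proof -
    have "(\<Sum>q\<in>{..<m} \<times> {..<n}. of_int (d (i,j) q) * (case q of (k,l) \<Rightarrow> x ^ k * y ^ l))
       = (\<Sum>k<m. \<Sum>l<n. of_int (d (i,j) (k,l)) * (x ^ k * y ^ l))"
      by (simp add: sum.cartesian_product split_def)
    also have "\<dots> = (\<Sum>k<m. \<Sum>l<n. if l = j then of_int (if Suc i = m then c k else if k = Suc i then 1 else 0) * (x ^ k * y ^ j) else 0)"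
      by (intro sum.cong) (auto simp: d_def)
    also have "\<dots> = (\<Sum>k<m. of_int (if Suc i = m then c k else if k = Suc i then 1 else 0) * (x ^ k * y ^ j))"
      using ij by simp
    also have "\<dots> = (\<Sum>k<m. of_int (if Suc i = m then c k else if k = Suc i then 1 else 0) * x ^ k) * y ^ j"
      by (simp only: sum_distrib_right mult.assoc)
    also have "(\<Sum>k<m. of_int (if Suc i = m then c k else if k = Suc i then 1 else 0) * x ^ k) = x ^ Suc i"
    proof (cases "Suc i = m")
      case True
      with assms show ?thesis by auto
    next
      case False
      then have "Suc i < m" using ij by simp
      have "(\<Sum>k<m. of_int (if Suc i = m then c k else if k = Suc i then 1 else 0) * x ^ k)
        = (\<Sum>k<m. if k = Suc i then x ^ k else 0)"
        using False by (intro sum.cong) auto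
      also have "\<dots> = x ^ Suc i" using \<open>Suc i < m\<close> by (subst sum.delta) auto
      finally show ?thesis .
    qed
    finally show ?thesis by (simp add: mult_ac)
  qed
  then show ?thesis unfolding int_acts_def by (intro exI[of _ d]) auto
qed

lemma int_acts_swap:
  assumes "int_acts (\<lambda>(i,j). v i j) (A \<times> B) x"
  shows "int_acts (\<lambda>(j,i). v i j) (B \<times> A) x"
proof -
  obtain c where c: "\<forall>q\<in>A \<times> B. x * (case q of (i,j) \<Rightarrow> v i j) = (\<Sum>r\<in>A \<times> B. of_int (c q r) * (case r of (i,j) \<Rightarrow> v i j))"
    using assms unfolding int_acts_def by blast
  have "x * v i j = (\<Sum>r\<in>B \<times> A. of_int (c (i,j) (prod.swap r)) * (case r of (j,i) \<Rightarrow> v i j))"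
    if "i \<in> A" "j \<in> B" for i j
  proof -
    have "x * v i j = (\<Sum>r\<in>A \<times> B. of_int (c (i,j) r) * (case r of (i,j) \<Rightarrow> v i j))"
      using c that by force
    also have "\<dots> = (\<Sum>r\<in>B \<times> A. of_int (c (i,j) (prod.swap r)) * (case r of (j,i) \<Rightarrow> v i j))"
      by (rule sum.reindex_bij_witness[of _ prod.swap prod.swap]) auto
    finally show ?thesis .
  qed
  then show ?thesis unfolding int_acts_def
    by (intro exI[of _ "\<lambda>q r. c (prod.swap q) (prod.swap r)"]) auto
qed

lemma
  fixes x y :: complex
  assumes "algebraic_int x" "algebraic_int y"
  shows algebraic_int_add: "algebraic_int (x + y)"
    and algebraic_int_mult: "algebraic_int (x * y)"
proof -
  obtain m c where m: "m > 0" "x ^ m = (\<Sum>i<m. of_int (c i :: int) * x ^ i)"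
    by (rule algebraic_int_power_reduce[OF assms(1)])
  obtain n d where n: "n > 0" "y ^ n = (\<Sum>i<n. of_int (d i :: int) * y ^ i)"
    by (rule algebraic_int_power_reduce[OF assms(2)])
  let ?v = "\<lambda>(i,j). x ^ i * y ^ j" and ?I = "{..<m} \<times> {..<n}"
  have x: "int_acts ?v ?I x" by (rule int_acts_powers[OF m(2)])
  have "int_acts (\<lambda>(i,j). y ^ i * x ^ j) ({..<n} \<times> {..<m}) y"
    by (rule int_acts_powers[OF n(2)])
  from int_acts_swap[OF this] have y: "int_acts ?v ?I y"
    by (simp add: mult.commute)
  have I: "finite ?I" "(0,0) \<in> ?I" "?v (0,0) \<noteq> 0" using m(1) n(1) by auto
  show "algebraic_int (x + y)"
    by (rule int_acts_imp_algebraic_int[OF int_acts_add[OF x y] I])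
  show "algebraic_int (x * y)"
    by (rule int_acts_imp_algebraic_int[OF int_acts_mult[OF x y] I])
qed

lemma algebraic_int_diff:
  "algebraic_int (x::complex) \<Longrightarrow> algebraic_int y \<Longrightarrow> algebraic_int (x - y)"
  using algebraic_int_add[of x "- y"] by auto

lemma algebraic_int_power:
  "algebraic_int (x::complex) \<Longrightarrow> algebraic_int (x ^ n)"
  by (induction n) (auto intro: algebraic_int_mult)

lemma algebraic_multiple_algebraic_int:
  assumes "algebraic (x :: complex)"
  obtains n :: nat where "n > 0" "algebraic_int (of_nat n * x)"
proof -
  obtain p where p: "p \<noteq> 0" "poly (map_poly of_int p) x = 0"
    using algebraicE'[OF assms] by blast
  define d where "d = Polynomial.degree p"
  define a where "a = Polynomial.lead_coeff p"
  have a: "a \<noteq> 0" using p(1) by (simp add: a_def)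
  have "of_int a * x ^ d = - (\<Sum>i<d. of_int (Polynomial.coeff p i) * x ^ i)"
  proof -
    have "0 = (\<Sum>i\<le>d. of_int (Polynomial.coeff p i) * x ^ i)"
      using p(2) by (simp add: poly_altdef d_def degree_map_poly coeff_map_poly)
    also have "\<dots> = (\<Sum>i<d. of_int (Polynomial.coeff p i) * x ^ i) + of_int a * x ^ d"
      unfolding lessThan_Suc_atMost[symmetric] a_def d_def by simp
    finally show ?thesis by (simp add: add_eq_0_iff2)
  qed
  have d0: "d > 0"
  proof (rule ccontr)
    assume "\<not> d > 0"
    with \<open>of_int a * x ^ d = _\<close> a show False by simp
  qed
  let ?y = "of_int a * x"
  \<comment> \<open>Multiplying the equation of \<open>x\<close> by \<open>a ^ (d - 1)\<close> turns
    it into a monic equation for \<open>a * x\<close>; these are its coefficients after solving for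
    the top power.\<close>
  define c where "c = (\<lambda>i. - Polynomial.coeff p i * a ^ (d - 1 - i))"
  have red: "?y ^ d = (\<Sum>i<d. of_int (c i) * ?y ^ i)"
  proof -
    have "?y ^ d = of_int a ^ (d - 1) * (of_int a * x ^ d)"
      using d0 by (cases d) (simp_all add: power_mult_distrib mult_ac)
    also have "\<dots> = (\<Sum>i<d. of_int (- Polynomial.coeff p i) * of_int a ^ (d - 1) * x ^ i)"
      unfolding \<open>of_int a * x ^ d = _\<close> by (simp add: sum_distrib_left sum_negf mult_ac)
    also have "\<dots> = (\<Sum>i<d. of_int (c i) * ?y ^ i)"
    proof (rule sum.cong)
      fix i assume "i \<in> {..<d}"
      then have "(of_int a :: complex) ^ (d - 1) = of_int a ^ (d - 1 - i) * of_int a ^ i"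
        by (simp add: power_add[symmetric])
      then show "of_int (- Polynomial.coeff p i) * of_int a ^ (d - 1) * x ^ i = of_int (c i) * ?y ^ i"
        by (simp add: c_def power_mult_distrib mult_ac)
    qed simp
    finally show ?thesis .
  qed
  have "int_acts (\<lambda>(i,j). ?y ^ i * 1 ^ j) ({..<d} \<times> {..<(1::nat)}) ?y"
    by (rule int_acts_powers[OF red])
  then have y: "algebraic_int ?y"
    by (rule int_acts_imp_algebraic_int[of _ _ _ "(0,0)"]) (use d0 in auto)
  have "of_nat (nat \<bar>a\<bar>) * x = ?y \<or> of_nat (nat \<bar>a\<bar>) * x = - ?y"
    by (cases "a \<ge> 0") auto
  then have "algebraic_int (of_nat (nat \<bar>a\<bar>) * x)" using y by auto
  moreover have "nat \<bar>a\<bar> > 0" using a by simp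
  ultimately show ?thesis using that by metis
qed

section \<open>The ring of integers of a number field\<close>

text \<open>A bound on the rational dimension, phrased with integer relations so that coefficients
  can be divided by their gcd and reduced modulo a prime.\<close>

definition rank_le :: "nat \<Rightarrow> complex set \<Rightarrow> bool" where
  "rank_le D A \<longleftrightarrow> (\<forall>B\<subseteq>A. finite B \<longrightarrow> card B > D \<longrightarrow>
     (\<exists>c :: complex \<Rightarrow> int. (\<exists>b\<in>B. c b \<noteq> 0) \<and> (\<Sum>b\<in>B. of_int (c b) * b) = 0))"

text \<open>Closure is kept as plain set membership, and of the dimension only the bound
  \<open>D\<close>. The locale is applied both to a fixed number field and to the field generated by
  the coordinates of a point.\<close>

locale nfield =
  fixes F :: "complex set" and D :: nat
  assumes one_F: "1 \<in> F"
    and add_F: "x \<in> F \<Longrightarrow> y \<in> F \<Longrightarrow> x + y \<in> F"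
    and mult_F: "x \<in> F \<Longrightarrow> y \<in> F \<Longrightarrow> x * y \<in> F"
    and minus_F: "x \<in> F \<Longrightarrow> - x \<in> F"
    and inverse_F: "x \<in> F \<Longrightarrow> inverse x \<in> F"
    and algebraic_F: "x \<in> F \<Longrightarrow> algebraic x"
    and rank_F: "rank_le D F"
begin

lemma zero_F: "0 \<in> F"
  using add_F[OF one_F minus_F[OF one_F]] by simp

lemma diff_F: "x \<in> F \<Longrightarrow> y \<in> F \<Longrightarrow> x - y \<in> F"
  using add_F[of x "- y"] minus_F[of y] by simp

lemma divide_F: "x \<in> F \<Longrightarrow> y \<in> F \<Longrightarrow> x / y \<in> F"
  using mult_F[of x "inverse y"] inverse_F[of y] by (simp add: field_simps)

lemma power_F: "x \<in> F \<Longrightarrow> x ^ n \<in> F"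
  by (induction n) (auto intro: one_F mult_F)

lemma of_nat_F: "of_nat n \<in> F"
  by (induction n) (auto intro: zero_F one_F add_F)

lemma of_int_F: "of_int n \<in> F"
  by (cases n) (auto intro: of_nat_F minus_F diff_F one_F)

lemma Rats_F: "x \<in> \<rat> \<Longrightarrow> x \<in> F"
  by (auto elim!: Rats_cases' intro: divide_F of_int_F)

lemma sum_F: "(\<And>i. i \<in> A \<Longrightarrow> f i \<in> F) \<Longrightarrow> sum f A \<in> F"
  by (induction A rule: infinite_finite_induct) (auto intro: zero_F add_F)

lemma prod_F: "(\<And>i. i \<in> A \<Longrightarrow> f i \<in> F) \<Longrightarrow> prod f A \<in> F"
  by (induction A rule: infinite_finite_induct) (auto intro: one_F mult_F)

definition Z where "Z = {x \<in> F. algebraic_int x}"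

lemma Z_F: "x \<in> Z \<Longrightarrow> x \<in> F"
  and Z_algebraic_int: "x \<in> Z \<Longrightarrow> algebraic_int x"
  by (auto simp: Z_def)

lemma zero_Z: "0 \<in> Z"
  and one_Z: "1 \<in> Z"
  and of_nat_Z: "of_nat n \<in> Z"
  and of_int_Z: "of_int k \<in> Z"
  by (auto simp: Z_def zero_F one_F of_nat_F of_int_F)

lemma add_Z: "x \<in> Z \<Longrightarrow> y \<in> Z \<Longrightarrow> x + y \<in> Z"
  and mult_Z: "x \<in> Z \<Longrightarrow> y \<in> Z \<Longrightarrow> x * y \<in> Z"
  and diff_Z: "x \<in> Z \<Longrightarrow> y \<in> Z \<Longrightarrow> x - y \<in> Z"
  and minus_Z: "x \<in> Z \<Longrightarrow> - x \<in> Z"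
  and power_Z: "x \<in> Z \<Longrightarrow> x ^ n \<in> Z"
  by (auto simp: Z_def add_F mult_F diff_F minus_F power_F
      algebraic_int_add algebraic_int_mult algebraic_int_diff algebraic_int_power)

lemma sum_Z: "(\<And>i. i \<in> A \<Longrightarrow> f i \<in> Z) \<Longrightarrow> sum f A \<in> Z"
  by (induction A rule: infinite_finite_induct) (auto intro: zero_Z add_Z)

text \<open>The quotient of \<open>Z\<close> by \<open>p\<close> is a vector space over the field
  with \<open>p\<close> elements, of dimension at most \<open>D\<close>: a family independent modulo
  \<open>p\<close> is independent over the integers, since an integer relation divided by the gcd of
  its coefficients stays nontrivial modulo \<open>p\<close>.\<close>

lemma residues_prime:
  assumes p: "Factorial_Ring.prime (p :: nat)"
  shows "\<exists>R. finite R \<and> R \<subseteq> Z \<and> (\<forall>x\<in>Z. \<exists>r\<in>R. \<exists>y\<in>Z. x = r + of_nat p * y)"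
proof -
  define P where "P = (\<lambda>B. B \<subseteq> Z \<and> finite B \<and>
    (\<forall>c :: complex \<Rightarrow> int. (\<exists>y\<in>Z. (\<Sum>b\<in>B. of_int (c b) * b) = of_nat p * y) \<longrightarrow> (\<forall>b\<in>B. int p dvd c b)))"
  have "P {}" by (simp add: P_def)
  moreover have "card B \<le> D" if "P B" for B
  proof (rule ccontr)
    assume "\<not> card B \<le> D"
    moreover have B: "B \<subseteq> Z" "finite B" using that by (auto simp: P_def)
    moreover have "Z \<subseteq> F" by (auto simp: Z_def)
    ultimately obtain c b where c: "b \<in> B" "c b \<noteq> 0" "(\<Sum>b\<in>B. of_int (c b :: int) * b) = 0"
      using rank_F unfolding rank_le_def by (meson leI order_trans)
    define g where "g = Gcd (c ` B)"
    have "g \<noteq> 0" using c by (auto simp: g_def)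
    define c' where "c' = (\<lambda>b. c b div g)"
    have cc: "c b = g * c' b" if "b \<in> B" for b
      using that by (simp add: c'_def g_def)
    have "of_int g * (\<Sum>b\<in>B. of_int (c' b) * b) = 0"
      using c(3) by (simp add: cc sum_distrib_left mult.assoc)
    then have "(\<Sum>b\<in>B. of_int (c' b) * b) = of_nat p * 0"
      using \<open>g \<noteq> 0\<close> by simp
    then have "\<forall>b\<in>B. int p dvd c' b"
      using that zero_Z unfolding P_def by blast
    then have "\<forall>b\<in>B. g * int p dvd c b"
      using cc by simp
    then have "g * int p dvd g" 
      unfolding g_def by (intro Gcd_greatest) auto
    then have "int p dvd 1" using \<open>g \<noteq> 0\<close> by simp
    then show False using p by simp
  qed
  \<comment> \<open>A largest family independent modulo \<open>p\<close> also spans modulo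
    \<open>p\<close>, which is \<open>repr\<close> below.\<close>
  ultimately have "\<exists>B. P B \<and> (\<forall>B'. P B' \<longrightarrow> card B' \<le> card B)"
    by (intro ex_has_greatest_nat[of P "{}" card "Suc D"]) (auto simp: less_Suc_eq_le)
  then obtain B where B: "P B" "\<And>B'. P B' \<Longrightarrow> card B' \<le> card B" by metis
  have BZ: "B \<subseteq> Z" "finite B" using B(1) by (auto simp: P_def)
  have repr: "\<exists>c :: complex \<Rightarrow> int. \<exists>y\<in>Z. x = (\<Sum>b\<in>B. of_int (c b) * b) + of_nat p * y" if x: "x \<in> Z" for x
  proof (cases "x \<in> B")
    case True
    have "(\<Sum>b\<in>B. of_int (if b = x then 1 else 0 :: int) * b) = (\<Sum>b\<in>B. if b = x then x else 0)"
      by (intro sum.cong) auto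
    also have "\<dots> = x" using True BZ(2) by simp
    finally show ?thesis
      by (intro exI[of _ "\<lambda>b. if b = x then 1 else 0"] bexI[of _ 0]) (simp_all add: zero_Z)
  next
    case False
    have "\<not> P (insert x B)"
      using B(2)[of "insert x B"] False BZ by auto
    then obtain c y where c: "y \<in> Z" "(\<Sum>b\<in>insert x B. of_int (c b :: int) * b) = of_nat p * y"
      "\<exists>b\<in>insert x B. \<not> int p dvd c b"
      using BZ x unfolding P_def by auto
    have s: "of_int (c x) * x + (\<Sum>b\<in>B. of_int (c b) * b) = of_nat p * y"
      using c(2) False BZ by simp
    have "\<not> int p dvd c x"
    proof
      assume d: "int p dvd c x"
      then obtain k where "c x = int p * k" by blast
      then have "(\<Sum>b\<in>B. of_int (c b) * b) = of_nat p * (y - of_int k * x)"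
        using s by (simp add: algebra_simps)
      moreover have "y - of_int k * x \<in> Z" by (intro diff_Z mult_Z of_int_Z c x)
      ultimately have "\<forall>b\<in>B. int p dvd c b" using B(1) unfolding P_def by blast
      with d c(3) show False by blast
    qed
    then have "coprime (int p) (c x)" using p
      by (metis prime_imp_coprime prime_nat_int_transfer)
    \<comment> \<open>\<open>u\<close> inverts the coefficient of \<open>x\<close> modulo
      \<open>p\<close>, so the relation can be solved for \<open>x\<close>.\<close>
    then obtain u v where uv: "u * c x + v * int p = 1"
      by (metis bezout_int coprime_iff_gcd_eq_1 gcd.commute)
    have "x = of_int (u * c x + v * int p) * x" using uv by simp
    also have "\<dots> = of_int u * (of_int (c x) * x) + of_nat p * (of_int v * x)"
      by (simp add: algebra_simps)
    also have "of_int (c x) * x = of_nat p * y - (\<Sum>b\<in>B. of_int (c b) * b)"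
      using s by (simp add: algebra_simps)
    finally have "x = (\<Sum>b\<in>B. of_int (- u * c b) * b) + of_nat p * (of_int u * y + of_int v * x)"
      by (simp add: algebra_simps sum_distrib_left sum_negf)
    then show ?thesis using c(1) x
      by (intro exI[of _ "\<lambda>b. - u * c b"] bexI[of _ "of_int u * y + of_int v * x"] add_Z mult_Z of_int_Z)
  qed
  define R where "R = (\<lambda>c. \<Sum>b\<in>B. of_int (c b :: int) * b) ` (B \<rightarrow>\<^sub>E {0..<int p})"
  have "finite R" unfolding R_def by (intro finite_imageI finite_PiE) (auto simp: BZ)
  moreover have "R \<subseteq> Z" unfolding R_def using BZ by (auto intro!: sum_Z mult_Z of_int_Z)
  moreover have "\<exists>r\<in>R. \<exists>y\<in>Z. x = r + of_nat p * y" if x: "x \<in> Z" for x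
  proof -
    obtain c y where c: "y \<in> Z" "x = (\<Sum>b\<in>B. of_int (c b :: int) * b) + of_nat p * y"
      using repr[OF x] by blast
    define d where "d = restrict (\<lambda>b. c b mod int p) B"
    have "(\<Sum>b\<in>B. of_int (c b) * b) = (\<Sum>b\<in>B. of_int (d b) * b + of_nat p * (of_int (c b div int p) * b))"
    proof (intro sum.cong refl)
      fix b assume "b \<in> B"
      have "of_int (c b) = (of_int (c b mod int p + int p * (c b div int p)) :: complex)" by simp
      then have "of_int (c b) = of_int (c b mod int p) + of_nat p * (of_int (c b div int p) :: complex)"
        by (simp only: of_int_add of_int_mult of_int_of_nat_eq)
      then show "of_int (c b) * b = of_int (d b) * b + of_nat p * (of_int (c b div int p) * b)"
        using \<open>b \<in> B\<close> by (simp add: d_def algebra_simps)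
    qed
    also have "\<dots> = (\<Sum>b\<in>B. of_int (d b) * b) + of_nat p * (\<Sum>b\<in>B. of_int (c b div int p) * b)"
      by (simp add: sum.distrib sum_distrib_left)
    finally have "x = (\<Sum>b\<in>B. of_int (d b) * b) + of_nat p * ((\<Sum>b\<in>B. of_int (c b div int p) * b) + y)"
      using c(2) by (simp add: algebra_simps)
    moreover have "(\<Sum>b\<in>B. of_int (d b) * b) \<in> R"
      unfolding R_def using p prime_gt_0_nat[OF p] by (intro imageI) (auto simp: d_def)
    moreover have "(\<Sum>b\<in>B. of_int (c b div int p) * b) + y \<in> Z"
      using BZ c(1) by (auto intro!: sum_Z mult_Z of_int_Z add_Z)
    ultimately show ?thesis by blast
  qed
  ultimately show ?thesis by blast
qed

text \<open>Splitting off a prime factor \<open>p\<close> of \<open>n\<close>, residues are written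
  with two digits \<open>q + p * r\<close>, one modulo \<open>p\<close> and one modulo
  \<open>n / p\<close>.\<close>

lemma residues:
  assumes "n > 0"
  shows "\<exists>R. finite R \<and> R \<subseteq> Z \<and> (\<forall>x\<in>Z. \<exists>r\<in>R. \<exists>y\<in>Z. x = r + of_nat n * y)"
  using assms
proof (induction n rule: less_induct)
  case (less n)
  show ?case
  proof (cases "n = 1")
    case True
    then show ?thesis by (intro exI[of _ "{0}"]) (simp add: zero_Z)
  next
    case False
    then obtain p m where p: "Factorial_Ring.prime p" "n = p * m"
      using prime_factor_nat[of n] by blast
    then have "m > 0" "m < n" using less.prems prime_gt_1_nat[OF p(1)] by auto
    then obtain R where R: "finite R" "R \<subseteq> Z" "\<forall>x\<in>Z. \<exists>r\<in>R. \<exists>y\<in>Z. x = r + of_nat m * y"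
      using less.IH[OF \<open>m < n\<close> \<open>m > 0\<close>] by (elim exE conjE) (rule that)
    obtain Q where Q: "finite Q" "Q \<subseteq> Z" "\<forall>x\<in>Z. \<exists>r\<in>Q. \<exists>y\<in>Z. x = r + of_nat p * y"
      using residues_prime[OF p(1)] by (elim exE conjE) (rule that)
    define T where "T = (\<lambda>(q,r). q + of_nat p * r) ` (Q \<times> R)"
    have "finite T" "T \<subseteq> Z" using R Q by (auto simp: T_def intro!: add_Z mult_Z of_nat_Z)
    moreover have "\<exists>t\<in>T. \<exists>y\<in>Z. x = t + of_nat n * y" if x: "x \<in> Z" for x
    proof -
      obtain q z where q: "q \<in> Q" "z \<in> Z" "x = q + of_nat p * z" using Q x by blast
      obtain r y where r: "r \<in> R" "y \<in> Z" "z = r + of_nat m * y" using R q by blast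
      have "x = (q + of_nat p * r) + of_nat n * y"
        using q r p by (simp add: algebra_simps)
      moreover have "q + of_nat p * r \<in> T" using q r by (auto simp: T_def)
      ultimately show ?thesis using r by blast
    qed
    ultimately show ?thesis by blast
  qed
qed

text \<open>The form in which finiteness modulo \<open>n\<close> is applied: to powers of one
  element, to multiples of powers, and to a sequence of integers with bounded conjugates.\<close>

lemma pigeonhole_Z:
  fixes f :: "nat \<Rightarrow> complex"
  assumes n: "n > 0" and "infinite A" and f: "\<And>i. i \<in> A \<Longrightarrow> f i \<in> Z"
  obtains j k y where "j \<in> A" "k \<in> A" "j < k" "y \<in> Z" "f k - f j = of_nat n * y"
proof -
  obtain R where R: "finite R" "R \<subseteq> Z" "\<forall>x\<in>Z. \<exists>r\<in>R. \<exists>y\<in>Z. x = r + of_nat n * y"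
    using residues[OF n] by (elim exE conjE) (rule that)
  then have "\<forall>i\<in>A. \<exists>r. r \<in> R \<and> (\<exists>y\<in>Z. f i = r + of_nat n * y)" using f by blast
  then obtain r where r: "\<forall>i\<in>A. r i \<in> R \<and> (\<exists>y\<in>Z. f i = r i + of_nat n * y)"
    by (metis (no_types))
  then have "finite (r ` A)" using R(1) by (meson finite_subset image_subsetI)
  then have "\<not> inj_on r A" using assms(2) finite_imageD by blast
  then obtain i j where ij: "i \<in> A" "j \<in> A" "i < j" "r i = r j"
    unfolding inj_on_def by (metis linorder_neqE_nat)
  obtain y z where "y \<in> Z" "z \<in> Z" "f i = r i + of_nat n * y" "f j = r j + of_nat n * z"
    using r ij by meson
  then have "z - y \<in> Z" "f j - f i = of_nat n * (z - y)"
    using ij by (auto intro: diff_Z simp: algebra_simps)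
  then show ?thesis using ij that by blast
qed

text \<open>Reduces questions modulo a nonzero element of \<open>Z\<close> to questions modulo a
  positive natural number, where \<open>residues\<close> applies. The number is a denominator of
  \<open>inverse a\<close>.\<close>

lemma dvd_nat_Z:
  assumes "a \<in> Z" "a \<noteq> 0"
  obtains n :: nat and y where "n > 0" "y \<in> Z" "of_nat n = a * y"
proof -
  have "inverse a \<in> F" using assms by (intro inverse_F Z_F)
  then obtain n :: nat where "n > 0" "algebraic_int (of_nat n * inverse a)"
    using algebraic_multiple_algebraic_int[OF algebraic_F] by metis
  moreover have "of_nat n * inverse a \<in> F" using \<open>inverse a \<in> F\<close> by (intro mult_F of_nat_F)
  moreover have "of_nat n = a * (of_nat n * inverse a)" using assms by simp
  ultimately show ?thesis using that[of n "of_nat n * inverse a"] by (simp add: Z_def)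
qed

lemma fraction_Z:
  assumes "x \<in> F"
  obtains n :: nat where "n > 0" "of_nat n * x \<in> Z"
  using algebraic_multiple_algebraic_int[OF algebraic_F[OF assms]] assms
  by (metis (mono_tags, lifting) Z_def mem_Collect_eq mult_F of_nat_F)

text \<open>All powers of \<open>b\<close> have a common denominator \<open>n\<close>. Two of the
  multiples \<open>n * b ^ k\<close> agree modulo \<open>n\<close>, so some
  \<open>b ^ k - b ^ j\<close> with \<open>j < k\<close> lies in \<open>Z\<close>, which is a monic
  equation for \<open>b\<close> over \<open>Z\<close>.\<close>

lemma almost_integral:
  assumes c: "c \<in> Z" "c \<noteq> 0" and b: "b \<in> F" and cb: "\<And>k. c * b ^ k \<in> Z"
  shows "b \<in> Z"
proof -
  obtain n y where n: "n > 0" "y \<in> Z" "of_nat n = c * y" by (rule dvd_nat_Z[OF c])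
  have [simp]: "of_nat n * b ^ k \<in> Z" for k
    using mult_Z[OF n(2) cb[of k]] n(3) by (simp add: mult_ac)
  then obtain j k z where jk: "j < k" "z \<in> Z" "of_nat n * b ^ k - of_nat n * b ^ j = of_nat n * z"
    by (rule pigeonhole_Z[OF n(1) infinite_UNIV_nat, of "\<lambda>k. of_nat n * b ^ k"]) auto
  then have z: "b ^ k - b ^ j = z" using n(1)
    by (metis mult_left_cancel of_nat_eq_0_iff not_gr_zero right_diff_distrib)
  let ?p = "Polynomial.monom 1 k - Polynomial.monom 1 j :: complex poly"
  have "Polynomial.degree ?p = k"
    using jk(1) degree_add_eq_left[of "- Polynomial.monom 1 j" "Polynomial.monom (1::complex) k"]
    by (simp add: degree_monom_eq)
  then have "algebraic_int b"
    using jk z by (intro algebraic_int_root[of z ?p b])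
      (auto simp: poly_monom Z_algebraic_int)
  then show ?thesis using b by (simp add: Z_def)
qed

section \<open>Ideals of the ring of integers\<close>

definition is_ideal :: "complex set \<Rightarrow> bool" where
  "is_ideal I \<longleftrightarrow> I \<subseteq> Z \<and> 0 \<in> I \<and> (\<forall>x\<in>I. \<forall>y\<in>I. x + y \<in> I) \<and> (\<forall>x\<in>I. \<forall>y\<in>Z. x * y \<in> I)"

lemma is_ideal_diff: "is_ideal I \<Longrightarrow> x \<in> I \<Longrightarrow> y \<in> I \<Longrightarrow> x - y \<in> I"
  unfolding is_ideal_def using minus_Z[OF one_Z] by (metis diff_conv_add_uminus mult.right_neutral mult_minus_right)

text \<open>An ideal containing \<open>n\<close> is a union of residue classes modulo
  \<open>n\<close>, so it is determined by the representatives it contains.\<close>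

lemma finite_ideals:
  assumes "n > 0"
  shows "finite {I. is_ideal I \<and> of_nat n \<in> I}"
proof -
  obtain R where R: "finite R" "R \<subseteq> Z" "\<forall>x\<in>Z. \<exists>r\<in>R. \<exists>y\<in>Z. x = r + of_nat n * y"
    using residues[OF assms] by (elim exE conjE) (rule that)
  have sub: "I \<subseteq> J" if I: "is_ideal I" "of_nat n \<in> I" and J: "is_ideal J" "of_nat n \<in> J" and eq: "I \<inter> R = J \<inter> R" for I J
  proof
    fix x assume x: "x \<in> I"
    then have "x \<in> Z" using I by (auto simp: is_ideal_def)
    then obtain r y where r: "r \<in> R" "y \<in> Z" "x = r + of_nat n * y" using R by blast
    have "of_nat n * y \<in> I" "of_nat n * y \<in> J" using I J r by (auto simp: is_ideal_def)
    then have "r \<in> I" using is_ideal_diff[OF I(1) x, of "of_nat n * y"] r by simp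
    then have "r \<in> J" using eq r by blast
    then show "x \<in> J" using r \<open>of_nat n * y \<in> J\<close> J by (auto simp: is_ideal_def)
  qed
  have inj: "inj_on (\<lambda>I. I \<inter> R) {I. is_ideal I \<and> of_nat n \<in> I}"
  proof (rule inj_onI)
    fix I J assume I: "I \<in> {I. is_ideal I \<and> of_nat n \<in> I}" and J: "J \<in> {I. is_ideal I \<and> of_nat n \<in> I}"
      and eq: "I \<inter> R = J \<inter> R"
    from I have I': "is_ideal I" "of_nat n \<in> I" by simp_all
    from J have J': "is_ideal J" "of_nat n \<in> J" by simp_all
    show "I = J"
      by (rule subset_antisym[OF sub[OF I' J' eq] sub[OF J' I' eq[symmetric]]])
  qed
  have "finite ((\<lambda>I. I \<inter> R) ` {I. is_ideal I \<and> of_nat n \<in> I})"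
    by (rule finite_subset[of _ "Pow R"]) (auto simp: R)
  then show ?thesis using inj by (rule finite_imageD)
qed

section \<open>Nonzero primes and their local generators\<close>

definition nonzero_prime :: "complex set \<Rightarrow> bool" where
  "nonzero_prime p \<longleftrightarrow> is_ideal p \<and> 1 \<notin> p \<and> (\<forall>a\<in>Z. \<forall>b\<in>Z. a * b \<in> p \<longrightarrow> a \<in> p \<or> b \<in> p) \<and> p \<noteq> {0}"

lemma nat_in_ideal:
  assumes "is_ideal I" "a \<in> I" "a \<noteq> 0"
  obtains n :: nat where "n > 0" "of_nat n \<in> I"
proof -
  have "a \<in> Z" using assms by (auto simp: is_ideal_def)
  obtain n y where n: "n > 0" "y \<in> Z" "of_nat n = a * y" by (rule dvd_nat_Z[OF \<open>a \<in> Z\<close> assms(3)])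
  then have "of_nat n \<in> I" using assms by (auto simp: is_ideal_def)
  then show ?thesis by (rule that[OF n(1)])
qed

lemma finite_ideals_containing:
  assumes "a \<in> Z" "a \<noteq> 0"
  shows "finite {I. is_ideal I \<and> a \<in> I}"
proof -
  obtain n y where n: "n > 0" "y \<in> Z" "of_nat n = a * y" by (rule dvd_nat_Z[OF assms])
  then have "{I. is_ideal I \<and> a \<in> I} \<subseteq> {I. is_ideal I \<and> of_nat n \<in> I}" by (auto simp: is_ideal_def)
  then show ?thesis using finite_ideals[OF n(1)] finite_subset by blast
qed

text \<open>Only finitely many ideals contain \<open>a\<close>, so among the proper ones above
  \<open>I\<close> there is a maximal one. Maximality makes every \<open>s\<close> outside it
  invertible modulo it, which gives primality.\<close>

lemma exists_nonzero_prime: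
  assumes I: "is_ideal I" "1 \<notin> I" "a \<in> I" "a \<noteq> 0"
  obtains p where "nonzero_prime p" "I \<subseteq> p"
proof -
  have "a \<in> Z" using I by (auto simp: is_ideal_def)
  define A where "A = {J. is_ideal J \<and> a \<in> J \<and> 1 \<notin> J}"
  have "finite A"
    by (rule finite_subset[OF _ finite_ideals_containing[OF \<open>a \<in> Z\<close> I(4)]]) (auto simp: A_def)
  moreover have "I \<in> A" using I by (simp add: A_def)
  ultimately have "\<exists>p\<in>A. I \<subseteq> p \<and> (\<forall>J\<in>A. p \<subseteq> J \<longrightarrow> p = J)"
    by (rule finite_has_maximal2)
  then obtain p where p: "p \<in> A" "I \<subseteq> p" "\<forall>J\<in>A. p \<subseteq> J \<longrightarrow> p = J"
    by (elim bexE conjE) (rule that)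
  have ip: "is_ideal p" and pZ: "p \<subseteq> Z" using p by (auto simp: A_def is_ideal_def)
  have pc: "x + y \<in> p" if "x \<in> p" "y \<in> p" for x y using ip that by (auto simp: is_ideal_def)
  have pm: "x * y \<in> p" if "x \<in> p" "y \<in> Z" for x y using ip that by (auto simp: is_ideal_def)
  have max: "\<exists>z\<in>Z. \<exists>q\<in>p. 1 = q + s * z" if s: "s \<in> Z" "s \<notin> p" for s
  proof -
    define J where "J = {q + s * z | q z. q \<in> p \<and> z \<in> Z}"
    have "is_ideal J" unfolding is_ideal_def
    proof (intro conjI ballI)
      show "J \<subseteq> Z" using pZ s by (auto simp: J_def intro!: add_Z mult_Z)
      show "0 \<in> J" using ip zero_Z unfolding J_def is_ideal_def
        by (intro CollectI exI[of _ 0]) auto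
    next
      fix x y assume "x \<in> J" "y \<in> J"
      then obtain q z q' z' where "x = q + s * z" "y = q' + s * z'" "q \<in> p" "z \<in> Z" "q' \<in> p" "z' \<in> Z"
        by (auto simp: J_def)
      moreover from this have "x + y = (q + q') + s * (z + z')" by (simp add: algebra_simps)
      ultimately show "x + y \<in> J" unfolding J_def
        by (intro CollectI exI[of _ "q + q'"] exI[of _ "z + z'"] conjI pc add_Z)
    next
      fix x y assume "x \<in> J" "y \<in> Z"
      then obtain q z where "x = q + s * z" "q \<in> p" "z \<in> Z" by (auto simp: J_def)
      moreover from this have "x * y = q * y + s * (z * y)" by (simp add: algebra_simps)
      ultimately show "x * y \<in> J" unfolding J_def using \<open>y \<in> Z\<close>
        by (intro CollectI exI[of _ "q * y"] exI[of _ "z * y"] conjI pm mult_Z)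
    qed
    moreover have pJ: "p \<subseteq> J"
    proof
      fix q assume "q \<in> p"
      then show "q \<in> J" unfolding J_def using zero_Z by (intro CollectI exI[of _ q] exI[of _ 0]) simp
    qed
    moreover have "s \<in> J" unfolding J_def using ip one_Z
      by (intro CollectI exI[of _ 0] exI[of _ 1]) (simp add: is_ideal_def)
    moreover have "a \<in> J" using pJ p(1) by (auto simp: A_def)
    moreover have "J = p" if "1 \<notin> J"
      using bspec[OF p(3), of J] pJ \<open>is_ideal J\<close> \<open>a \<in> J\<close> that by (simp add: A_def)
    ultimately have "1 \<in> J" using s by metis
    then show ?thesis by (auto simp: J_def)
  qed
  have "x \<in> p \<or> y \<in> p" if xy: "x \<in> Z" "y \<in> Z" "x * y \<in> p" for x y
  proof (rule ccontr)
    assume "\<not> (x \<in> p \<or> y \<in> p)"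
    then obtain z q where z: "z \<in> Z" "q \<in> p" "1 = q + x * z" "y \<notin> p" using max xy by blast
    have "y = y * (q + x * z)" using z by simp
    also have "\<dots> = q * y + (x * y) * z" by (simp add: algebra_simps)
    also have "\<dots> \<in> p" by (intro pc pm xy z)
    finally show False using z by blast
  qed
  then have "nonzero_prime p" using p I by (auto simp: nonzero_prime_def A_def)
  then show ?thesis by (rule that[OF _ p(2)])
qed

text \<open>The residue field is finite, so \<open>s\<close> has finite multiplicative order modulo \<open>p\<close>.\<close>

lemma nonzero_prime_unit:
  assumes p: "nonzero_prime p" and s: "s \<in> Z" "s \<notin> p"
  obtains t where "t \<in> Z" "1 - s * t \<in> p"
proof -
  have ip: "is_ideal p" using p by (simp add: nonzero_prime_def)
  obtain a where "a \<in> p" "a \<noteq> 0" using p by (auto simp: nonzero_prime_def is_ideal_def)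
  then obtain n :: nat where n: "n > 0" "of_nat n \<in> p" using nat_in_ideal[OF ip] by metis
  obtain j k y where jk: "j < k" "y \<in> Z" "s ^ k - s ^ j = of_nat n * y"
    by (rule pigeonhole_Z[OF n(1) infinite_UNIV_nat, of "\<lambda>k. s ^ k"]) (auto intro: power_Z s)
  have "s ^ j * (s ^ (k - j) - 1) = s ^ k - s ^ j"
    using jk(1) by (simp add: algebra_simps power_add[symmetric])
  then have "s ^ j * (s ^ (k - j) - 1) \<in> p" using jk n ip by (simp add: is_ideal_def)
  moreover have "s ^ j \<notin> p"
  proof (induction j)
    case 0 show ?case using p by (simp add: nonzero_prime_def)
  next
    case (Suc j) then show ?case using p s power_Z[OF s(1), of j] by (auto simp: nonzero_prime_def)
  qed
  ultimately have "s ^ (k - j) - 1 \<in> p" using p power_Z[OF s(1)] diff_Z one_Z by (meson nonzero_prime_def)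
  moreover have "0 \<in> p" using ip by (simp add: is_ideal_def)
  ultimately have "0 - (s ^ (k - j) - 1) \<in> p" using is_ideal_diff[OF ip, of 0 "s ^ (k - j) - 1"] by simp
  moreover have "s ^ (k - j) = s * s ^ (k - j - 1)" using jk(1) power_eq_if[of _ "k - j"] by simp
  ultimately have "1 - s * s ^ (k - j - 1) \<in> p" by simp
  then show ?thesis by (rule that[OF power_Z[OF s(1)]])
qed

text \<open>The prime \<open>p\<close> kills the class of \<open>y\<close> in
  \<open>Z / a Z\<close>, which is not zero. In other words \<open>y / a\<close> multiplies
  \<open>p\<close> into \<open>Z\<close> without being integral: the first step towards an inverse
  of \<open>p\<close>.\<close>

lemma nonzero_prime_associated:
  assumes p: "nonzero_prime p"
  obtains a y where "a \<in> Z" "a \<noteq> 0" "y \<in> Z" "\<not> (\<exists>z\<in>Z. y = a * z)" "\<forall>x\<in>p. \<exists>z\<in>Z. x * y = a * z"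
proof -
  have ip: "is_ideal p" and p1: "1 \<notin> p" using p by (auto simp: nonzero_prime_def)
  obtain a where a: "a \<in> p" "a \<noteq> 0" using p by (auto simp: nonzero_prime_def is_ideal_def)
  have aZ: "a \<in> Z" using a ip by (auto simp: is_ideal_def)
  \<comment> \<open>The annihilator of the class of \<open>y\<close> modulo \<open>a\<close>. There
    are only finitely many of these, as each contains \<open>a\<close>, so there is a maximal one
    among those inside \<open>p\<close>; it turns out to contain \<open>p\<close>.\<close>
  define I where "I = (\<lambda>y. {x \<in> Z. \<exists>z\<in>Z. x * y = a * z})"
  have is_idealI: "is_ideal (I y)" if "y \<in> Z" for y
    unfolding is_ideal_def
  proof (intro conjI ballI)
    show "I y \<subseteq> Z" by (auto simp: I_def)
    show "0 \<in> I y" using zero_Z by (auto simp: I_def)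
  next
    fix u v assume "u \<in> I y" "v \<in> I y"
    then obtain z z' where "u \<in> Z" "v \<in> Z" "z \<in> Z" "z' \<in> Z" "u * y = a * z" "v * y = a * z'"
      by (auto simp: I_def)
    then have "(u + v) * y = a * (z + z')" "u + v \<in> Z" "z + z' \<in> Z"
      by (auto simp: ring_distribs intro: add_Z)
    then show "u + v \<in> I y" by (auto simp: I_def)
  next
    fix u v assume "u \<in> I y" "v \<in> Z"
    then obtain z where "u \<in> Z" "z \<in> Z" "u * y = a * z" by (auto simp: I_def)
    then have "(u * v) * y = a * (z * v)" "u * v \<in> Z" "z * v \<in> Z"
      using \<open>v \<in> Z\<close> by (auto intro: mult_Z)
    then show "u * v \<in> I y" unfolding I_def by blast
  qed
  have aI: "a \<in> I y" if "y \<in> Z" for y using that aZ by (auto simp: I_def)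
  define A where "A = {J. \<exists>y\<in>Z. J = I y \<and> I y \<subseteq> p}"
  have "finite A"
    by (rule finite_subset[OF _ finite_ideals_containing[OF aZ a(2)]]) (auto simp: A_def is_idealI aI)
  moreover have "I 1 \<in> A"
  proof -
    have "I 1 \<subseteq> p" using a ip by (auto simp: I_def is_ideal_def)
    then show ?thesis using one_Z by (auto simp: A_def)
  qed
  ultimately have "\<exists>J\<in>A. I 1 \<subseteq> J \<and> (\<forall>J'\<in>A. J \<subseteq> J' \<longrightarrow> J = J')"
    by (rule finite_has_maximal2)
  then obtain J where J: "J \<in> A" "\<forall>J'\<in>A. J \<subseteq> J' \<longrightarrow> J = J'"
    by (elim bexE conjE) (rule that)
  from J(1) obtain y where y: "y \<in> Z" "J = I y" "I y \<subseteq> p" unfolding A_def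
    by (elim CollectE bexE conjE) (rule that)
  have ymax: "I w = I y" if "w \<in> Z" "I w \<subseteq> p" "I y \<subseteq> I w" for w
    using J(2) that y(2) unfolding A_def by (metis (mono_tags, lifting) mem_Collect_eq)
  have mono: "I y \<subseteq> I (w * y)" if "w \<in> Z" for w y
  proof
    fix x assume "x \<in> I y"
    then obtain z where "x \<in> Z" "z \<in> Z" "x * y = a * z" by (auto simp: I_def)
    then have "x * (w * y) = a * (z * w)" "z * w \<in> Z" using that by (auto intro: mult_Z simp: mult_ac)
    then show "x \<in> I (w * y)" using \<open>x \<in> Z\<close> unfolding I_def by blast
  qed
  \<comment> \<open>If \<open>x\<close> in \<open>p\<close> did not kill \<open>y\<close>,
    maximality would keep the annihilator of \<open>x ^ k * y\<close> equal to that of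
    \<open>y\<close> for every \<open>k\<close>. Two powers of \<open>x\<close> agree modulo
    \<open>a\<close>, so \<open>x ^ (k - j) - 1\<close> would kill \<open>x ^ j * y\<close> and lie
    in \<open>p\<close>, as does \<open>x ^ (k - j)\<close>; their difference is
    \<open>1\<close>.\<close>
  have "x \<in> I y" if x: "x \<in> p" for x
  proof (rule ccontr)
    assume nx: "x \<notin> I y"
    have xZ: "x \<in> Z" using x ip by (auto simp: is_ideal_def)
    have iter: "I (x ^ k * y) = I y" for k
    proof (induction k)
      case (Suc k)
      let ?w = "x ^ k * y"
      have wZ: "?w \<in> Z" using xZ y by (intro mult_Z power_Z)
      \<comment> \<open>An \<open>s\<close> outside \<open>p\<close> killing \<open>x * ?w\<close>
        would make \<open>x\<close> kill \<open>s * ?w\<close>; but that element has the same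
        annihilator as \<open>y\<close>.\<close>
      have "I (x * ?w) \<subseteq> p"
      proof
        fix s assume s: "s \<in> I (x * ?w)"
        show "s \<in> p"
        proof (rule ccontr)
          assume sp: "s \<notin> p"
          have sZ: "s \<in> Z" using s by (auto simp: I_def)
          have "I (s * ?w) \<subseteq> p"
          proof
            fix z assume z: "z \<in> I (s * ?w)"
            then have "z * s \<in> I ?w" using sZ by (auto simp: I_def mult.assoc intro: mult_Z)
            then have "z * s \<in> p" using Suc y by auto
            then show "z \<in> p" using p sp sZ z unfolding nonzero_prime_def I_def by blast
          qed
          then have "I (s * ?w) = I y" using ymax[of "s * ?w"] mono[OF sZ, of ?w] Suc sZ wZ mult_Z by auto
          moreover have "x \<in> I (s * ?w)" using s xZ by (auto simp: I_def mult_ac)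
          ultimately show False using nx by blast
        qed
      qed
      then have "I (x * ?w) = I y" using ymax[of "x * ?w"] mono[OF xZ, of ?w] Suc xZ wZ mult_Z by auto
      then show ?case by (simp add: mult.assoc)
    qed simp
    obtain n z where n: "n > 0" "z \<in> Z" "of_nat n = a * z" by (rule dvd_nat_Z[OF aZ a(2)])
    obtain j k w where jk: "j < k" "w \<in> Z" "x ^ k - x ^ j = of_nat n * w"
      by (rule pigeonhole_Z[OF n(1) infinite_UNIV_nat, of "\<lambda>k. x ^ k"]) (auto intro: power_Z xZ)
    have "(x ^ (k - j) - 1) * (x ^ j * y) = (x ^ k - x ^ j) * y"
      using jk(1) by (simp add: algebra_simps power_add[symmetric])
    also have "\<dots> = a * (z * w * y)" using jk n by simp
    finally have *: "(x ^ (k - j) - 1) * (x ^ j * y) = a * (z * w * y)" .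
    have "z * w * y \<in> Z" "x ^ (k - j) - 1 \<in> Z"
      using n jk y xZ by (simp_all add: mult_Z diff_Z power_Z one_Z)
    with * have "x ^ (k - j) - 1 \<in> I (x ^ j * y)"
      unfolding I_def by (intro CollectI conjI bexI)
    then have "x ^ (k - j) - 1 \<in> p" using iter y by blast
    moreover have "x ^ (k - j) \<in> p"
    proof -
      have "x ^ (k - j) = x * x ^ (k - j - 1)" using jk(1) power_eq_if[of _ "k - j"] by simp
      moreover have "x * x ^ (k - j - 1) \<in> p" using x ip power_Z[OF xZ, of "k - j - 1"] by (simp add: is_ideal_def)
      ultimately show ?thesis by simp
    qed
    ultimately have "x ^ (k - j) - (x ^ (k - j) - 1) \<in> p" by (rule is_ideal_diff[OF ip, rotated])
    then show False using p1 by simp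
  qed
  then have "\<forall>x\<in>p. \<exists>z\<in>Z. x * y = a * z" by (auto simp: I_def)
  moreover have "\<not> (\<exists>z\<in>Z. y = a * z)"
  proof
    assume "\<exists>z\<in>Z. y = a * z"
    then have "1 \<in> I y" using one_Z by (simp add: I_def)
    then show False using y(3) p1 by blast
  qed
  ultimately show ?thesis by (rule that[OF aZ a(2) y(1), rotated])
qed

text \<open>Multiplication by \<open>b = y / a\<close> maps \<open>p\<close> into \<open>Z\<close>.
  If it mapped \<open>p\<close> into itself, every \<open>c * b ^ k\<close> with \<open>c\<close> in
  \<open>p\<close> would be integral, and so would \<open>b\<close>. An element \<open>q\<close> of
  \<open>p\<close> with \<open>b * q\<close> outside \<open>p\<close> generates \<open>p\<close>
  locally, since \<open>(b * q) * x = q * (b * x)\<close> for \<open>x\<close> in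
  \<open>p\<close>.\<close>

lemma nonzero_prime_uniformizer:
  assumes p: "nonzero_prime p"
  obtains b q where "b \<in> F" "\<forall>x\<in>p. b * x \<in> Z" "q \<in> p" "b * q \<notin> p"
proof -
  obtain a y where ay: "a \<in> Z" "a \<noteq> 0" "y \<in> Z" "\<not> (\<exists>z\<in>Z. y = a * z)"
    "\<forall>x\<in>p. \<exists>z\<in>Z. x * y = a * z"
    by (rule nonzero_prime_associated[OF p])
  define b where "b = y / a"
  have bF: "b \<in> F" using ay by (auto simp: b_def intro: divide_F Z_F)
  have bx: "b * x \<in> Z" if "x \<in> p" for x
  proof -
    from bspec[OF ay(5) that] obtain z where "z \<in> Z" "x * y = a * z" by blast
    then have "b * x = z" using ay(2) by (simp add: b_def field_simps)
    then show ?thesis using \<open>z \<in> Z\<close> by simp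
  qed
  have "b \<notin> Z" using ay(2,4) by (auto simp: b_def field_simps)
  have "\<exists>q\<in>p. b * q \<notin> p"
  proof (rule ccontr)
    assume *: "\<not> (\<exists>q\<in>p. b * q \<notin> p)"
    obtain c where c: "c \<in> p" "c \<noteq> 0" using p by (auto simp: nonzero_prime_def is_ideal_def)
    have pZ: "p \<subseteq> Z" using p by (auto simp: nonzero_prime_def is_ideal_def)
    have "c * b ^ k \<in> p" for k
    proof (induction k)
      case (Suc k)
      then have "b * (c * b ^ k) \<in> p" using * by blast
      then show ?case by (simp add: mult_ac)
    qed (use c in simp)
    then have "b \<in> Z" using almost_integral[of c b] c pZ bF by blast
    with \<open>b \<notin> Z\<close> show False by blast
  qed
  then obtain q where "q \<in> p" "b * q \<notin> p" by metis
  moreover have "\<forall>x\<in>p. b * x \<in> Z" using bx by blast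
  ultimately show ?thesis using that[OF bF] by blast
qed

end

section \<open>Valuations at the finite places\<close>

lemma CC_simps [simp]:
  "carrier CC = UNIV" "x \<otimes>\<^bsub>CC\<^esub> y = x * y" "x \<oplus>\<^bsub>CC\<^esub> y = x + y" "\<zero>\<^bsub>CC\<^esub> = 0" "\<one>\<^bsub>CC\<^esub> = 1"
  by (simp_all add: ring_of_type_algebra_def)

section \<open>Identification with the ideals of the ring structure\<close>

context nfield
begin

abbreviation RI where "RI \<equiv> ring_of_integers F"

lemma RI_simps [simp]:
  "carrier RI = Z" "x \<otimes>\<^bsub>RI\<^esub> y = x * y" "x \<oplus>\<^bsub>RI\<^esub> y = x + y" "\<zero>\<^bsub>RI\<^esub> = 0" "\<one>\<^bsub>RI\<^esub> = 1"
  by (simp_all add: ring_of_integers_def Z_def)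

lemma cring_RI: "cring RI"
proof (rule cringI)
  show "abelian_group RI"
  proof (rule abelian_groupI)
    fix x assume "x \<in> carrier RI"
    then show "\<exists>y\<in>carrier RI. y \<oplus>\<^bsub>RI\<^esub> x = \<zero>\<^bsub>RI\<^esub>"
      by (intro bexI[of _ "- x"]) (simp_all add: minus_Z)
  qed (auto simp: add_Z zero_Z)
  show "comm_monoid RI"
    by (rule comm_monoidI) (auto simp: mult_Z one_Z)
qed (auto simp: algebra_simps)

lemma ideal_iff_is_ideal: "ideal I RI \<longleftrightarrow> is_ideal I"
proof
  assume "ideal I RI"
  then have i: "ideal I RI" and a: "additive_subgroup I RI" by (simp_all add: ideal.axioms(1))
  have "I \<subseteq> Z" using additive_subgroup.a_subset[OF a] by simp
  moreover have "0 \<in> I" using additive_subgroup.zero_closed[OF a] by simp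
  moreover have "x + y \<in> I" if "x \<in> I" "y \<in> I" for x y
    using additive_subgroup.a_closed[OF a that] by simp
  moreover have "x * y \<in> I" if "x \<in> I" "y \<in> Z" for x y
    using ideal.I_r_closed[OF i, of x y] that by simp
  ultimately show "is_ideal I" by (simp add: is_ideal_def)
next
  assume I: "is_ideal I"
  interpret R: cring RI by (rule cring_RI)
  have neg: "- x \<in> I" if "x \<in> I" for x using is_ideal_diff[OF I, of 0 x] that I by (simp add: is_ideal_def)
  show "ideal I RI"
  proof (rule idealI)
    show "ring RI" by (rule R.ring_axioms)
    show "subgroup I (add_monoid RI)"
    proof (rule R.add.subgroupI)
      show "I \<subseteq> carrier RI" using I by (simp add: is_ideal_def)
      show "I \<noteq> {}" using I by (auto simp: is_ideal_def)
      show "\<ominus>\<^bsub>RI\<^esub> a \<in> I" if "a \<in> I" for a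
      proof -
        have "a \<in> Z" using that I by (auto simp: is_ideal_def)
        then have "\<ominus>\<^bsub>RI\<^esub> a = - a"
          by (intro R.minus_equality) (simp_all add: minus_Z)
        then show ?thesis using neg[OF that] by simp
      qed
      show "a \<oplus>\<^bsub>RI\<^esub> b \<in> I" if "a \<in> I" "b \<in> I" for a b using I that by (simp add: is_ideal_def)
    qed
  qed (use I in \<open>auto simp: is_ideal_def mult.commute\<close>)
qed

lemma prime_iff_nonzero_prime: "primeideal p RI \<and> p \<noteq> {0} \<longleftrightarrow> nonzero_prime p"
proof
  assume *: "primeideal p RI \<and> p \<noteq> {0}"
  then interpret primeideal p RI by simp
  have p: "is_ideal p" using ideal_iff_is_ideal is_ideal by simp
  have "1 \<notin> p" using I_notcarr one_imp_carrier by auto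
  then show "nonzero_prime p" using p * I_prime by (auto simp: nonzero_prime_def)
next
  assume p: "nonzero_prime p"
  then have "primeideal p RI"
    by (intro primeidealI cring_RI) (auto simp: ideal_iff_is_ideal nonzero_prime_def is_ideal_def one_Z)
  then show "primeideal p RI \<and> p \<noteq> {0}" using p by (simp add: nonzero_prime_def)
qed

lemma finite_places_eq: "finite_places F = {p. nonzero_prime p}"
  by (auto simp: finite_places_def prime_iff_nonzero_prime[symmetric])

definition ipow :: "complex set \<Rightarrow> nat \<Rightarrow> complex set" where
  "ipow p k = p [^]\<^bsub>ideals_set RI\<^esub> k"

lemma ipow_0: "ipow p 0 = Z"
  and ipow_Suc: "ipow p (Suc k) = ideal_prod RI (ipow p k) p"
  by (simp_all add: ipow_def nat_pow_def ideals_set_def)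

lemma is_ideal_ipow:
  assumes "is_ideal p"
  shows "is_ideal (ipow p k)"
proof (induction k)
  case 0
  show ?case by (auto simp: ipow_0 is_ideal_def zero_Z add_Z mult_Z)
next
  case (Suc k)
  interpret R: cring RI by (rule cring_RI)
  show ?case
    using R.ideal_prod_is_ideal[of "ipow p k" p] Suc assms
    by (simp add: ipow_Suc ideal_iff_is_ideal)
qed

end

text \<open>\<open>q\<close> is a uniformizer at \<open>p\<close>, and \<open>b\<close> is its
  inverse up to the local unit \<open>b * q\<close>.\<close>

locale nfield_prime = nfield +
  fixes p :: "complex set" and b q :: complex
  assumes nonzero_prime_p: "nonzero_prime p" and b_F: "b \<in> F" and b_p: "x \<in> p \<Longrightarrow> b * x \<in> Z"
    and q_p: "q \<in> p" and bq: "b * q \<notin> p"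
begin

lemma is_ideal_p: "is_ideal p" using nonzero_prime_p by (simp add: nonzero_prime_def)

lemma p_Z: "x \<in> p \<Longrightarrow> x \<in> Z" using is_ideal_p by (auto simp: is_ideal_def)

lemma p_mult: "x \<in> p \<Longrightarrow> y \<in> Z \<Longrightarrow> x * y \<in> p" "x \<in> p \<Longrightarrow> y \<in> Z \<Longrightarrow> y * x \<in> p"
  using is_ideal_p by (auto simp: is_ideal_def mult.commute)

lemma p_prime: "x \<in> Z \<Longrightarrow> y \<in> Z \<Longrightarrow> x \<notin> p \<Longrightarrow> y \<notin> p \<Longrightarrow> x * y \<notin> p"
  using nonzero_prime_p by (auto simp: nonzero_prime_def)

lemma one_p: "1 \<notin> p" using nonzero_prime_p by (simp add: nonzero_prime_def)

lemma q_Z: "q \<in> Z" by (rule p_Z[OF q_p])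

lemma bq_Z: "b * q \<in> Z" by (rule b_p[OF q_p])

lemma q_nz: "q \<noteq> 0"
  using bq is_ideal_p by (auto simp: is_ideal_def)

lemma nz: "x \<notin> p \<Longrightarrow> x \<noteq> 0"
  using is_ideal_p by (auto simp: is_ideal_def)

text \<open>Membership in the \<open>k\<close>-th power of the maximal ideal after localising at
  \<open>p\<close>, with the denominator \<open>s\<close> cleared.\<close>

definition ord_ge :: "nat \<Rightarrow> complex \<Rightarrow> bool" where
  "ord_ge k a \<longleftrightarrow> a \<in> Z \<and> (\<exists>s c. s \<in> Z \<and> s \<notin> p \<and> c \<in> Z \<and> s * a = q ^ k * c)"

lemma ord_geI: "a \<in> Z \<Longrightarrow> s \<in> Z \<Longrightarrow> s \<notin> p \<Longrightarrow> c \<in> Z \<Longrightarrow> s * a = q ^ k * c \<Longrightarrow> ord_ge k a"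
  unfolding ord_ge_def by metis

lemma ord_geE:
  assumes "ord_ge k a"
  obtains s c where "a \<in> Z" "s \<in> Z" "s \<notin> p" "c \<in> Z" "s * a = q ^ k * c"
  using assms unfolding ord_ge_def by metis

text \<open>One more factor \<open>q\<close> is produced by inserting the local unit
  \<open>b * q\<close> and using that \<open>b * y\<close> is integral.\<close>

lemma ord_ge_mult_p:
  assumes "ord_ge k x" "y \<in> p"
  shows "ord_ge (Suc k) (x * y)"
proof -
  obtain s c where s: "x \<in> Z" "s \<in> Z" "s \<notin> p" "c \<in> Z" "s * x = q ^ k * c"
    by (rule ord_geE[OF assms(1)])
  have "(s * (b * q)) * (x * y) = (s * x) * q * (b * y)" by simp
  also have "\<dots> = q ^ Suc k * (c * (b * y))" using s(5) by simp
  finally have eq: "(s * (b * q)) * (x * y) = q ^ Suc k * (c * (b * y))" .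
  show ?thesis
    by (rule ord_geI[OF mult_Z[OF s(1) p_Z[OF assms(2)]] mult_Z[OF s(2) bq_Z] p_prime[OF s(2) bq_Z s(3) bq]
          mult_Z[OF s(4) b_p[OF assms(2)]] eq])
qed

lemma ord_ge_add:
  assumes "ord_ge k x" "ord_ge k y"
  shows "ord_ge k (x + y)"
proof -
  obtain s c where s: "x \<in> Z" "s \<in> Z" "s \<notin> p" "c \<in> Z" "s * x = q ^ k * c"
    by (rule ord_geE[OF assms(1)])
  obtain t d where t: "y \<in> Z" "t \<in> Z" "t \<notin> p" "d \<in> Z" "t * y = q ^ k * d"
    by (rule ord_geE[OF assms(2)])
  have "(s * t) * (x + y) = t * (s * x) + s * (t * y)" by (simp add: algebra_simps)
  also have "\<dots> = q ^ k * (t * c + s * d)" using s t by (simp add: algebra_simps)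
  finally show ?thesis
    using s t by (intro ord_geI[of _ "s * t" "t * c + s * d"] add_Z mult_Z p_prime) simp_all
qed

lemma ipow_imp_ord_ge: "a \<in> ipow p k \<Longrightarrow> ord_ge k a"
proof (induction k arbitrary: a)
  case 0
  then show ?case by (intro ord_geI[of _ 1 a]) (simp_all add: ipow_0 one_Z one_p)
next
  case (Suc k)
  from Suc.prems have "a \<in> ideal_prod RI (ipow p k) p" by (simp add: ipow_Suc)
  then show ?case
    by (induction a rule: ideal_prod.induct) (simp_all add: Suc.IH ord_ge_mult_p ord_ge_add)
qed

text \<open>Together with \<open>almost_integral\<close> this shows that a nonzero element cannot
  lie in all powers of \<open>p\<close>.\<close>

lemma ipow_b: "a \<in> ipow p k \<Longrightarrow> b ^ k * a \<in> Z"
proof (induction k arbitrary: a)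
  case 0
  then show ?case by (simp add: ipow_0)
next
  case (Suc k)
  from Suc.prems have "a \<in> ideal_prod RI (ipow p k) p" by (simp add: ipow_Suc)
  then show ?case
  proof (induction a rule: ideal_prod.induct)
    case (prod i j)
    have "b ^ Suc k * (i * j) = (b ^ k * i) * (b * j)" by simp
    also have "\<dots> \<in> Z" by (rule mult_Z[OF Suc.IH[OF prod(1)] b_p[OF prod(2)]])
    finally show ?case by simp
  next
    case (sum s t)
    then show ?case by (simp add: distrib_left add_Z)
  qed
qed

lemma q_ipow: "q ^ k \<in> ipow p k"
proof (induction k)
  case (Suc k)
  then show ?case using ideal_prod.prod[OF Suc q_p, of RI] by (simp add: ipow_Suc mult.commute)
qed (simp add: ipow_0 one_Z)

text \<open>The errors multiply: \<open>1 - s * y\<close> in \<open>p ^ k\<close> and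
  \<open>1 - s * t\<close> in \<open>p\<close> have a product of the form \<open>1 - s * z\<close>
  in the next power.\<close>

lemma unit_mod_ipow:
  assumes "s \<in> Z" "s \<notin> p"
  shows "\<exists>y\<in>Z. 1 - s * y \<in> ipow p k"
proof (induction k)
  case 0
  show ?case using assms by (intro bexI[of _ 0]) (simp_all add: ipow_0 one_Z zero_Z)
next
  case (Suc k)
  then obtain y where y: "y \<in> Z" "1 - s * y \<in> ipow p k" by auto
  obtain t where t: "t \<in> Z" "1 - s * t \<in> p" by (rule nonzero_prime_unit[OF nonzero_prime_p assms])
  have "(1 - s * y) * (1 - s * t) = 1 - s * (y + t - s * y * t)" by (simp add: algebra_simps)
  moreover have "(1 - s * y) * (1 - s * t) \<in> ipow p (Suc k)"
    using ideal_prod.prod[OF y(2) t(2), of RI] by (simp add: ipow_Suc)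
  moreover have "y + t - s * y * t \<in> Z" using y t assms by (intro add_Z diff_Z mult_Z)
  ultimately show ?case by (intro bexI[of _ "y + t - s * y * t"]) simp_all
qed

text \<open>Passing to the localisation loses nothing: if \<open>s * a\<close> is a multiple of
  \<open>q ^ k\<close> and \<open>s * y\<close> is \<open>1\<close> modulo \<open>p ^ k\<close>,
  then \<open>a = (1 - s * y) * a + y * (s * a)\<close> lies in \<open>p ^ k\<close>.\<close>

lemma ipow_iff_ord_ge: "a \<in> ipow p k \<longleftrightarrow> ord_ge k a"
proof
  assume "ord_ge k a"
  then obtain s c where s: "a \<in> Z" "s \<in> Z" "s \<notin> p" "c \<in> Z" "s * a = q ^ k * c"
    by (rule ord_geE)
  obtain y where y: "y \<in> Z" "1 - s * y \<in> ipow p k" using unit_mod_ipow[OF s(2,3)] by metis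
  have I: "is_ideal (ipow p k)" by (rule is_ideal_ipow[OF is_ideal_p])
  have "(1 - s * y) * a \<in> ipow p k" "q ^ k * (c * y) \<in> ipow p k"
    using I y s q_ipow[of k] by (auto simp: is_ideal_def mult_Z)
  then have "(1 - s * y) * a + q ^ k * (c * y) \<in> ipow p k" using I by (auto simp: is_ideal_def)
  moreover have "(1 - s * y) * a + q ^ k * (c * y) = a - y * (s * a - q ^ k * c)"
    by (simp add: algebra_simps)
  ultimately show "a \<in> ipow p k" using s(5) by simp
qed (rule ipow_imp_ord_ge)

text \<open>\<open>vord k x\<close>: the \<open>p\<close>-adic valuation of \<open>x\<close> is \<open>k\<close>, with \<open>q\<close> as uniformizer.\<close>

definition vord :: "int \<Rightarrow> complex \<Rightarrow> bool" where
  "vord k x \<longleftrightarrow> (\<exists>s c. s \<in> Z \<and> s \<notin> p \<and> c \<in> Z \<and> c \<notin> p \<and> s * x = q powi k * c)"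

lemma vordI: "s \<in> Z \<Longrightarrow> s \<notin> p \<Longrightarrow> c \<in> Z \<Longrightarrow> c \<notin> p \<Longrightarrow> s * x = q powi k * c \<Longrightarrow> vord k x"
  unfolding vord_def by metis

lemma vordE:
  assumes "vord k x"
  obtains s c where "s \<in> Z" "s \<notin> p" "c \<in> Z" "c \<notin> p" "s * x = q powi k * c"
  using assms unfolding vord_def by metis

lemma vord_mult:
  assumes "vord k x" "vord l y"
  shows "vord (k + l) (x * y)"
proof -
  obtain s c where s: "s \<in> Z" "s \<notin> p" "c \<in> Z" "c \<notin> p" "s * x = q powi k * c"
    by (rule vordE[OF assms(1)])
  obtain t d where t: "t \<in> Z" "t \<notin> p" "d \<in> Z" "d \<notin> p" "t * y = q powi l * d"
    by (rule vordE[OF assms(2)])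
  have "(s * t) * (x * y) = (s * x) * (t * y)" by (simp add: mult_ac)
  also have "\<dots> = q powi (k + l) * (c * d)" unfolding s(5) t(5) using q_nz by (simp add: power_int_add mult_ac)
  finally show ?thesis using s t by (intro vordI[of "s * t" "c * d"] mult_Z p_prime)
qed

lemma vord_inverse:
  assumes "vord k x"
  shows "vord (- k) (inverse x)"
proof -
  obtain s c where s: "s \<in> Z" "s \<notin> p" "c \<in> Z" "c \<notin> p" "s * x = q powi k * c"
    by (rule vordE[OF assms(1)])
  have "x = q powi k * c / s" using s(5) nz[OF s(2)] by (simp add: nonzero_eq_divide_eq mult.commute)
  then have "c * inverse x = q powi (- k) * s"
    using q_nz nz[OF s(2)] nz[OF s(4)] by (simp add: power_int_minus divide_inverse)
  then show ?thesis using s by (intro vordI[of c s])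
qed

lemma q_pow_p: "n > 0 \<Longrightarrow> c \<in> Z \<Longrightarrow> q ^ n * c \<in> p"
  by (cases n) (auto simp: mult.assoc intro: p_mult q_p mult_Z power_Z q_Z)

lemma vord_1_imp_p:
  assumes "a \<in> Z" "s \<in> Z" "s \<notin> p" "c \<in> Z" "k > 0" "s * a = q powi k * c"
  shows "a \<in> p"
proof (rule ccontr)
  assume "a \<notin> p"
  obtain n where "nat k = Suc n" using assms(5) by (metis gr0_implies_Suc zero_less_nat_eq)
  then have "q powi k = q ^ Suc n" using assms(5) by (simp add: power_int_def)
  then have "s * a = q * (q ^ n * c)" using assms(6) by simp
  moreover have "q * (q ^ n * c) \<in> p" using assms by (intro p_mult q_p mult_Z power_Z q_Z)
  ultimately show False using p_prime assms \<open>a \<notin> p\<close> by metis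
qed

lemma vord_unique:
  assumes "vord k x" "vord l x"
  shows "k = l"
proof -
  have no: "\<not> k < l" if kl: "vord k x" "vord l x" for k l
  proof
    assume "k < l"
    obtain s c where s: "s \<in> Z" "s \<notin> p" "c \<in> Z" "c \<notin> p" "s * x = q powi k * c"
      by (rule vordE[OF kl(1)])
    obtain t d where t: "t \<in> Z" "t \<notin> p" "d \<in> Z" "d \<notin> p" "t * x = q powi l * d"
      by (rule vordE[OF kl(2)])
    have "t * (s * x) = s * (t * x)" by simp
    moreover have "q powi l = q powi k * q powi (l - k)"
      using q_nz by (simp add: power_int_add[symmetric])
    ultimately have "t * c = q powi (l - k) * (s * d)"
      using s t q_nz by (simp add: mult_ac)
    then have "t * c \<in> p" using s t \<open>k < l\<close> one_p one_Z
      by (intro vord_1_imp_p[of _ 1 "s * d" "l - k"] mult_Z) simp_all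
    then show False using p_prime s t by metis
  qed
  show ?thesis using no[OF assms] no[OF assms(2,1)] by simp
qed

lemma vord_int_ord:
  assumes a: "a \<in> Z" "a \<noteq> 0"
  shows "vord (int (int_ord F p a)) a"
proof -
  \<comment> \<open>Otherwise \<open>a\<close> would be a common denominator of all powers of
    \<open>b\<close>, making \<open>b\<close> integral and \<open>b * q\<close> an element of
    \<open>p\<close>.\<close>
  have "\<exists>k. a \<notin> ipow p k"
  proof (rule ccontr)
    assume "\<nexists>k. a \<notin> ipow p k"
    then have "a * b ^ k \<in> Z" for k using ipow_b[of a k] unfolding mult.commute[of a] by blast
    then have "b \<in> Z" by (rule almost_integral[OF a b_F])
    then show False using p_mult(2)[OF q_p, of b] bq by simp
  qed
  then obtain k where k: "a \<notin> ipow p k" "\<forall>i<k. a \<in> ipow p i"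
    using exists_least_iff[of "\<lambda>k. a \<notin> ipow p k"] by auto
  then have "k \<noteq> 0" using a by (intro notI) (simp add: ipow_0)
  then obtain n where n: "k = Suc n" by (auto simp: gr0_conv_Suc)
  then have an: "a \<in> ipow p n" using k by simp
  then obtain s c where s: "a \<in> Z" "s \<in> Z" "s \<notin> p" "c \<in> Z" "s * a = q ^ n * c"
    unfolding ipow_iff_ord_ge by (rule ord_geE)
  \<comment> \<open>A factor \<open>c\<close> in \<open>p\<close> would supply another
    \<open>q\<close> and place \<open>a\<close> in the next power.\<close>
  have "c \<notin> p"
  proof
    assume c: "c \<in> p"
    have "(s * (b * q)) * a = (s * a) * (b * q)" by simp
    also have "\<dots> = q ^ k * (b * c)" unfolding s(5) n by simp
    finally have eq: "(s * (b * q)) * a = q ^ k * (b * c)" .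
    have "ord_ge k a"
      by (rule ord_geI[OF a(1) mult_Z[OF s(2) bq_Z] p_prime[OF s(2) bq_Z s(3) bq] b_p[OF c] eq])
    then show False using k(1) ipow_iff_ord_ge by simp
  qed
  then have v: "vord (int n) a" using s by (intro vordI[of s c]) (simp_all)
  have "{m::nat. a \<in> p [^]\<^bsub>ideals_set (ring_of_integers F)\<^esub> m} = {..n}"
  proof (intro equalityI subsetI)
    fix m assume "m \<in> {m::nat. a \<in> p [^]\<^bsub>ideals_set (ring_of_integers F)\<^esub> m}"
    then have "ord_ge m a" by (simp add: ipow_iff_ord_ge[symmetric] ipow_def)
    then obtain t d where t: "a \<in> Z" "t \<in> Z" "t \<notin> p" "d \<in> Z" "t * a = q ^ m * d" by (rule ord_geE)
    show "m \<in> {..n}"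
    proof (rule ccontr)
      assume "m \<notin> {..n}"
      then have mn: "n < m" by simp
      have "q ^ m = q ^ n * q ^ (m - n)" using mn by (simp add: power_add[symmetric])
      then have "q ^ n * (q ^ (m - n) * (s * d)) = s * (t * a)" using t(5) by simp
      also have "\<dots> = t * (s * a)" by simp
      also have "\<dots> = q ^ n * (t * c)" using s(5) by simp
      finally have "t * c = q ^ (m - n) * (s * d)" using q_nz by simp
      then have "t * c \<in> p" using q_pow_p[of "m - n" "s * d"] mn mult_Z[OF s(2) t(4)] by simp
      then show False using p_prime s t \<open>c \<notin> p\<close> by metis
    qed
  next
    fix m assume "m \<in> {..n}"
    then show "m \<in> {m::nat. a \<in> p [^]\<^bsub>ideals_set (ring_of_integers F)\<^esub> m}"
      using k n by (simp add: ipow_def[symmetric])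
  qed
  moreover have "Max {..n} = n" by (rule Max_eqI) auto
  ultimately have "int_ord F p a = n" by (simp add: int_ord_def)
  then show ?thesis using v by simp
qed

text \<open>Uniqueness of the valuation makes the definite description in \<open>place_ord\<close>
  independent of the fraction; a fraction with a natural number as denominator exists.\<close>

lemma vord_place_ord:
  assumes x: "x \<in> F" "x \<noteq> 0"
  shows "vord (place_ord F p x) x"
proof -
  define Q where "Q = (\<lambda>k. \<exists>a b. a \<in> carrier (ring_of_integers F) \<and> b \<in> carrier (ring_of_integers F) \<and> a \<noteq> 0 \<and> b \<noteq> 0 \<and>
     x = a / b \<and> k = int (int_ord F p a) - int (int_ord F p b))"
  have Q: "vord k x" if "Q k" for k
  proof -
    from that obtain a b where ab: "a \<in> Z" "b \<in> Z" "a \<noteq> 0" "b \<noteq> 0" "x = a / b"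
      "k = int (int_ord F p a) - int (int_ord F p b)" unfolding Q_def RI_simps by metis
    have "vord (int (int_ord F p a) + (- int (int_ord F p b))) (a * inverse b)"
      by (intro vord_mult vord_inverse vord_int_ord ab)
    moreover have "a * inverse b = x" using ab by (simp add: divide_inverse)
    ultimately show ?thesis using ab(6) by simp
  qed
  obtain n :: nat where n: "n > 0" "of_nat n * x \<in> Z" by (rule fraction_Z[OF x(1)])
  have "Q (int (int_ord F p (of_nat n * x)) - int (int_ord F p (of_nat n)))"
    unfolding Q_def using n x of_nat_Z
    by (intro exI[of _ "of_nat n * x"] exI[of _ "of_nat n"]) simp_all
  then have "Q (THE k. Q k)"
    using Q vord_unique by (metis theI)
  then show ?thesis using Q by (simp add: place_ord_def Q_def)
qed

end

section \<open>Orders at all primes, integrality and norms\<close>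

context nfield
begin

lemma nfield_prime_exists:
  assumes "nonzero_prime p"
  obtains b q where "nfield_prime F D p b q"
proof -
  obtain b q where bq: "b \<in> F" "\<forall>x\<in>p. b * x \<in> Z" "q \<in> p" "b * q \<notin> p"
    by (rule nonzero_prime_uniformizer[OF assms])
  have "nfield_prime F D p b q"
    by (unfold_locales) (use assms bq in auto)
  then show ?thesis by (rule that)
qed

lemma place_ord_mult:
  assumes "nonzero_prime p" "x \<in> F" "y \<in> F" "x \<noteq> 0" "y \<noteq> 0"
  shows "place_ord F p (x * y) = place_ord F p x + place_ord F p y"
proof -
  obtain b q where "nfield_prime F D p b q" by (rule nfield_prime_exists[OF assms(1)])
  then interpret nfield_prime F D p b q .
  show ?thesis
    by (rule vord_unique[OF vord_place_ord vord_mult[OF vord_place_ord vord_place_ord]])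
      (use assms mult_F in simp_all)
qed

lemma place_ord_Z:
  assumes "nonzero_prime p" "a \<in> Z" "a \<noteq> 0"
  shows "place_ord F p a \<ge> 0"
proof -
  obtain b q where "nfield_prime F D p b q" by (rule nfield_prime_exists[OF assms(1)])
  then interpret nfield_prime F D p b q .
  have "place_ord F p a = int (int_ord F p a)"
    by (rule vord_unique[OF vord_place_ord vord_int_ord]) (use assms Z_F in simp_all)
  then show ?thesis by simp
qed

lemma place_ord_pos_iff:
  assumes "nonzero_prime p" "a \<in> Z" "a \<noteq> 0"
  shows "place_ord F p a > 0 \<longleftrightarrow> a \<in> p"
proof -
  obtain b q where "nfield_prime F D p b q" by (rule nfield_prime_exists[OF assms(1)])
  then interpret nfield_prime F D p b q .
  have "vord (place_ord F p a) a" using assms Z_F by (intro vord_place_ord) simp_all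
  then obtain s c where s: "s \<in> Z" "s \<notin> p" "c \<in> Z" "c \<notin> p" "s * a = q powi (place_ord F p a) * c"
    by (rule vordE)
  show ?thesis
  proof
    assume "place_ord F p a > 0"
    then show "a \<in> p" using vord_1_imp_p s assms by metis
  next
    assume a: "a \<in> p"
    show "place_ord F p a > 0"
    proof (rule ccontr)
      assume "\<not> place_ord F p a > 0"
      then have "place_ord F p a = 0" using place_ord_Z[OF assms] by simp
      then have "s * a = c" using s(5) by simp
      then show False using p_mult(2)[OF a s(1)] s(4) by simp
    qed
  qed
qed

lemma place_ord_nonneg_unit:
  assumes "nonzero_prime p" "x \<in> F" "x \<noteq> 0" "place_ord F p x \<ge> 0"
  obtains s where "s \<in> Z" "s \<notin> p" "s * x \<in> Z"
proof -
  obtain b q where "nfield_prime F D p b q" by (rule nfield_prime_exists[OF assms(1)])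
  then interpret nfield_prime F D p b q .
  have "vord (place_ord F p x) x" using assms by (intro vord_place_ord)
  then obtain s c where s: "s \<in> Z" "s \<notin> p" "c \<in> Z" "c \<notin> p" "s * x = q powi (place_ord F p x) * c"
    by (rule vordE)
  have "q powi (place_ord F p x) \<in> Z" using assms(4) q_Z by (auto simp: power_int_def intro: power_Z)
  then have "s * x \<in> Z" using s by (simp add: mult_Z)
  then show ?thesis using s by (intro that)
qed

text \<open>Local to global: for each nonzero prime \<open>p\<close> the ideal of denominators of
  \<open>x\<close> has an element outside \<open>p\<close>, so it lies in no such prime and must
  contain \<open>1\<close>.\<close>

lemma integral_if_place_ord_nonneg:
  assumes x: "x \<in> F" "x \<noteq> 0" and ord: "\<And>p. nonzero_prime p \<Longrightarrow> place_ord F p x \<ge> 0"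
  shows "x \<in> Z"
proof -
  define I where "I = {a \<in> Z. a * x \<in> Z}"
  have I: "is_ideal I" unfolding is_ideal_def
  proof (intro conjI ballI)
    show "I \<subseteq> Z" "0 \<in> I" by (auto simp: I_def zero_Z)
  next
    fix u v assume "u \<in> I" "v \<in> I"
    then show "u + v \<in> I" by (auto simp: I_def ring_distribs intro: add_Z)
  next
    fix u v assume uv: "u \<in> I" "v \<in> Z"
    then have "(u * x) * v \<in> Z" "u * v \<in> Z" by (auto simp: I_def intro!: mult_Z)
    moreover have "u * v * x = (u * x) * v" by simp
    ultimately show "u * v \<in> I" unfolding I_def by (metis (mono_tags, lifting) mem_Collect_eq)
  qed
  obtain n :: nat where n: "n > 0" "of_nat n * x \<in> Z" by (rule fraction_Z[OF x(1)])
  have "1 \<in> I"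
  proof (rule ccontr)
    assume "1 \<notin> I"
    moreover have "of_nat n \<in> I" using n of_nat_Z by (simp add: I_def)
    moreover have "(of_nat n :: complex) \<noteq> 0" using n by simp
    ultimately obtain p where p: "nonzero_prime p" "I \<subseteq> p"
      by (rule exists_nonzero_prime[OF I])
    obtain s where "s \<in> Z" "s \<notin> p" "s * x \<in> Z" by (rule place_ord_nonneg_unit[OF p(1) x ord[OF p(1)]])
    then show False using p(2) by (auto simp: I_def)
  qed
  then show ?thesis by (simp add: I_def)
qed

lemma finite_place_ord_neg:
  assumes x: "x \<in> F" "x \<noteq> 0"
  shows "finite {p. nonzero_prime p \<and> place_ord F p x < 0}"
proof -
  obtain n :: nat where n: "n > 0" "of_nat n * x \<in> Z" by (rule fraction_Z[OF x(1)])
  have "of_nat n \<in> p" if p: "nonzero_prime p" "place_ord F p x < 0" for p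
  proof -
    have "place_ord F p (of_nat n * x) = place_ord F p (of_nat n) + place_ord F p x"
      using n x p by (intro place_ord_mult) (simp_all add: of_nat_F)
    moreover have "place_ord F p (of_nat n * x) \<ge> 0" using n x p by (intro place_ord_Z) simp_all
    ultimately have "place_ord F p (of_nat n) > 0" using p by simp
    then show ?thesis using place_ord_pos_iff[OF p(1) of_nat_Z, of n] n by simp
  qed
  then have "{p. nonzero_prime p \<and> place_ord F p x < 0} \<subseteq> {I. is_ideal I \<and> of_nat n \<in> I}"
    by (auto simp: nonzero_prime_def)
  then show ?thesis using finite_ideals[OF n(1)] finite_subset by blast
qed

lemma carrier_Quot: "carrier (RI Quot p) = (\<lambda>a. {h + a | h. h \<in> p}) ` Z"
  by (auto simp: FactRing_def A_RCOSETS_def' a_r_coset_def')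

text \<open>The quotient by \<open>p\<close> is finite because \<open>p\<close> contains a positive
  natural number. As an additive group it has order \<open>place_norm F p\<close>, so this multiple
  of \<open>1\<close> vanishes in it.\<close>

lemma place_norm:
  assumes p: "nonzero_prime p"
  shows place_norm_pos: "place_norm F p > 0" and place_norm_in: "of_nat (place_norm F p) \<in> p"
proof -
  have ip: "is_ideal p" using p by (simp add: nonzero_prime_def)
  obtain a where "a \<in> p" "a \<noteq> 0" using p by (auto simp: nonzero_prime_def is_ideal_def)
  then obtain n :: nat where n: "n > 0" "of_nat n \<in> p" using nat_in_ideal[OF ip] by metis
  define f where "f = (\<lambda>a. {h + a | h. h \<in> p})"
  define C where "C = f ` Z"
  have N: "place_norm F p = card C" by (simp add: place_norm_def carrier_Quot C_def f_def)
  have f_iff: "f x = f y \<longleftrightarrow> x - y \<in> p" for x y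
  proof
    assume "f x = f y"
    moreover have "x \<in> f x" using ip by (auto simp: f_def is_ideal_def)
    ultimately have "x \<in> f y" by simp
    then show "x - y \<in> p" by (auto simp: f_def)
  next
    assume *: "x - y \<in> p"
    have "f u \<subseteq> f v" if "u - v \<in> p" for u v
    proof
      fix z assume "z \<in> f u"
      then obtain h where "h \<in> p" "z = h + u" by (auto simp: f_def)
      then have "h + (u - v) \<in> p" "z = (h + (u - v)) + v" using ip that by (auto simp: is_ideal_def)
      then show "z \<in> f v" unfolding f_def by blast
    qed
    moreover have "y - x \<in> p"
      using is_ideal_diff[OF ip, of 0 "x - y"] ip * by (simp add: is_ideal_def)
    ultimately show "f x = f y" using * by (intro equalityI)
  qed
  obtain R where R: "finite R" "R \<subseteq> Z" "\<forall>x\<in>Z. \<exists>r\<in>R. \<exists>y\<in>Z. x = r + of_nat n * y"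
    using residues[OF n(1)] by (elim exE conjE) (rule that)
  have "C \<subseteq> f ` R"
  proof
    fix c assume "c \<in> C"
    then obtain x where x: "x \<in> Z" "c = f x" by (auto simp: C_def)
    then obtain r y where r: "r \<in> R" "y \<in> Z" "x = r + of_nat n * y" using R(3) by metis
    have "x - r \<in> p" using r n ip by (auto simp: is_ideal_def)
    then have "c = f r" using f_iff x(2) by metis
    then show "c \<in> f ` R" using r(1) by (rule image_eqI)
  qed
  then have fin: "finite C" using R(1) finite_surj by blast
  have "C \<noteq> {}" using zero_Z by (auto simp: C_def)
  then show "place_norm F p > 0" using fin N by (simp add: card_gt_0_iff)
  define r where "r = (\<lambda>c. SOME x. x \<in> Z \<and> f x = c)"
  have r: "r c \<in> Z \<and> f (r c) = c" if "c \<in> C" for c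
    unfolding r_def by (rule someI_ex) (use that in \<open>auto simp: C_def\<close>)
  \<comment> \<open>Translation by \<open>1\<close> permutes the classes. Summing
    \<open>r c + 1 - r (g c)\<close> over all classes cancels the representatives and leaves the
    number of classes.\<close>
  define g where "g = (\<lambda>c. f (r c + 1))"
  have gC: "g ` C \<subseteq> C" using r by (auto simp: g_def C_def intro!: imageI add_Z one_Z)
  have "inj_on g C"
  proof (rule inj_onI)
    fix c d assume cd: "c \<in> C" "d \<in> C" "g c = g d"
    then have "r c - r d \<in> p" using f_iff[of "r c + 1" "r d + 1"] by (simp add: g_def)
    then have "f (r c) = f (r d)" using f_iff by simp
    then show "c = d" using r cd by simp
  qed
  then have bij: "bij_betw g C C" using gC fin by (simp add: bij_betw_def endo_inj_surj)
  have step: "r c + 1 - r (g c) \<in> p" if "c \<in> C" for c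
    using f_iff[of "r c + 1" "r (g c)"] r[of "g c"] gC that by (auto simp: g_def)
  have "(\<Sum>c\<in>C'. r c + 1 - r (g c)) \<in> p" if "finite C'" "C' \<subseteq> C" for C'
    using that by (induction C') (use ip step in \<open>auto simp: is_ideal_def\<close>)
  then have "(\<Sum>c\<in>C. r c + 1 - r (g c)) \<in> p" using fin by simp
  also have "(\<Sum>c\<in>C. r c + 1 - r (g c)) = (\<Sum>c\<in>C. r c) + of_nat (card C) - (\<Sum>c\<in>C. r (g c))"
    by (simp add: sum.distrib sum_subtractf)
  also have "(\<Sum>c\<in>C. r (g c)) = (\<Sum>c\<in>C. r c)" by (rule sum.reindex_bij_betw[OF bij])
  finally show "of_nat (place_norm F p) \<in> p" using N by simp
qed

text \<open>The norms of the primes in the denominator of \<open>x\<close> multiply up to a denominator of \<open>x\<close>.\<close>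

lemma denominator:
  assumes x: "x \<in> F" "x \<noteq> 0"
  defines "T \<equiv> {p. nonzero_prime p \<and> place_ord F p x < 0}"
  shows "of_nat (\<Prod>p\<in>T. place_norm F p ^ nat (- place_ord F p x)) * x \<in> Z"
proof -
  define m where "m = (\<Prod>p\<in>T. place_norm F p ^ nat (- place_ord F p x))"
  have fin: "finite T" unfolding T_def by (rule finite_place_ord_neg[OF x])
  have m0: "m > 0" unfolding m_def using place_norm_pos by (intro prod_pos) (auto simp: T_def)
  have pow: "place_ord F p (a ^ k) = int k * place_ord F p a" if "nonzero_prime p" "a \<in> F" "a \<noteq> 0" for p a k
  proof (induction k)
    case 0
    have "place_ord F p 1 = place_ord F p 1 + place_ord F p 1"
      using place_ord_mult[OF that(1) one_F one_F] by simp
    then show ?case by simp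
  next
    case (Suc k)
    then show ?case using place_ord_mult[OF that(1) that(2) power_F[OF that(2)], of k] that
      by (simp add: algebra_simps)
  qed
  have "of_nat m * x \<in> Z"
  proof (rule integral_if_place_ord_nonneg)
    show "of_nat m * x \<in> F" using x by (intro mult_F of_nat_F)
    show "of_nat m * x \<noteq> 0" using x m0 by simp
    fix p assume p: "nonzero_prime p"
    have eq: "place_ord F p (of_nat m * x) = place_ord F p (of_nat m) + place_ord F p x"
      using p x m0 by (intro place_ord_mult) (simp_all add: of_nat_F)
    show "place_ord F p (of_nat m * x) \<ge> 0"
    proof (cases "p \<in> T")
      case False
      then show ?thesis using eq p place_ord_Z[OF p of_nat_Z, of m] m0 by (simp add: T_def)
    next
      case True
      let ?N = "place_norm F p" and ?k = "nat (- place_ord F p x)"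
      define m' where "m' = (\<Prod>p\<in>T - {p}. place_norm F p ^ nat (- place_ord F p x))"
      have m: "m = ?N ^ ?k * m'" unfolding m_def m'_def by (rule prod.remove[OF fin True])
      have m'0: "m' > 0" using m m0 by (intro Nat.gr0I) simp
      have N0: "?N > 0" by (rule place_norm_pos[OF p])
      have "place_ord F p (of_nat m) = place_ord F p (of_nat ?N ^ ?k * of_nat m')"
        by (simp add: m)
      also have "\<dots> = place_ord F p (of_nat ?N ^ ?k) + place_ord F p (of_nat m')"
        using p m'0 N0 by (intro place_ord_mult) (simp_all add: of_nat_F power_F)
      also have "place_ord F p (of_nat ?N ^ ?k) = int ?k * place_ord F p (of_nat ?N)"
        using p N0 by (intro pow) (simp_all add: of_nat_F)
      finally have "place_ord F p (of_nat m) \<ge> int ?k * place_ord F p (of_nat ?N)"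
        using place_ord_Z[OF p of_nat_Z, of m'] m'0 by simp
      moreover have "place_ord F p (of_nat ?N) \<ge> 1"
        using place_ord_pos_iff[OF p of_nat_Z, of ?N] place_norm_in[OF p] N0 by simp
      then have "int ?k * place_ord F p (of_nat ?N) \<ge> int ?k * 1" by (intro mult_left_mono) simp_all
      ultimately have "place_ord F p (of_nat m) \<ge> - place_ord F p x" by linarith
      then show ?thesis using eq by simp
    qed
  qed
  then show ?thesis by (simp add: m_def)
qed

end

section \<open>Subfields of the complex numbers\<close>

lemma field_CC: "field CC"
  by (rule field_from_type_algebra)

interpretation CC: domain CC
  by (rule field.axioms(1)[OF field_CC])

lemma CC_minus [simp]: "\<ominus>\<^bsub>CC\<^esub> x = - x"
  by (rule CC.minus_equality) simp_all

lemma CC_inv [simp]: "x \<noteq> 0 \<Longrightarrow> inv\<^bsub>CC\<^esub> x = inverse x"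
  by (rule CC.inv_unique'[symmetric]) simp_all

lemma CC_pow [simp]: "x [^]\<^bsub>CC\<^esub> (n::nat) = x ^ n"
  by (induction n) (simp_all add: mult.commute)

lemma subfield_CC_closed:
  assumes "subfield F CC"
  shows "1 \<in> F" "x \<in> F \<Longrightarrow> y \<in> F \<Longrightarrow> x + y \<in> F" "x \<in> F \<Longrightarrow> y \<in> F \<Longrightarrow> x * y \<in> F"
    "x \<in> F \<Longrightarrow> - x \<in> F" "x \<in> F \<Longrightarrow> inverse x \<in> F" "0 \<in> F"
proof -
  note E = CC.subring_props[OF assms]
  note E' = subringE[OF subfieldE(1)[OF assms]]
  show "1 \<in> F" "0 \<in> F" using E'(3,2) by simp_all
  show "x \<in> F \<Longrightarrow> y \<in> F \<Longrightarrow> x + y \<in> F" using E'(7)[of x y] by simp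
  show "x \<in> F \<Longrightarrow> y \<in> F \<Longrightarrow> x * y \<in> F" using E'(6)[of x y] by simp
  show "x \<in> F \<Longrightarrow> - x \<in> F" using E'(5)[of x] by simp
  show "x \<in> F \<Longrightarrow> inverse x \<in> F"
    using CC.subfield_m_inv(1)[OF assms, of x] E'(2) by (cases "x = 0") simp_all
qed

lemma subfield_CC_Rats:
  assumes "subfield F CC" "x \<in> \<rat>"
  shows "x \<in> F"
proof -
  note c = subfield_CC_closed[OF assms(1)]
  have n: "of_nat n \<in> F" for n by (induction n) (auto intro: c)
  have i: "of_int k \<in> F" for k
    using n[of "nat k"] c(4)[OF n[of "nat (- k)"]] by (cases "k \<ge> 0") simp_all
  obtain a b where "x = of_int a / of_int b" using assms(2) by (rule Rats_cases') 
  then have "x = of_int a * inverse (of_int b)" by (simp add: divide_inverse)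
  then show ?thesis using c(3)[OF i[of a] c(5)[OF i[of b]]] by simp
qed

lemma subfield_Rats: "subfield \<rat> CC"
proof (rule field.subfieldI'[OF field_CC])
  show "subring \<rat> CC" by (rule CC.subringI) auto
  show "inv\<^bsub>CC\<^esub> k \<in> \<rat>" if "k \<in> \<rat> - {\<zero>\<^bsub>CC\<^esub>}" for k using that by simp
qed

section \<open>Rank, algebraicity and finite extensions\<close>

lemma CC_combine: "length ks = length xs \<Longrightarrow> CC.combine ks xs = (\<Sum>i<length xs. ks ! i * xs ! i)"
proof (induction xs arbitrary: ks)
  case (Cons x xs)
  then obtain k ks' where ks: "ks = k # ks'" by (cases ks) auto
  with Cons show ?case by (simp del: sum.lessThan_Suc add: sum.lessThan_Suc_shift)
qed simp

lemma common_denominator: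
  assumes "finite A" "\<forall>a\<in>A. f a \<in> \<rat>"
  obtains n :: int where "n \<noteq> 0" "\<forall>a\<in>A. of_int n * (f a :: complex) \<in> \<int>"
proof -
  have "\<exists>n::int. n \<noteq> 0 \<and> (\<forall>a\<in>A. of_int n * (f a :: complex) \<in> \<int>)"
    using assms
  proof (induction A)
    case (insert a A)
    then obtain n :: int where n: "n \<noteq> 0" "\<forall>a\<in>A. of_int n * f a \<in> \<int>" by auto
    obtain c d where d: "d > 0" "f a = of_int c / of_int d"
      using insert.prems by (metis Rats_cases' insertI1)
    have "of_int (n * d) * f x \<in> \<int>" if "x \<in> insert a A" for x
    proof (cases "x = a")
      case True
      then have "of_int (n * d) * f x = of_int (n * c)" using d by simp
      then show ?thesis by (simp only: Ints_of_int)
    next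
      case False
      then have "of_int n * f x \<in> \<int>" using n that by simp
      then have "of_int d * (of_int n * f x) \<in> \<int>" by (rule Ints_mult[OF Ints_of_int])
      then show ?thesis by (simp add: mult_ac)
    qed
    then show ?case using n d by (intro exI[of _ "n * d"]) auto
  qed (auto intro: exI[of _ 1])
  then show ?thesis using that by metis
qed

lemma dimension_rank_le:
  assumes "CC.dimension n \<rat> F"
  shows "rank_le n F"
  unfolding rank_le_def
proof (intro allI impI)
  fix B assume B: "B \<subseteq> F" "finite B" "n < card B"
  obtain xs where xs: "set xs = B" "distinct xs" using finite_distinct_list[OF B(2)] by blast
  have "\<not> CC.independent \<rat> xs"
    using CC.independent_length_le_dimension[OF subfield_Rats assms, of xs] B xs distinct_card[of xs] by auto
  then obtain ks where ks: "length ks = length xs" "CC.combine ks xs = \<zero>\<^bsub>CC\<^esub>" "set ks \<subseteq> \<rat>" "set ks \<noteq> {\<zero>\<^bsub>CC\<^esub>}"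
    using CC.dependent_imp_non_trivial_combine[OF subfield_Rats, of xs] by auto
  have "length xs > n" using B(3) xs distinct_card[of xs] by simp
  then have "length xs > 0" by linarith
  then have ne: "set ks \<noteq> {}" using ks(1) by auto
  have "\<exists>k\<in>set ks. k \<noteq> 0"
  proof (rule ccontr)
    assume "\<not> (\<exists>k\<in>set ks. k \<noteq> 0)"
    then have "set ks \<subseteq> {0}" by auto
    then have "set ks = {0}" using ne subset_singletonD[of "set ks" 0] by metis
    then show False using ks(4) by simp
  qed
  then obtain k where k: "k \<in> set ks" "k \<noteq> 0" by (elim bexE) (rule that)
  then obtain i0 where i0: "i0 < length xs" "ks ! i0 \<noteq> 0" using ks(1) by (auto simp: in_set_conv_nth)
  have rat: "\<forall>i\<in>{..<length xs}. ks ! i \<in> \<rat>" using ks(1,3) by auto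
  obtain m :: int where m: "m \<noteq> 0" "\<forall>i\<in>{..<length xs}. of_int m * (ks ! i) \<in> \<int>"
    by (rule common_denominator[OF finite_lessThan rat])
  then have "\<forall>i\<in>{..<length xs}. \<exists>z::int. of_int m * (ks ! i) = of_int z" by (metis Ints_cases)
  then have "\<exists>z. \<forall>i\<in>{..<length xs}. of_int m * (ks ! i) = of_int (z i :: int)"
    by (rule bchoice)
  then obtain z where z: "\<forall>i\<in>{..<length xs}. of_int m * (ks ! i) = of_int (z i :: int)"
    by (elim exE) (rule that)
  have bij: "bij_betw (\<lambda>i. xs ! i) {..<length xs} B"
    using xs bij_betw_nth by blast
  define c where "c = (\<lambda>b. z (inv_into {..<length xs} (\<lambda>i. xs ! i) b))"
  have c: "c (xs ! i) = z i" if "i < length xs" for i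
    unfolding c_def using bij that by (simp add: bij_betw_inv_into_left)
  have "(\<Sum>b\<in>B. of_int (c b) * b) = (\<Sum>i<length xs. of_int (c (xs ! i)) * xs ! i)"
    by (rule sum.reindex_bij_betw[OF bij, symmetric])
  also have "\<dots> = (\<Sum>i<length xs. of_int m * (ks ! i * xs ! i))"
    using z by (intro sum.cong) (auto simp: c mult.assoc[symmetric])
  also have "\<dots> = of_int m * CC.combine ks xs" by (simp add: CC_combine[OF ks(1)] sum_distrib_left del: CC.combine.simps)
  finally have "(\<Sum>b\<in>B. of_int (c b) * b) = 0" using ks(2) by simp
  moreover have "xs ! i0 \<in> B" "c (xs ! i0) \<noteq> 0"
  proof -
    show "xs ! i0 \<in> B" using i0 xs by auto
    have "of_int m * (ks ! i0) \<noteq> 0" using m i0 by simp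
    then show "c (xs ! i0) \<noteq> 0" using z i0 c by auto
  qed
  ultimately show "\<exists>c :: complex \<Rightarrow> int. (\<exists>b\<in>B. c b \<noteq> 0) \<and> (\<Sum>b\<in>B. of_int (c b) * b) = 0" by blast
qed

text \<open>More than \<open>n\<close> distinct powers satisfy an integer relation; two coinciding
  powers give an equation directly. The cases are separated because \<open>rank_le\<close> speaks of
  sets, in which repetitions disappear.\<close>

lemma rank_le_algebraic:
  assumes "rank_le n F" "\<And>i. x ^ i \<in> F"
  shows "algebraic x"
proof (cases "inj_on (\<lambda>i. x ^ i) {..n}")
  case True
  let ?B = "(\<lambda>i. x ^ i) ` {..n}"
  have "card ?B > n" using True by (simp add: card_image)
  moreover have "?B \<subseteq> F" "finite ?B" using assms(2) by auto
  ultimately obtain c b where c: "b \<in> ?B" "c b \<noteq> (0::int)" "(\<Sum>b\<in>?B. of_int (c b) * b) = 0"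
    using assms(1) unfolding rank_le_def by meson
  define p where "p = (\<Sum>i\<le>n. Polynomial.monom (of_int (c (x ^ i)) :: complex) i)"
  have co: "Polynomial.coeff p i = (if i \<le> n then of_int (c (x ^ i)) else 0)" for i
    by (simp add: p_def coeff_sum sum.delta)
  have "poly p x = (\<Sum>i\<le>n. of_int (c (x ^ i)) * x ^ i)" by (simp add: p_def poly_sum poly_monom)
  also have "\<dots> = 0" using c(3) by (simp add: sum.reindex[OF True])
  finally have "poly p x = 0" .
  moreover obtain i where "i \<le> n" "c (x ^ i) \<noteq> 0" using c(1,2) by auto
  then have "Polynomial.coeff p i \<noteq> 0" by (simp add: co)
  then have "p \<noteq> 0" by auto
  ultimately show ?thesis by (intro Polynomial.algebraicI[of p]) (auto simp: co)
next
  case False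
  then obtain i j where ij: "i \<noteq> j" "x ^ i = x ^ j" by (auto simp: inj_on_def)
  let ?p = "Polynomial.monom 1 i - Polynomial.monom (1::complex) j"
  have "Polynomial.coeff ?p i \<noteq> 0" using ij by simp
  then have "?p \<noteq> 0" by (metis coeff_0)
  moreover have "poly ?p x = 0" using ij by (simp add: poly_monom)
  ultimately show ?thesis by (intro Polynomial.algebraicI[of ?p]) auto
qed

lemma number_field_nfield:
  assumes "number_field F"
  shows "nfield F (field_degree F)"
proof -
  have F: "subfield F CC" and fin: "CC.finite_dimension \<rat> F"
    using assms by (auto simp: number_field_def)
  have "CC.dimension (field_degree F) \<rat> F"
    using CC.finite_dimensionE[OF subfield_Rats fin] by (simp add: field_degree_def over_def)
  then have r: "rank_le (field_degree F) F" by (rule dimension_rank_le)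
  note c = subfield_CC_closed[OF F]
  have p: "x ^ i \<in> F" if "x \<in> F" for x i using that by (induction i) (auto intro: c)
  show ?thesis
    by unfold_locales (auto intro: c r rank_le_algebraic[OF r p])
qed

text \<open>Coefficient lists in \<open>CC\<close> start with the leading coefficient, those of
  \<open>Poly\<close> with the constant one.\<close>

lemma CC_eval: "CC.eval xs x = poly (Poly (rev xs)) x"
proof (induction xs)
  case (Cons a xs)
  have "CC.eval (a # xs) x = a * x ^ length xs + CC.eval xs x" by simp
  also have "poly (Poly (rev (a # xs))) x = poly (Poly (rev xs)) x + x ^ length xs * a"
    by (simp add: Poly_append poly_monom)
  ultimately show ?case using Cons by simp
qed simp

lemma algebraic_overI:
  assumes K: "subfield K CC" and p: "\<And>i. Polynomial.coeff p i \<in> K" "p \<noteq> 0" "poly p x = 0"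
  shows "(CC.algebraic over K) x"
proof -
  let ?xs = "rev (coeffs p)"
  have "set ?xs \<subseteq> K"
  proof
    fix y assume "y \<in> set ?xs"
    then have "y \<in> set (coeffs p)" by simp
    then obtain i where "y = Polynomial.coeff p i"
      unfolding coeffs_def by (auto split: if_splits)
    then show "y \<in> K" using p(1) by simp
  qed
  moreover have "?xs \<noteq> []" "hd ?xs \<noteq> 0" using p(2)
    by (simp_all add: hd_rev last_coeffs_eq_coeff_degree)
  ultimately have "?xs \<in> carrier (univ_poly CC K)"
    by (simp add: univ_poly_def polynomial_def)
  then show ?thesis
    by (rule CC.algebraicI) (use p \<open>?xs \<noteq> []\<close> in \<open>simp_all add: CC_eval\<close>)
qed

lemma algebraic_over:
  assumes "algebraic x" "subfield K CC"
  shows "(CC.algebraic over K) x"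
proof -
  obtain p where p: "\<And>i. Polynomial.coeff p i \<in> \<int>" "p \<noteq> 0" "poly p x = 0"
    using assms(1) by (rule Polynomial.algebraicE) auto
  show ?thesis
    by (rule algebraic_overI[OF assms(2) _ p(2,3)])
      (use p(1) subfield_CC_Rats[OF assms(2)] Ints_subset_Rats in auto)
qed

lemma number_field_extend:
  assumes K: "number_field K" and x: "finite A" "\<And>x. x \<in> A \<Longrightarrow> (CC.algebraic over K) x"
  obtains L where "number_field L" "K \<subseteq> L" "A \<subseteq> L"
proof -
  obtain xs where xs: "set xs = A" using x(1) finite_list by blast
  have K': "subfield K CC" "CC.finite_dimension \<rat> K" using K by (auto simp: number_field_def)
  define L where "L = CC.finite_extension K xs"
  have alg: "(CC.algebraic over K) x" if "x \<in> set xs" for x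
    using that xs x(2) by simp
  have L: "subfield L CC" unfolding L_def
    by (rule CC.finite_extension_is_subfield[OF K'(1)]) (use alg in auto)
  have "CC.finite_dimension K L" unfolding L_def
    by (rule CC.finite_extension_finite_dimension(1)[OF K'(1)]) (use alg in auto)
  then have "CC.finite_dimension \<rat> L"
    by (rule CC.telescopic_base_dim(1)[OF subfield_Rats K'])
  then have "number_field L" using L by (simp add: number_field_def)
  moreover have "K \<subseteq> L" unfolding L_def by (rule CC.finite_extension_incl) simp_all
  moreover have "A \<subseteq> L"
    using CC.finite_extension_mem[OF subfieldE(1)[OF K'(1)], of xs] xs by (simp add: L_def)
  ultimately show ?thesis by (rule that)
qed

lemma number_field_Rats: "number_field \<rat>"
  unfolding number_field_def
  using subfield_Rats CC.finite_dimensionI[OF CC.dimension_one[OF subfield_Rats]] by simp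

lemma number_field_algebraic: "number_field K \<Longrightarrow> x \<in> K \<Longrightarrow> algebraic x"
  using nfield.algebraic_F[OF number_field_nfield] .

text \<open>Adjoining the coefficients and then \<open>x\<close> to the rationals gives a number
  field. This later rules out transcendental common zeros of forms on a line.\<close>

lemma algebraic_root:
  fixes x :: complex
  assumes p: "\<And>i. algebraic (Polynomial.coeff p i)" "p \<noteq> 0" "poly p x = 0"
  shows "algebraic x"
proof -
  obtain K where K: "number_field K" "set (coeffs p) \<subseteq> K"
    by (rule number_field_extend[OF number_field_Rats, of "set (coeffs p)"])
      (auto simp: coeffs_def subfield_Rats p(1) intro!: algebraic_over split: if_splits)
  have K': "subfield K CC" using K(1) by (simp add: number_field_def)
  have "Polynomial.coeff p i \<in> K" for i
  proof -
    have "Polynomial.coeff p i \<in> insert 0 (set (coeffs p))" using range_coeff[of p] by (metis rangeI)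
    then show ?thesis using K(2) subfield_CC_closed(6)[OF K'] by auto
  qed
  then have x: "(CC.algebraic over K) x" by (rule algebraic_overI[OF K' _ p(2,3)])
  obtain L where "number_field L" "{x} \<subseteq> L"
    by (rule number_field_extend[OF K(1), of "{x}"]) (use x in auto)
  then show ?thesis using number_field_algebraic by simp
qed

text \<open>The degree bound keeps estimates uniform while the field of coordinates varies inside
  \<open>L\<close>.\<close>

lemma number_field_generate:
  assumes L: "number_field L" and H: "H \<subseteq> L"
  shows "number_field (generate_field CC H)" "generate_field CC H \<subseteq> L"
    "0 < field_degree (generate_field CC H)" "field_degree (generate_field CC H) \<le> field_degree L"
proof -
  let ?F = "generate_field CC H"
  have L': "subfield L CC" "CC.finite_dimension \<rat> L" using L by (auto simp: number_field_def)
  have F: "subfield ?F CC" by (rule field.generate_field_is_subfield[OF field_CC]) simp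
  show sub: "?F \<subseteq> L" by (rule field.generate_field_min_subfield1[OF field_CC _ L'(1) H]) simp
  have "subalgebra \<rat> ?F CC"
    unfolding subalgebra_def subalgebra_axioms_def
    using field.generate_field_is_add_subgroup[OF field_CC, of H] subfield_CC_Rats[OF F] subfield_CC_closed(3)[OF F] by auto
  then have fin: "CC.finite_dimension \<rat> ?F"
    using CC.subalbegra_incl_imp_finite_dimension[OF subfield_Rats L'(2)] sub by blast
  then show "number_field ?F" using F by (simp add: number_field_def)
  have dF: "CC.dimension (field_degree ?F) \<rat> ?F"
    using CC.finite_dimensionE[OF subfield_Rats fin] by (simp add: field_degree_def over_def)
  have dL: "CC.dimension (field_degree L) \<rat> L"
    using CC.finite_dimensionE[OF subfield_Rats L'(2)] by (simp add: field_degree_def over_def)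
  show "0 < field_degree ?F"
  proof (rule Nat.gr0I)
    assume "field_degree ?F = 0"
    then have "?F = {0}" using CC.dimension_zero[OF subfield_Rats, of ?F] dF by simp
    then show False using subfield_CC_closed(1)[OF F] by simp
  qed
  obtain Vs where "CC.independent \<rat> Vs" "length Vs = field_degree ?F" "CC.Span \<rat> Vs = ?F" "set Vs \<subseteq> ?F"
    using CC.exists_base[OF subfield_Rats dF] CC.Span_base_incl[OF subfield_Rats] by metis
  then show "field_degree ?F \<le> field_degree L"
    using CC.independent_length_le_dimension[OF subfield_Rats dL, of Vs] sub by auto
qed

section \<open>Extension of embeddings\<close>

lemma algebraic_of_multiple:
  assumes "algebraic (of_nat n * x :: complex)" "n > 0"
  shows "algebraic x"
proof -
  obtain p where p: "\<And>i. Polynomial.coeff p i \<in> \<int>" "p \<noteq> 0" "poly p (of_nat n * x) = 0"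
    using assms(1) by (rule Polynomial.algebraicE) auto
  let ?q = "pcompose p [:0, of_nat n:]"
  have "Polynomial.coeff ?q i \<in> \<int>" for i
    by (rule coeff_pcompose_semiring_closed) (use p in \<open>auto simp: coeff_pCons split: nat.splits\<close>)
  moreover have "?q \<noteq> 0" using p(2) assms(2) by (subst pcompose_eq_0_iff) auto
  moreover have "poly ?q x = 0" using p(3) by (simp add: poly_pcompose mult.commute)
  ultimately show ?thesis by (rule Polynomial.algebraicI)
qed

lemma
  fixes x y :: complex
  assumes "algebraic x" "algebraic y"
  shows algebraic_add: "algebraic (x + y)"
    and algebraic_mult: "algebraic (x * y)"
proof -
  obtain m :: nat where m: "m > 0" "algebraic_int (of_nat m * x)"
    by (rule algebraic_multiple_algebraic_int[OF assms(1)])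
  obtain n :: nat where n: "n > 0" "algebraic_int (of_nat n * y)"
    by (rule algebraic_multiple_algebraic_int[OF assms(2)])
  have "algebraic_int (of_nat n * (of_nat m * x) + of_nat m * (of_nat n * y))"
    by (intro algebraic_int_add algebraic_int_mult m n algebraic_int_of_nat)
  also have "of_nat n * (of_nat m * x) + of_nat m * (of_nat n * y) = of_nat (m * n) * (x + y)"
    by (simp add: algebra_simps)
  finally show "algebraic (x + y)"
    by (rule algebraic_of_multiple[OF algebraic_int_imp_algebraic]) (use m n in simp)
  have "algebraic_int ((of_nat m * x) * (of_nat n * y))"
    by (intro algebraic_int_mult m n)
  also have "(of_nat m * x) * (of_nat n * y) = of_nat (m * n) * (x * y)" by simp
  finally show "algebraic (x * y)"
    by (rule algebraic_of_multiple[OF algebraic_int_imp_algebraic]) (use m n in simp)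
qed

lemma subfield_CCI:
  assumes "1 \<in> F" "\<And>x y. x \<in> F \<Longrightarrow> y \<in> F \<Longrightarrow> x + y \<in> F" "\<And>x y. x \<in> F \<Longrightarrow> y \<in> F \<Longrightarrow> x * y \<in> F"
    "\<And>x. x \<in> F \<Longrightarrow> - x \<in> F" "\<And>x. x \<in> F \<Longrightarrow> x \<noteq> 0 \<Longrightarrow> inverse x \<in> F"
  shows "subfield F CC"
proof (rule field.subfieldI'[OF field_CC])
  show "subring F CC" by (rule CC.subringI) (use assms in simp_all)
  show "inv\<^bsub>CC\<^esub> k \<in> F" if "k \<in> F - {\<zero>\<^bsub>CC\<^esub>}" for k using that assms by simp
qed

definition is_field_hom :: "complex set \<Rightarrow> (complex \<Rightarrow> complex) \<Rightarrow> bool" where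
  "is_field_hom E \<sigma> \<longleftrightarrow> \<sigma> 1 = 1 \<and> (\<forall>x\<in>E. \<forall>y\<in>E. \<sigma> (x + y) = \<sigma> x + \<sigma> y) \<and> (\<forall>x\<in>E. \<forall>y\<in>E. \<sigma> (x * y) = \<sigma> x * \<sigma> y)"

lemma complex_embeddings_eq: "complex_embeddings F = {\<sigma>. is_field_hom F \<sigma>} \<inter> extensional F"
  by (auto simp: complex_embeddings_def Ring.ring_hom_def is_field_hom_def)

locale field_hom =
  fixes E :: "complex set" and \<sigma> :: "complex \<Rightarrow> complex"
  assumes subfield_E: "subfield E CC" and is_field_hom: "is_field_hom E \<sigma>"
begin

lemmas closed = subfield_CC_closed[OF subfield_E]

lemma hom_1: "\<sigma> 1 = 1" and hom_add: "x \<in> E \<Longrightarrow> y \<in> E \<Longrightarrow> \<sigma> (x + y) = \<sigma> x + \<sigma> y"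
  and hom_mult: "x \<in> E \<Longrightarrow> y \<in> E \<Longrightarrow> \<sigma> (x * y) = \<sigma> x * \<sigma> y"
  using is_field_hom by (auto simp: is_field_hom_def)

lemma hom_0: "\<sigma> 0 = 0"
  using hom_add[of 0 0] closed(6) by simp

lemma hom_minus: "x \<in> E \<Longrightarrow> \<sigma> (- x) = - \<sigma> x"
  using hom_add[of x "- x"] closed(4)[of x] hom_0 by (simp add: add_eq_0_iff)

lemma hom_diff: "x \<in> E \<Longrightarrow> y \<in> E \<Longrightarrow> \<sigma> (x - y) = \<sigma> x - \<sigma> y"
  using hom_add[of x "- y"] hom_minus[of y] closed(4)[of y] by simp

lemma hom_nonzero: "x \<in> E \<Longrightarrow> x \<noteq> 0 \<Longrightarrow> \<sigma> x \<noteq> 0"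
  using hom_mult[of x "inverse x"] closed(5)[of x] hom_1 by auto

lemma hom_inverse: "x \<in> E \<Longrightarrow> \<sigma> (inverse x) = inverse (\<sigma> x)"
  using hom_mult[of x "inverse x"] closed(5)[of x] hom_1 hom_0
  by (cases "x = 0") (auto simp: inverse_unique)

lemma sum_closed: "(\<And>i. i \<in> A \<Longrightarrow> f i \<in> E) \<Longrightarrow> sum f A \<in> E"
  by (induction A rule: infinite_finite_induct) (auto intro: closed)

lemma hom_sum: "(\<And>i. i \<in> A \<Longrightarrow> f i \<in> E) \<Longrightarrow> \<sigma> (sum f A) = (\<Sum>i\<in>A. \<sigma> (f i))"
  by (induction A rule: infinite_finite_induct) (auto simp: hom_0 hom_add sum_closed)

lemma of_nat_closed: "of_nat n \<in> E" and hom_of_nat: "\<sigma> (of_nat n) = of_nat n"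
proof (induction n)
  case (Suc n)
  { case 1 then show ?case using Suc closed by simp
  next
    case 2 then show ?case using Suc closed hom_add[of 1 "of_nat n"] hom_1 by simp }
qed (auto simp: closed hom_0)

lemma of_int_closed: "of_int n \<in> E" and hom_of_int: "\<sigma> (of_int n) = of_int n"
  using of_nat_closed[of "nat n"] of_nat_closed[of "nat (- n)"] closed(4)[of "of_nat (nat (-n))"]
    hom_of_nat[of "nat n"] hom_of_nat[of "nat (- n)"] hom_minus[of "of_nat (nat (- n))"]
  by (cases "n \<ge> 0"; simp)+

lemma hom_Rats: "x \<in> \<rat> \<Longrightarrow> \<sigma> x = x"
  by (elim Rats_cases') (simp add: divide_inverse hom_mult hom_inverse hom_of_int closed of_int_closed)

section \<open>Polynomials with coefficients in a subfield\<close>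

definition poly_over :: "complex poly \<Rightarrow> bool" where
  "poly_over p \<longleftrightarrow> (\<forall>i. Polynomial.coeff p i \<in> E)"

lemma poly_over_add: "poly_over p \<Longrightarrow> poly_over q \<Longrightarrow> poly_over (p + q)"
  and poly_over_minus: "poly_over p \<Longrightarrow> poly_over (- p)"
  and poly_over_smult: "c \<in> E \<Longrightarrow> poly_over p \<Longrightarrow> poly_over (Polynomial.smult c p)"
  and poly_over_mult: "poly_over p \<Longrightarrow> poly_over q \<Longrightarrow> poly_over (p * q)"
  and poly_over_monom: "c \<in> E \<Longrightarrow> poly_over (Polynomial.monom c n)"
  and poly_over_const: "c \<in> E \<Longrightarrow> poly_over [:c:]"
  and poly_over_0: "poly_over 0"
  by (auto simp: poly_over_def closed coeff_mult coeff_pCons intro!: sum_closed split: nat.splits)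

lemma poly_over_diff: "poly_over p \<Longrightarrow> poly_over q \<Longrightarrow> poly_over (p - q)"
  using poly_over_add[of p "- q"] poly_over_minus[of q] by simp

abbreviation "mp \<equiv> map_poly \<sigma>"

lemma coeff_mp: "Polynomial.coeff (mp p) i = \<sigma> (Polynomial.coeff p i)"
  by (simp add: coeff_map_poly hom_0)

lemma mp_add: "poly_over p \<Longrightarrow> poly_over q \<Longrightarrow> mp (p + q) = mp p + mp q"
  by (rule poly_eqI) (simp add: coeff_mp poly_over_def hom_add)

lemma mp_mult: "poly_over p \<Longrightarrow> poly_over q \<Longrightarrow> mp (p * q) = mp p * mp q"
  by (rule poly_eqI) (simp add: coeff_mp poly_over_def coeff_mult hom_sum hom_mult closed)

lemma mp_const: "mp [:c:] = [:\<sigma> c:]"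
  by (rule poly_eqI) (simp add: coeff_mp coeff_pCons hom_0 split: nat.splits)

lemma poly_over_division:
  assumes f: "poly_over f" "Polynomial.lead_coeff f = 1" and "poly_over p"
  shows "\<exists>h r. poly_over h \<and> poly_over r \<and> p = f * h + r \<and> (r = 0 \<or> Polynomial.degree r < Polynomial.degree f)"
  using assms(3)
proof (induction "Polynomial.degree p" arbitrary: p rule: less_induct)
  case less
  show ?case
  proof (cases "p = 0 \<or> Polynomial.degree p < Polynomial.degree f")
    case True
    then show ?thesis using less.prems poly_over_0 by (intro exI[of _ 0] exI[of _ p]) auto
  next
    case False
    define k where "k = Polynomial.degree p - Polynomial.degree f"
    define m where "m = Polynomial.monom (Polynomial.lead_coeff p) k"
    have m: "poly_over m" unfolding m_def using less.prems by (intro poly_over_monom) (simp add: poly_over_def)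
    define p' where "p' = p - f * m"
    have p': "poly_over p'" unfolding p'_def by (intro poly_over_diff poly_over_mult less.prems f m)
    have fm: "Polynomial.degree (f * m) = Polynomial.degree p" "Polynomial.lead_coeff (f * m) = Polynomial.lead_coeff p"
    proof -
      have m0: "m \<noteq> 0" using False by (simp add: m_def)
      have "f \<noteq> 0" using f(2) by auto
      then have "Polynomial.degree (f * m) = Polynomial.degree f + Polynomial.degree m"
        using m0 by (rule degree_mult_eq)
      also have "Polynomial.degree m = k" using False by (simp add: m_def Polynomial.degree_monom_eq)
      finally show "Polynomial.degree (f * m) = Polynomial.degree p" using False by (simp add: k_def)
      show "Polynomial.lead_coeff (f * m) = Polynomial.lead_coeff p"
        unfolding lead_coeff_mult f(2) using False by (simp add: m_def Polynomial.degree_monom_eq)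
    qed
    have c: "p' = 0 \<or> Polynomial.degree p' < Polynomial.degree p"
    proof (rule ccontr)
      assume *: "\<not> (p' = 0 \<or> Polynomial.degree p' < Polynomial.degree p)"
      have "Polynomial.degree p' \<le> Polynomial.degree p"
        unfolding p'_def using fm(1) by (intro degree_diff_le) simp_all
      then have "Polynomial.degree p' = Polynomial.degree p" using * by simp
      then have "Polynomial.lead_coeff p' = 0" using fm by (simp add: p'_def)
      then show False using * by simp
    qed
    have "\<exists>h r. poly_over h \<and> poly_over r \<and> p' = f * h + r \<and> (r = 0 \<or> Polynomial.degree r < Polynomial.degree f)"
    proof (cases "p' = 0")
      case True
      then show ?thesis using poly_over_0 by (intro exI[of _ 0]) auto
    next
      case False
      then show ?thesis using less.hyps[OF _ p'] c by auto
    qed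
    then obtain h r where hr: "poly_over h" "poly_over r" "p' = f * h + r" "r = 0 \<or> Polynomial.degree r < Polynomial.degree f"
      by (elim exE conjE) (rule that)
    have "p = f * (h + m) + r" using hr(3) by (simp add: p'_def algebra_simps)
    then show ?thesis using hr m by (intro exI[of _ "h + m"] exI[of _ r]) (auto intro: poly_over_add)
  qed
qed

lemma minimal_poly_over:
  assumes "algebraic \<theta>"
  obtains f where "poly_over f" "Polynomial.lead_coeff f = 1" "poly f \<theta> = 0"
    "\<forall>p. poly_over p \<longrightarrow> poly p \<theta> = 0 \<longrightarrow> (\<exists>h. poly_over h \<and> p = f * h)"
proof -
  define P where "P = (\<lambda>f. poly_over f \<and> Polynomial.lead_coeff f = 1 \<and> poly f \<theta> = 0)"
  have mon: "P (Polynomial.smult (inverse (Polynomial.lead_coeff p)) p)" if "poly_over p" "p \<noteq> 0" "poly p \<theta> = 0" for p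
  proof -
    have "Polynomial.lead_coeff p \<in> E" using that(1) by (simp add: poly_over_def)
    then show ?thesis using that closed(5) by (simp add: P_def poly_over_smult)
  qed
  obtain p0 where p0: "\<And>i. Polynomial.coeff p0 i \<in> \<int>" "p0 \<noteq> 0" "poly p0 \<theta> = 0"
    using assms by (rule Polynomial.algebraicE) auto
  have "poly_over p0" unfolding poly_over_def using p0(1) of_int_closed by (metis Ints_cases)
  then have "\<exists>f. P f" using mon p0 by blast
  then have "\<exists>f. P f \<and> (\<forall>g. P g \<longrightarrow> Polynomial.degree f \<le> Polynomial.degree g)"
    by (rule ex_has_least_nat[of P _ Polynomial.degree, OF someI_ex])
  then obtain f where f: "P f" "\<forall>g. P g \<longrightarrow> Polynomial.degree f \<le> Polynomial.degree g"
    by (elim exE conjE) (rule that)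
  have "\<exists>h. poly_over h \<and> p = f * h" if p: "poly_over p" "poly p \<theta> = 0" for p
  proof -
    have "\<exists>h r. poly_over h \<and> poly_over r \<and> p = f * h + r \<and> (r = 0 \<or> Polynomial.degree r < Polynomial.degree f)"
      using f(1) p(1) by (intro poly_over_division) (simp_all add: P_def)
    then obtain h r where hr: "poly_over h" "poly_over r" "p = f * h + r" "r = 0 \<or> Polynomial.degree r < Polynomial.degree f"
      by (elim exE conjE) (rule that)
    have "r = 0"
    proof (rule ccontr)
      assume r: "r \<noteq> 0"
      have "poly r \<theta> = 0" using p(2) hr(3) f(1) by (simp add: P_def)
      from mon[OF hr(2) r this] have "Polynomial.degree f \<le> Polynomial.degree r"
        using f(2) r by fastforce
      then show False using hr(4) r by simp
    qed
    then show ?thesis using hr by auto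
  qed
  then show ?thesis using f(1) by (intro that[of f]) (simp_all add: P_def)
qed

text \<open>The ring \<open>E[\<theta>]\<close> consists of the values
  \<open>poly p \<theta>\<close>, and sending them to \<open>poly (mp p) \<theta>'\<close> is well
  defined since \<open>f\<close> divides every polynomial over \<open>E\<close> vanishing at
  \<open>\<theta>\<close>. The choice of \<open>f\<close> precedes \<open>\<theta>'\<close>, so that
  one \<open>f\<close> serves all its roots; this is used to reach every conjugate of an algebraic
  integer.\<close>

lemma extend_hom:
  assumes alg: "\<And>x. x \<in> E \<Longrightarrow> algebraic x" and \<theta>: "algebraic \<theta>"
  shows "\<exists>f. poly_over f \<and> Polynomial.lead_coeff f = 1 \<and> poly f \<theta> = 0 \<and>
    (\<forall>\<theta>'. poly (mp f) \<theta>' = 0 \<longrightarrow> (\<exists>E' \<tau>. field_hom E' \<tau> \<and> (\<forall>x\<in>E'. algebraic x) \<and> E \<subseteq> E' \<and> \<theta> \<in> E' \<and>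
       (\<forall>x\<in>E. \<tau> x = \<sigma> x) \<and> \<tau> \<theta> = \<theta>'))"
proof -
  obtain f where f: "poly_over f" "Polynomial.lead_coeff f = 1" "poly f \<theta> = 0"
    "\<forall>p. poly_over p \<longrightarrow> poly p \<theta> = 0 \<longrightarrow> (\<exists>h. poly_over h \<and> p = f * h)"
    by (rule minimal_poly_over[OF \<theta>])
  have "\<exists>E' \<tau>. field_hom E' \<tau> \<and> (\<forall>x\<in>E'. algebraic x) \<and> E \<subseteq> E' \<and> \<theta> \<in> E' \<and>
       (\<forall>x\<in>E. \<tau> x = \<sigma> x) \<and> \<tau> \<theta> = \<theta>'" if \<theta>': "poly (mp f) \<theta>' = 0" for \<theta>'
  proof -
    define E' where "E' = {poly p \<theta> | p. poly_over p}"
    define \<tau> where "\<tau> = (\<lambda>y. poly (mp (SOME p. poly_over p \<and> poly p \<theta> = y)) \<theta>')"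
    have \<tau>: "\<tau> (poly p \<theta>) = poly (mp p) \<theta>'" if p: "poly_over p" for p
    proof -
      define q where "q = (SOME q. poly_over q \<and> poly q \<theta> = poly p \<theta>)"
      have q: "poly_over q \<and> poly q \<theta> = poly p \<theta>" unfolding q_def by (rule someI[of _ p]) (simp add: p)
      then have "poly_over (p - q)" "poly (p - q) \<theta> = 0" using p by (simp_all add: poly_over_diff)
      then obtain h where h: "poly_over h" "p - q = f * h" using f(4) by metis
      have "mp p = mp (q + f * h)" using h(2) by (simp add: algebra_simps)
      also have "\<dots> = mp q + mp f * mp h" using q h f(1) by (simp add: mp_add mp_mult poly_over_mult)
      finally have "poly (mp p) \<theta>' = poly (mp q) \<theta>'" using \<theta>' by simp
      then show ?thesis by (simp add: \<tau>_def q_def)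
    qed
    have EE: "E \<subseteq> E'"
    proof
      fix x assume "x \<in> E"
      then show "x \<in> E'" unfolding E'_def by (intro CollectI exI[of _ "[:x:]"]) (simp add: poly_over_const)
    qed
    have add: "x + y \<in> E'" "\<tau> (x + y) = \<tau> x + \<tau> y" if xy: "x \<in> E'" "y \<in> E'" for x y
    proof -
      obtain p q where pq: "poly_over p" "x = poly p \<theta>" "poly_over q" "y = poly q \<theta>" using xy unfolding E'_def by auto
      have e: "x + y = poly (p + q) \<theta>" using pq by simp
      then show "x + y \<in> E'" unfolding E'_def using pq poly_over_add by blast
      show "\<tau> (x + y) = \<tau> x + \<tau> y" 
        using \<tau>[OF poly_over_add[OF pq(1,3)]] \<tau>[OF pq(1)] \<tau>[OF pq(3)] mp_add[OF pq(1,3)] by (simp add: pq(2,4))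
    qed
    have mult: "x * y \<in> E'" "\<tau> (x * y) = \<tau> x * \<tau> y" if xy: "x \<in> E'" "y \<in> E'" for x y
    proof -
      obtain p q where pq: "poly_over p" "x = poly p \<theta>" "poly_over q" "y = poly q \<theta>" using xy unfolding E'_def by auto
      have e: "x * y = poly (p * q) \<theta>" using pq by simp
      then show "x * y \<in> E'" unfolding E'_def using pq poly_over_mult by blast
      show "\<tau> (x * y) = \<tau> x * \<tau> y" 
        using \<tau>[OF poly_over_mult[OF pq(1,3)]] \<tau>[OF pq(1)] \<tau>[OF pq(3)] mp_mult[OF pq(1,3)] by (simp add: pq(2,4))
    qed
    have minus: "- x \<in> E'" if "x \<in> E'" for x
    proof -
      have "- 1 \<in> E" by (intro closed)
      then have "- 1 \<in> E'" using EE by blast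
      then show ?thesis using mult(1)[of "- 1" x] that by simp
    qed
    have \<tau>E: "\<tau> x = \<sigma> x" if "x \<in> E" for x
      using \<tau>[OF poly_over_const[OF that]] by (simp add: mp_const)
    have pX: "poly_over [:0, 1:]" by (simp add: poly_over_def coeff_pCons closed split: nat.splits)
    have "mp [:0, 1:] = [:0, 1:]"
      by (rule poly_eqI) (simp add: coeff_mp coeff_pCons hom_0 hom_1 split: nat.splits)
    then have \<tau>\<theta>: "\<tau> \<theta> = \<theta>'" using \<tau>[OF pX] by simp
    have \<theta>E: "\<theta> \<in> E'" unfolding E'_def by (intro CollectI exI[of _ "[:0, 1:]"]) (simp add: pX)
    have algE': "algebraic x" if x: "x \<in> E'" for x
    proof -
      obtain p where p: "poly_over p" "x = poly p \<theta>" using x unfolding E'_def by auto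
      have pow: "algebraic (\<theta> ^ i)" for i
        by (induction i) (auto intro: algebraic_mult \<theta> rat_imp_algebraic)
      have sum: "algebraic (\<Sum>i\<in>A. Polynomial.coeff p i * \<theta> ^ i)" if "finite A" for A
        using that
      proof (induction A)
        case (insert i A)
        have "algebraic (Polynomial.coeff p i)"
          using p(1) by (intro alg) (simp add: poly_over_def)
        then have "algebraic (Polynomial.coeff p i * \<theta> ^ i + (\<Sum>i\<in>A. Polynomial.coeff p i * \<theta> ^ i))"
          by (intro algebraic_add insert.IH algebraic_mult[OF _ pow])
        then show ?case using insert.hyps by simp
      qed simp
      show ?thesis unfolding p(2) poly_altdef by (rule sum) simp
    qed
    have ofint: "of_int k \<in> E'" for k using EE of_int_closed by blast
    have intpoly: "poly (map_poly of_int q) x \<in> E'" if "x \<in> E'" for q x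
    proof (induction q)
      case 0 show ?case using ofint[of 0] by simp
    next
      case (pCons a q)
      then show ?case using that by (simp add: map_poly_pCons add mult ofint)
    qed
    \<comment> \<open>A nonzero algebraic \<open>x\<close> satisfies an integer equation
      \<open>a + x * q(x) = 0\<close> with \<open>a\<close> nonzero, so its inverse is a polynomial
      in \<open>x\<close>.\<close>
    have inv: "inverse x \<in> E'" if x: "x \<in> E'" "x \<noteq> 0" for x
    proof -
      obtain p where p: "p \<noteq> 0" "Polynomial.coeff p 0 \<noteq> 0" "poly (map_poly of_int p) x = 0"
        by (rule algebraicE'_nonzero[OF algE'[OF x(1)] x(2)])
      obtain a q where pq: "p = pCons a q" by (rule pCons_cases)
      then have "of_int a + x * poly (map_poly of_int q) x = 0" "a \<noteq> 0"
        using p by (simp_all add: map_poly_pCons)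
      then have "inverse x = - (poly (map_poly of_int q) x * inverse (of_int a))"
        using x(2) by (simp add: field_simps eq_neg_iff_add_eq_0)
      moreover have "inverse (of_int a) \<in> E'" using EE closed(5)[OF of_int_closed] by blast
      ultimately show ?thesis using minus mult(1) intpoly[OF x(1)] by metis
    qed
    have "subfield E' CC"
      by (rule subfield_CCI) (use EE closed(1) add(1) mult(1) minus inv in auto)
    moreover have "is_field_hom E' \<tau>"
      unfolding is_field_hom_def using add(2) mult(2) \<tau>E[of 1] closed(1) hom_1 by simp
    ultimately have "field_hom E' \<tau>" by (rule field_hom.intro)
    then show ?thesis using EE \<theta>E \<tau>E \<tau>\<theta> algE' by (intro exI[of _ E'] exI[of _ \<tau>]) simp
  qed
  then show ?thesis using f by (intro exI[of _ f]) simp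
qed

end

text \<open>One element at a time: the transported polynomial is again of positive degree, so it has
  a complex root to serve as the image of the new element.\<close>

lemma extend_hom_finite:
  assumes "finite B" "field_hom E \<sigma>" "\<forall>x\<in>E. algebraic x" "\<forall>b\<in>B. algebraic b"
  shows "\<exists>E' \<tau>. field_hom E' \<tau> \<and> (\<forall>x\<in>E'. algebraic x) \<and> E \<subseteq> E' \<and> B \<subseteq> E' \<and> (\<forall>x\<in>E. \<tau> x = \<sigma> x)"
  using assms(1,4)
proof (induction B)
  case empty
  show ?case using assms by (intro exI[of _ E] exI[of _ \<sigma>]) simp
next
  case (insert b B)
  have "\<exists>E' \<tau>. field_hom E' \<tau> \<and> (\<forall>x\<in>E'. algebraic x) \<and> E \<subseteq> E' \<and> B \<subseteq> E' \<and> (\<forall>x\<in>E. \<tau> x = \<sigma> x)"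
    using insert by simp
  then obtain E1 \<tau> where 1: "field_hom E1 \<tau>" "\<forall>x\<in>E1. algebraic x" "E \<subseteq> E1" "B \<subseteq> E1" "\<forall>x\<in>E. \<tau> x = \<sigma> x"
    by (elim exE conjE) (rule that)
  interpret field_hom E1 \<tau> by (rule 1)
  have "\<exists>f. poly_over f \<and> Polynomial.lead_coeff f = 1 \<and> poly f b = 0 \<and>
    (\<forall>\<theta>'. poly (mp f) \<theta>' = 0 \<longrightarrow> (\<exists>E' \<tau>'. field_hom E' \<tau>' \<and> (\<forall>x\<in>E'. algebraic x) \<and> E1 \<subseteq> E' \<and> b \<in> E' \<and>
       (\<forall>x\<in>E1. \<tau>' x = \<tau> x) \<and> \<tau>' b = \<theta>'))"
    by (rule extend_hom) (use 1 insert.prems in auto)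
  then obtain f where f: "poly_over f" "Polynomial.lead_coeff f = 1" "poly f b = 0"
    "\<forall>\<theta>'. poly (mp f) \<theta>' = 0 \<longrightarrow> (\<exists>E' \<tau>'. field_hom E' \<tau>' \<and> (\<forall>x\<in>E'. algebraic x) \<and> E1 \<subseteq> E' \<and> b \<in> E' \<and>
       (\<forall>x\<in>E1. \<tau>' x = \<tau> x) \<and> \<tau>' b = \<theta>')"
    by (elim exE conjE) (rule that)
  have "Polynomial.degree f \<noteq> 0"
  proof
    assume "Polynomial.degree f = 0"
    then have "f = 1" using f(2) by (metis degree_0_id one_pCons of_nat_1)
    then show False using f(3) by simp
  qed
  moreover have "Polynomial.degree (mp f) = Polynomial.degree f"
    by (rule degree_map_poly) (use f(2) hom_1 in auto)
  ultimately obtain z where "poly (mp f) z = 0"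
    using fundamental_theorem_of_algebra_alt[of "mp f"] by (metis degree_pCons_0)
  then have "\<exists>E' \<tau>'. field_hom E' \<tau>' \<and> (\<forall>x\<in>E'. algebraic x) \<and> E1 \<subseteq> E' \<and> b \<in> E' \<and>
       (\<forall>x\<in>E1. \<tau>' x = \<tau> x) \<and> \<tau>' b = z" using f(4) by blast
  then obtain E2 \<tau>2 where 2: "field_hom E2 \<tau>2" "\<forall>x\<in>E2. algebraic x" "E1 \<subseteq> E2" "b \<in> E2"
       "\<forall>x\<in>E1. \<tau>2 x = \<tau> x" by (elim exE conjE) (rule that)
  then show ?case using 1 by (intro exI[of _ E2] exI[of _ \<tau>2]) auto
qed

section \<open>Algebraic integers with bounded conjugates\<close>

context nfield
begin

lemma subfield_F: "subfield F CC"
  by (rule subfield_CCI) (auto intro: one_F add_F mult_F minus_F inverse_F)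

text \<open>The rank bound yields a largest subset without integer relations; any further element
  then occurs with nonzero coefficient in a relation and can be solved for over the
  rationals.\<close>

lemma spanning:
  obtains B where "finite B" "B \<subseteq> F" "\<forall>x\<in>F. \<exists>c. (\<forall>b\<in>B. c b \<in> \<rat>) \<and> x = (\<Sum>b\<in>B. c b * b)"
proof -
  define dep where "dep = (\<lambda>B. \<exists>c :: complex \<Rightarrow> int. (\<exists>b\<in>B. c b \<noteq> 0) \<and> (\<Sum>b\<in>B. of_int (c b) * b) = 0)"
  define P where "P = (\<lambda>B. B \<subseteq> F \<and> finite B \<and> \<not> dep B)"
  have bound: "card B < Suc D" if B: "P B" for B
  proof (rule ccontr)
    assume "\<not> card B < Suc D"
    then have "D < card B" by simp
    then have "dep B" using rank_F B unfolding rank_le_def dep_def P_def by simp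
    then show False using B by (simp add: P_def)
  qed
  have "\<exists>B. P B \<and> (\<forall>B'. P B' \<longrightarrow> card B' \<le> card B)"
  proof (rule ex_has_greatest_nat)
    show "P {}" by (simp add: P_def dep_def)
    show "\<forall>B. P B \<longrightarrow> card B < Suc D" using bound by simp
  qed
  then obtain B where B: "P B" "\<forall>B'. P B' \<longrightarrow> card B' \<le> card B"
    by (elim exE conjE) (rule that)
  have BF: "B \<subseteq> F" "finite B" "\<not> dep B" using B(1) by (simp_all add: P_def)
  have "\<exists>c. (\<forall>b\<in>B. c b \<in> \<rat>) \<and> x = (\<Sum>b\<in>B. c b * b)" if x: "x \<in> F" for x
  proof (cases "x \<in> B")
    case True
    have "(\<Sum>b\<in>B. (if b = x then 1 else 0) * b) = (\<Sum>b\<in>B. if b = x then x else 0)"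
      by (intro sum.cong) auto
    also have "\<dots> = x" using True BF(2) by simp
    finally show ?thesis by (intro exI[of _ "\<lambda>b. if b = x then 1 else 0"]) simp
  next
    case False
    have "\<not> P (insert x B)"
    proof
      assume "P (insert x B)"
      then have "card (insert x B) \<le> card B" using B(2) by simp
      then show False using False BF(2) by simp
    qed
    then have "dep (insert x B)" using x BF by (simp add: P_def)
    then obtain c where c: "\<exists>b\<in>insert x B. c b \<noteq> (0::int)" "(\<Sum>b\<in>insert x B. of_int (c b) * b) = 0"
      unfolding dep_def by (elim exE conjE) (rule that)
    have s: "of_int (c x) * x + (\<Sum>b\<in>B. of_int (c b) * b) = 0" using c(2) False BF(2) by simp
    have "c x \<noteq> 0"
    proof
      assume "c x = 0"
      then have "dep B" using s c(1) unfolding dep_def by (intro exI[of _ c]) simp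
      then show False using BF by simp
    qed
    then have "x = (\<Sum>b\<in>B. of_int (- c b) * b) / of_int (c x)"
      using s by (simp add: field_simps sum_negf eq_neg_iff_add_eq_0)
    also have "\<dots> = (\<Sum>b\<in>B. of_int (- c b) / of_int (c x) * b)" by (simp add: sum_divide_distrib)
    finally show ?thesis
      by (intro exI[of _ "\<lambda>b. of_int (- c b) / of_int (c x)"]) (simp add: Rats_divide)
  qed
  then show ?thesis using BF by (intro that[of B]) simp_all
qed

lemma field_hom_embedding:
  assumes "\<sigma> \<in> complex_embeddings F"
  shows "field_hom F \<sigma>"
  using assms by (intro field_hom.intro subfield_F) (simp add: complex_embeddings_eq)

lemma embedding_determined:
  assumes B: "B \<subseteq> F" "\<forall>x\<in>F. \<exists>c. (\<forall>b\<in>B. c b \<in> \<rat>) \<and> x = (\<Sum>b\<in>B. c b * b)"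
    and \<sigma>: "\<sigma> \<in> complex_embeddings F" "\<tau> \<in> complex_embeddings F" and eq: "\<forall>b\<in>B. \<sigma> b = \<tau> b"
  shows "\<sigma> = \<tau>"
proof (rule extensionalityI[of _ F])
  show "\<sigma> \<in> extensional F" "\<tau> \<in> extensional F" using \<sigma> by (simp_all add: complex_embeddings_eq)
  interpret s: field_hom F \<sigma> by (rule field_hom_embedding[OF \<sigma>(1)])
  interpret t: field_hom F \<tau> by (rule field_hom_embedding[OF \<sigma>(2)])
  fix x assume "x \<in> F"
  from bspec[OF B(2) this]
  obtain c where c: "\<forall>b\<in>B. c b \<in> \<rat>" "x = (\<Sum>b\<in>B. c b * b)"
    by (elim exE conjE) (rule that)
  have cF: "c b \<in> F" "b \<in> F" "c b * b \<in> F" if b: "b \<in> B" for b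
  proof -
    show 1: "c b \<in> F" using c(1) b by (simp add: Rats_F)
    show 2: "b \<in> F" using b B(1) by blast
    show "c b * b \<in> F" by (rule mult_F[OF 1 2])
  qed
  have "\<sigma> x = (\<Sum>b\<in>B. \<sigma> (c b * b))" unfolding c(2) using cF by (intro s.hom_sum)
  also have "\<dots> = (\<Sum>b\<in>B. \<tau> (c b * b))"
    using cF c(1) eq by (intro sum.cong) (simp_all add: s.hom_mult t.hom_mult s.hom_Rats t.hom_Rats)
  also have "\<dots> = \<tau> x" unfolding c(2) using cF by (intro t.hom_sum[symmetric])
  finally show "\<sigma> x = \<tau> x" .
qed

lemma hom_int_poly:
  assumes "field_hom F \<sigma>" "x \<in> F"
  shows "poly (map_poly of_int p) (\<sigma> x) = \<sigma> (poly (map_poly of_int p) x) \<and> poly (map_poly of_int p) x \<in> F"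
proof -
  interpret field_hom F \<sigma> by (rule assms)
  show ?thesis
  proof (induction p)
    case 0 show ?case by (simp add: hom_0 zero_F)
  next
    case (pCons a p)
    have "of_int a \<in> F" by (rule of_int_F)
    then show ?case using pCons assms(2)
      by (simp add: map_poly_pCons hom_add hom_mult hom_of_int mult_F add_F)
  qed
qed

lemma finite_embeddings: "finite (complex_embeddings F)"
proof -
  obtain B where B: "finite B" "B \<subseteq> F" "\<forall>x\<in>F. \<exists>c. (\<forall>b\<in>B. c b \<in> \<rat>) \<and> x = (\<Sum>b\<in>B. c b * b)"
    by (rule spanning)
  have "\<exists>A. finite A \<and> (\<forall>\<sigma>\<in>complex_embeddings F. \<sigma> b \<in> A)" if b: "b \<in> B" for b
  proof -
    have bF: "b \<in> F" using b B by blast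
    obtain p where p: "p \<noteq> 0" "poly (map_poly of_int p) b = 0"
      by (rule algebraicE'[OF algebraic_F[OF bF]])
    have "finite {z. poly (map_poly of_int p) z = (0::complex)}"
      using p(1) by (intro poly_roots_finite) (simp add: map_poly_eq_0_iff)
    moreover have "poly (map_poly of_int p) (\<sigma> b) = 0" if \<sigma>: "\<sigma> \<in> complex_embeddings F" for \<sigma>
      using hom_int_poly[OF field_hom_embedding[OF \<sigma>] bF, of p] p(2) field_hom.hom_0[OF field_hom_embedding[OF \<sigma>]] by simp
    ultimately show ?thesis by (intro exI[of _ "{z. poly (map_poly of_int p) z = 0}"]) simp
  qed
  then have "\<forall>b\<in>B. \<exists>A. finite A \<and> (\<forall>\<sigma>\<in>complex_embeddings F. \<sigma> b \<in> A)" by simp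
  then have "\<exists>A. \<forall>b\<in>B. finite (A b) \<and> (\<forall>\<sigma>\<in>complex_embeddings F. \<sigma> b \<in> A b)" by (rule bchoice)
  then obtain A where A: "\<forall>b\<in>B. finite (A b) \<and> (\<forall>\<sigma>\<in>complex_embeddings F. \<sigma> b \<in> A b)"
    by (elim exE) (rule that)
  have inj: "inj_on (\<lambda>\<sigma>. restrict \<sigma> B) (complex_embeddings F)"
  proof (rule inj_onI)
    fix \<sigma> \<tau> assume *: "\<sigma> \<in> complex_embeddings F" "\<tau> \<in> complex_embeddings F" "restrict \<sigma> B = restrict \<tau> B"
    have "\<forall>b\<in>B. \<sigma> b = \<tau> b" using *(3) by (metis restrict_apply')
    with B(2,3) *(1,2) show "\<sigma> = \<tau>" by (rule embedding_determined)
  qed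
  have "(\<lambda>\<sigma>. restrict \<sigma> B) ` complex_embeddings F \<subseteq> PiE B A" using A by auto
  moreover have "finite (PiE B A)" using A B(1) by (intro finite_PiE) simp_all
  ultimately have "finite ((\<lambda>\<sigma>. restrict \<sigma> B) ` complex_embeddings F)" by (rule finite_subset)
  then show ?thesis using inj by (rule finite_imageD)
qed

text \<open>\<open>E\<close> and \<open>F\<close> may be incomparable: \<open>\<sigma>\<close> is
  extended to a field containing both and then restricted to \<open>F\<close>.\<close>

lemma extend_embedding:
  assumes E: "field_hom E \<sigma>" "\<forall>x\<in>E. algebraic x"
  obtains \<tau> where "\<tau> \<in> complex_embeddings F" "\<forall>x\<in>E \<inter> F. \<tau> x = \<sigma> x"
proof -
  obtain B where B: "finite B" "B \<subseteq> F" "\<forall>x\<in>F. \<exists>c. (\<forall>b\<in>B. c b \<in> \<rat>) \<and> x = (\<Sum>b\<in>B. c b * b)"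
    by (rule spanning)
  have "\<forall>b\<in>B. algebraic b" using B algebraic_F by blast
  from extend_hom_finite[OF B(1) E(1,2) this]
  obtain E' \<tau> where \<tau>: "field_hom E' \<tau>" "E \<subseteq> E'" "B \<subseteq> E'" "\<forall>x\<in>E. \<tau> x = \<sigma> x"
    by (elim exE conjE) (rule that)
  interpret field_hom E' \<tau> by (rule \<tau>)
  have sub: "F \<subseteq> E'"
  proof
    fix x assume "x \<in> F"
    from bspec[OF B(3) this]
    obtain c where c: "\<forall>b\<in>B. c b \<in> \<rat>" "x = (\<Sum>b\<in>B. c b * b)"
      by (elim exE conjE) (rule that)
    show "x \<in> E'" unfolding c(2)
      using c(1) \<tau>(3) subfield_CC_Rats[OF subfield_E] by (intro sum_closed closed(3)) auto
  qed
  define \<rho> where "\<rho> = restrict \<tau> F"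
  have "is_field_hom F \<rho>" unfolding is_field_hom_def \<rho>_def
    using sub by (auto simp: one_F add_F mult_F hom_1 intro!: hom_add hom_mult)
  then have "\<rho> \<in> complex_embeddings F" by (simp add: complex_embeddings_eq \<rho>_def)
  moreover have "\<forall>x\<in>E \<inter> F. \<rho> x = \<sigma> x" using \<tau>(4) by (auto simp: \<rho>_def)
  ultimately show ?thesis by (rule that)
qed

lemma algebraic_int_hom:
  assumes "field_hom E \<sigma>" "x \<in> E" "algebraic_int x"
  shows "algebraic_int (\<sigma> x)"
proof -
  interpret field_hom E \<sigma> by (rule assms(1))
  obtain p where p: "poly (map_poly of_int p) x = 0" "Polynomial.lead_coeff p = 1"
    using assms(3) unfolding algebraic_int_altdef_ipoly by (elim exE conjE) (rule that)
  have "poly (map_poly of_int q) (\<sigma> x) = \<sigma> (poly (map_poly of_int q) x) \<and> poly (map_poly of_int q) x \<in> E" for q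
  proof (induction q)
    case 0 show ?case by (simp add: hom_0 closed)
  next
    case (pCons a p)
    then show ?case using assms(2)
      by (simp add: map_poly_pCons hom_add hom_mult hom_of_int closed of_int_closed)
  qed
  from this[of p] have "poly (map_poly of_int p) (\<sigma> x) = 0" using p(1) hom_0 by simp
  then show ?thesis using p(2) unfolding algebraic_int_altdef_ipoly by (intro exI[of _ p]) simp
qed

text \<open>The minimal polynomial over the rationals has an integral constant coefficient, which is the
  product of the conjugates up to sign.\<close>

lemma embedding_ge_1:
  assumes d: "\<delta> \<in> Z" "\<delta> \<noteq> 0"
  shows "\<exists>\<sigma>\<in>complex_embeddings F. cmod (\<sigma> \<delta>) \<ge> 1"
proof (rule ccontr)
  assume "\<not> ?thesis"
  then have small: "cmod (\<sigma> \<delta>) < 1" if "\<sigma> \<in> complex_embeddings F" for \<sigma> using that by force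
  have dF: "\<delta> \<in> F" "algebraic_int \<delta>" using d by (simp_all add: Z_def)
  interpret r: field_hom \<rat> "\<lambda>x. x"
    by (rule field_hom.intro) (simp_all add: subfield_Rats is_field_hom_def)
  have "\<exists>f. r.poly_over f \<and> Polynomial.lead_coeff f = 1 \<and> poly f \<delta> = 0 \<and>
    (\<forall>\<theta>'. poly (r.mp f) \<theta>' = 0 \<longrightarrow> (\<exists>E' \<tau>. field_hom E' \<tau> \<and> (\<forall>x\<in>E'. algebraic x) \<and> \<rat> \<subseteq> E' \<and> \<delta> \<in> E' \<and>
       (\<forall>x\<in>\<rat>. \<tau> x = x) \<and> \<tau> \<delta> = \<theta>'))"
    by (rule r.extend_hom) (use dF in \<open>auto intro: rat_imp_algebraic algebraic_F\<close>)
  then obtain f where f: "r.poly_over f" "Polynomial.lead_coeff f = 1" "poly f \<delta> = 0"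
    "\<forall>\<theta>'. poly (r.mp f) \<theta>' = 0 \<longrightarrow> (\<exists>E' \<tau>. field_hom E' \<tau> \<and> (\<forall>x\<in>E'. algebraic x) \<and> \<rat> \<subseteq> E' \<and> \<delta> \<in> E' \<and>
       (\<forall>x\<in>\<rat>. \<tau> x = x) \<and> \<tau> \<delta> = \<theta>')"
    by (elim exE conjE) (rule that)
  have mpf: "r.mp f = f" by (rule poly_eqI) (simp add: r.coeff_mp)
  \<comment> \<open>Every root of \<open>f\<close> is the image of \<open>\<delta>\<close> under
    some embedding of \<open>F\<close>, so the assumption on embeddings applies to all
    conjugates.\<close>
  have root: "algebraic_int z \<and> cmod z < 1 \<and> z \<noteq> 0" if z: "poly f z = 0" for z
  proof -
    have "\<exists>E' \<tau>. field_hom E' \<tau> \<and> (\<forall>x\<in>E'. algebraic x) \<and> \<rat> \<subseteq> E' \<and> \<delta> \<in> E' \<and>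
       (\<forall>x\<in>\<rat>. \<tau> x = x) \<and> \<tau> \<delta> = z" using f(4) z mpf by simp
    then obtain E' \<tau> where \<tau>: "field_hom E' \<tau>" "\<forall>x\<in>E'. algebraic x" "\<delta> \<in> E'" "\<tau> \<delta> = z"
      by (elim exE conjE) (rule that)
    obtain \<rho> where \<rho>: "\<rho> \<in> complex_embeddings F" "\<forall>x\<in>E' \<inter> F. \<rho> x = \<tau> x"
      by (rule extend_embedding[OF \<tau>(1,2)])
    have "\<rho> \<delta> = z" using \<rho>(2) \<tau>(3,4) dF by simp
    then show ?thesis using small[OF \<rho>(1)] algebraic_int_hom[OF field_hom_embedding[OF \<rho>(1)] dF]
        field_hom.hom_nonzero[OF field_hom_embedding[OF \<rho>(1)] dF(1) d(2)] by simp
  qed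
  have f0: "f \<noteq> 0" using f(2) by auto
  from alg_closed_imp_factorization[OF f0]
  obtain A where A: "size A = Polynomial.degree f" "f = Polynomial.smult (Polynomial.lead_coeff f) (\<Prod>x\<in>#A. [:-x, 1:])"
    by (elim exE conjE) (rule that)
  have fA: "f = (\<Prod>x\<in>#A. [:-x, 1:])" using A(2) f(2) by simp
  have rootA: "poly f x = 0" if "x \<in># A" for x
    unfolding fA poly_prod_mset using that by (force simp: prod_mset_zero_iff)
  have eval0: "poly f 0 = (\<Prod>x\<in>#A. - x)"
    unfolding fA by (simp add: poly_prod_mset image_mset.compositionality o_def)
  have prod: "algebraic_int (\<Prod>x\<in>#B. - x) \<and> cmod (\<Prod>x\<in>#B. - x) \<le> 1 \<and> (B \<noteq> {#} \<longrightarrow> cmod (\<Prod>x\<in>#B. - x) < 1) \<and> (\<Prod>x\<in>#B. - x) \<noteq> 0"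
    if "\<forall>x\<in>#B. poly f x = 0" for B
    using that
  proof (induction B)
    case (add x B)
    then have IH: "algebraic_int (\<Prod>x\<in>#B. - x)" "cmod (\<Prod>x\<in>#B. - x) \<le> 1" "(\<Prod>x\<in>#B. - x) \<noteq> 0" by auto
    have x: "algebraic_int x" "cmod x < 1" "x \<noteq> 0" using root[of x] add.prems by auto
    have "cmod x * cmod (\<Prod>x\<in>#B. - x) \<le> cmod x * 1" using IH by (intro mult_left_mono) simp_all
    then have "cmod (- x * (\<Prod>x\<in>#B. - x)) < 1" using x(2) unfolding norm_mult norm_minus_cancel by linarith
    moreover have "algebraic_int (- x * (\<Prod>x\<in>#B. - x))" using x IH by (intro algebraic_int_mult algebraic_int_minus)
    moreover have "- x * (\<Prod>x\<in>#B. - x) \<noteq> 0" using x IH by simp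
    ultimately show ?case by simp
  qed simp
  have "A \<noteq> {#}" using fA f(3) by auto
  then have "algebraic_int (poly f 0)" "cmod (poly f 0) < 1" "poly f 0 \<noteq> 0"
    using prod[of A] rootA eval0 by simp_all
  moreover have "poly f 0 \<in> \<rat>" using f(1) by (simp add: r.poly_over_def poly_0_coeff_0)
  ultimately have "poly f 0 \<in> \<int>" by (intro rational_algebraic_int_is_int)
  then obtain k :: int where "poly f 0 = of_int k" by (rule Ints_cases)
  then show False using \<open>cmod (poly f 0) < 1\<close> \<open>poly f 0 \<noteq> 0\<close> by simp
qed

text \<open>Among infinitely many such integers two differ by a multiple \<open>m * y\<close> with
  \<open>m > 2 * B\<close>. All conjugates of \<open>y\<close> would then have modulus below one,
  which \<open>embedding_ge_1\<close> excludes.\<close>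

lemma finite_bounded_integers:
  "finite {x \<in> Z. \<forall>\<sigma>\<in>complex_embeddings F. cmod (\<sigma> x) \<le> B}"
proof (rule ccontr)
  let ?A = "{x \<in> Z. \<forall>\<sigma>\<in>complex_embeddings F. cmod (\<sigma> x) \<le> B}"
  assume inf: "infinite ?A"
  obtain g :: "nat \<Rightarrow> complex" where g: "inj g" "range g \<subseteq> ?A"
    using infinite_countable_subset[OF inf] by (elim exE conjE) (rule that)
  obtain n :: nat where n: "2 * B < real n" using reals_Archimedean2 by blast
  define m where "m = Suc n"
  have gZ: "g i \<in> Z" for i using g(2) by auto
  obtain j k y where jk: "j < k" "y \<in> Z" "g k - g j = of_nat m * y"
    by (rule pigeonhole_Z[OF _ infinite_UNIV_nat, of m g]) (auto simp: m_def gZ)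
  have "g k \<noteq> g j" using g(1) jk(1) by (auto simp: inj_eq)
  then have "y \<noteq> 0" using jk(3) by auto
  obtain \<sigma> where \<sigma>: "\<sigma> \<in> complex_embeddings F" "cmod (\<sigma> y) \<ge> 1"
    using embedding_ge_1[OF jk(2) \<open>y \<noteq> 0\<close>] by (elim bexE) (rule that)
  interpret field_hom F \<sigma> by (rule field_hom_embedding[OF \<sigma>(1)])
  have "of_nat m * \<sigma> y = \<sigma> (g k - g j)"
    unfolding jk(3) using jk(2) by (simp add: hom_mult hom_of_nat of_nat_closed Z_F)
  also have "\<dots> = \<sigma> (g k) - \<sigma> (g j)" using gZ by (intro hom_diff Z_F)
  finally have "cmod (of_nat m * \<sigma> y) = cmod (\<sigma> (g k) - \<sigma> (g j))" by (rule arg_cong)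
  then have "real m * cmod (\<sigma> y) = cmod (\<sigma> (g k) - \<sigma> (g j))" by (simp add: norm_mult del: of_nat_Suc)
  also have "\<dots> \<le> cmod (\<sigma> (g k)) + cmod (\<sigma> (g j))" by (rule norm_triangle_ineq4)
  also have "\<dots> \<le> B + B"
  proof (rule add_mono)
    show "cmod (\<sigma> (g k)) \<le> B" "cmod (\<sigma> (g j)) \<le> B"
      using subsetD[OF g(2) rangeI, of k] subsetD[OF g(2) rangeI, of j] \<sigma>(1) by simp_all
  qed
  finally have "real m * cmod (\<sigma> y) \<le> 2 * B" by simp
  moreover have "real m * 1 \<le> real m * cmod (\<sigma> y)" using \<sigma>(2) by (intro mult_left_mono) simp_all
  ultimately have "real m \<le> 2 * B" by linarith
  then show False using n by (simp add: m_def)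
qed

end

section \<open>Heights and Northcott's theorem\<close>

no_notation Formal_Power_Series.fps_nth (infixl \<open>$\<close> 75)
no_notation Matrix.vec_index (infixl \<open>$\<close> 100)

lemma hom_coords_refl: "hom_coords x \<Longrightarrow> proj_rel x x"
  unfolding proj_rel_def by (intro conjI exI[of _ 1]) simp_all

lemma proj_point_surj:
  obtains x where "hom_coords x" "proj_point x = P"
proof -
  have "proj_rel (rep_qproj P) (rep_qproj P)" by (rule Quotient3_rep_reflp[OF Quotient3_qproj])
  moreover have "proj_point (rep_qproj P) = P" by (rule Quotient3_abs_rep[OF Quotient3_qproj])
  ultimately show ?thesis using that[of "rep_qproj P"] by (simp add: proj_rel_def)
qed

lemma proj_point_eq_iff:
  "hom_coords x \<Longrightarrow> hom_coords y \<Longrightarrow> proj_point x = proj_point y \<longleftrightarrow> (\<exists>c. c \<noteq> 0 \<and> y = c *s x)"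
  using Quotient3_rel[OF Quotient3_qproj, of x y] hom_coords_refl[of x] hom_coords_refl[of y]
  by (auto simp: proj_rel_def)

definition norm_coords :: "'n::finite qproj \<Rightarrow> complex ^ 'n" where
  "norm_coords P = (SOME x. hom_coords x \<and> proj_point x = P \<and> (\<exists>i. x $ i = 1))"

lemma norm_coords:
  shows "hom_coords (norm_coords P)" "proj_point (norm_coords P) = P" "\<exists>i. norm_coords P $ i = 1"
proof -
  obtain y where y: "hom_coords y" "proj_point y = P" by (rule proj_point_surj)
  then have "\<exists>i. y $ i \<noteq> 0" by (auto simp: hom_coords_def Finite_Cartesian_Product.vec_eq_iff)
  then obtain i where i: "y $ i \<noteq> 0" by (elim exE) (rule that)
  let ?x = "inverse (y $ i) *s y"
  have "hom_coords ?x" using y(1) i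
    by (auto simp: hom_coords_def Finite_Cartesian_Product.vec_eq_iff intro!: algebraic_mult algebraic_inverse)
  moreover have "proj_point ?x = P"
    using proj_point_eq_iff[OF y(1) \<open>hom_coords ?x\<close>] y(2) i
    by (metis inverse_nonzero_iff_nonzero)
  moreover have "?x $ i = 1" using i by simp
  ultimately have "hom_coords ?x \<and> proj_point ?x = P \<and> (\<exists>i. ?x $ i = 1)" by blast
  then have "hom_coords (norm_coords P) \<and> proj_point (norm_coords P) = P \<and> (\<exists>i. norm_coords P $ i = 1)"
    unfolding norm_coords_def by (rule someI)
  then show "hom_coords (norm_coords P)" "proj_point (norm_coords P) = P" "\<exists>i. norm_coords P $ i = 1"
    by simp_all
qed

lemma weil_height_eq:
  "weil_height P = field_height (generate_field CC {norm_coords P $ i | i. True}) (norm_coords P)"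
  by (simp add: weil_height_def norm_coords_def Let_def)

definition proj_over :: "complex set \<Rightarrow> 'n::finite qproj set" where
  "proj_over L = {P. \<exists>x. hom_coords x \<and> (\<forall>i. x $ i \<in> L) \<and> proj_point x = P}"

text \<open>Normalised coordinates arise from coordinates \<open>y\<close> in \<open>L\<close> by
  the factor \<open>inverse (y $ k)\<close>, which is again in \<open>L\<close>.\<close>

lemma norm_coords_over:
  assumes L: "subfield L CC" and P: "P \<in> proj_over L"
  shows "norm_coords P $ i \<in> L"
proof -
  obtain y where y: "hom_coords y" "\<forall>i. y $ i \<in> L" "proj_point y = P"
    using P by (auto simp: proj_over_def)
  note N = norm_coords[of P]
  obtain c where c: "c \<noteq> 0" "norm_coords P = c *s y"
    using proj_point_eq_iff[OF y(1) N(1)] y(3) N(2) by metis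
  obtain k where "norm_coords P $ k = 1" using N(3) by (elim exE) (rule that)
  then have "y $ k * c = 1" using c by (simp add: mult.commute)
  then have "c = inverse (y $ k)" by (rule inverse_unique[symmetric])
  then have "c \<in> L" using y(2) subfield_CC_closed(5)[OF L] by simp
  then show ?thesis using c y subfield_CC_closed(3)[OF L] by simp
qed

context nfield
begin

lemma place_abs_1:
  assumes "nonzero_prime p"
  shows "place_abs F p 1 = 1"
proof -
  have "place_ord F p (1 * 1) = place_ord F p 1 + place_ord F p 1"
    using assms one_F by (intro place_ord_mult) simp_all
  then show ?thesis by (simp add: place_abs_def)
qed

lemma place_abs_le_1:
  assumes "nonzero_prime p" "place_ord F p x \<ge> 0"
  shows "place_abs F p x \<le> 1"
proof (cases "x = 0")
  case False
  have "1 \<le> real (place_norm F p)" using place_norm_pos[OF assms(1)] by simp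
  then have "1 \<le> real (place_norm F p) ^ nat (place_ord F p x)" by (rule one_le_power)
  then have "1 \<le> real (place_norm F p) powi (place_ord F p x)"
    using assms(2) by (simp add: power_int_def)
  then show ?thesis using False by (simp add: place_abs_def power_int_minus inverse_le_1_iff)
qed (simp add: place_abs_def)

lemma ln_place_abs_neg:
  assumes "nonzero_prime p" "place_ord F p x < 0" "x \<noteq> 0"
  shows "ln (place_abs F p x) = ln (real (place_norm F p ^ nat (- place_ord F p x)))"
  using assms by (simp add: place_abs_def power_int_def)

text \<open>The maxima are at least \<open>1\<close> since one of the coordinates is \<open>1\<close>.\<close>

lemma height_terms:
  fixes x :: "complex ^ 'n::finite"
  assumes x: "\<And>i. x $ i \<in> F" "x $ k = 1"
  shows "\<sigma> \<in> complex_embeddings F \<Longrightarrow> 0 \<le> ln (Max {cmod (\<sigma> (x $ i)) | i. True})"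
    and "nonzero_prime p \<Longrightarrow> 0 \<le> ln (Max {place_abs F p (x $ i) | i. True})"
    and "\<sigma> \<in> complex_embeddings F \<Longrightarrow> cmod (\<sigma> (x $ j)) \<le> exp (ln (Max {cmod (\<sigma> (x $ i)) | i. True}))"
    and "nonzero_prime p \<Longrightarrow> place_ord F p (x $ j) < 0 \<Longrightarrow> ln (place_abs F p (x $ j)) \<le> ln (Max {place_abs F p (x $ i) | i. True})"
    and "(\<lambda>p. ln (Max {place_abs F p (x $ i) | i. True})) summable_on {p. nonzero_prime p}"
proof -
  have fin: "finite {f (x $ i) | i. True}" for f :: "complex \<Rightarrow> real"
    by (simp add: full_SetCompr_eq)
  have le: "f (x $ j) \<le> Max {f (x $ i) | i. True}" for f :: "complex \<Rightarrow> real" and j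
    by (rule Max_ge[OF fin]) blast
  { assume s: "\<sigma> \<in> complex_embeddings F"
    interpret field_hom F \<sigma> by (rule field_hom_embedding[OF s])
    have 1: "1 \<le> Max {cmod (\<sigma> (x $ i)) | i. True}" using le[of "\<lambda>z. cmod (\<sigma> z)" k] x(2) hom_1 by simp
    then show "0 \<le> ln (Max {cmod (\<sigma> (x $ i)) | i. True})" by simp
    show "cmod (\<sigma> (x $ j)) \<le> exp (ln (Max {cmod (\<sigma> (x $ i)) | i. True}))"
      using le[of "\<lambda>z. cmod (\<sigma> z)" j] 1 by simp }
  have p1: "1 \<le> Max {place_abs F p (x $ i) | i. True}" if "nonzero_prime p" for p
    using le[of "place_abs F p" k] x(2) place_abs_1[OF that] by simp
  then show "nonzero_prime p \<Longrightarrow> 0 \<le> ln (Max {place_abs F p (x $ i) | i. True})" by simp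
  show "ln (place_abs F p (x $ j)) \<le> ln (Max {place_abs F p (x $ i) | i. True})"
    if p: "nonzero_prime p" "place_ord F p (x $ j) < 0"
  proof (cases "x $ j = 0")
    case True
    then show ?thesis using p1[OF p(1)] by (simp add: place_abs_def)
  next
    case False
    then have "0 < place_abs F p (x $ j)" using place_norm_pos[OF p(1)] by (simp add: place_abs_def)
    then show ?thesis using le[of "place_abs F p" j] p1[OF p(1)] by simp
  qed
  \<comment> \<open>Outside these primes all coordinates are locally integral, and the coordinate
    \<open>1\<close> makes the maximum exactly one.\<close>
  define T where "T = (\<Union>i\<in>{i. x $ i \<noteq> 0}. {p. nonzero_prime p \<and> place_ord F p (x $ i) < 0})"
  have T: "finite T" unfolding T_def using x(1) by (intro finite_UN_I finite_place_ord_neg) simp_all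
  have "ln (Max {place_abs F p (x $ i) | i. True}) = 0" if p: "p \<in> {p. nonzero_prime p} - T" for p
  proof -
    have "place_abs F p (x $ i) \<le> 1" for i
    proof (cases "x $ i = 0")
      case False
      then show ?thesis using p by (intro place_abs_le_1) (auto simp: T_def not_less)
    qed (simp add: place_abs_def)
    then have "Max {place_abs F p (x $ i) | i. True} \<le> 1"
      by (intro Max.boundedI fin) auto
    then have "Max {place_abs F p (x $ i) | i. True} = 1" using p1[of p] p by simp
    then show ?thesis by simp
  qed
  moreover have "T \<subseteq> {p. nonzero_prime p}" by (auto simp: T_def)
  ultimately have "(\<lambda>p. ln (Max {place_abs F p (x $ i) | i. True})) summable_on {p. nonzero_prime p} \<longleftrightarrow>
    (\<lambda>p. ln (Max {place_abs F p (x $ i) | i. True})) summable_on T"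
    by (intro summable_on_cong_neutral) auto
  then show "(\<lambda>p. ln (Max {place_abs F p (x $ i) | i. True})) summable_on {p. nonzero_prime p}"
    using T by simp
qed

lemma field_height_nonneg:
  fixes x :: "complex ^ 'n::finite"
  assumes "\<And>i. x $ i \<in> F" "x $ k = 1"
  shows "0 \<le> field_height F x"
  unfolding field_height_def finite_places_eq
  using height_terms(1,2)[of x k] assms
  by (intro divide_nonneg_nonneg add_nonneg_nonneg sum_nonneg infsum_nonneg) auto

text \<open>\<open>M\<close> bounds the height before division by the degree. As all terms are
  nonnegative, the archimedean ones bound each conjugate of a coordinate by \<open>exp M\<close>,
  and the finite ones bound the logarithm of a denominator \<open>m\<close> by \<open>M\<close>; the
  product gives \<open>exp (2 * M)\<close>.\<close>

lemma height_bound: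
  fixes x :: "complex ^ 'n::finite"
  assumes x: "\<And>i. x $ i \<in> F" "x $ k = 1" and M: "field_height F x * real (field_degree F) \<le> M"
    and deg: "0 < field_degree F"
  shows "\<exists>m::nat. 0 < m \<and> real m \<le> exp M \<and> of_nat m * x $ j \<in> Z \<and>
     (\<forall>\<sigma>\<in>complex_embeddings F. cmod (\<sigma> (of_nat m * x $ j)) \<le> exp (2 * M))"
proof -
  define a where "a = (\<lambda>\<sigma>. ln (Max {cmod (\<sigma> (x $ i)) | i. True}))"
  define b where "b = (\<lambda>p. ln (Max {place_abs F p (x $ i) | i. True}))"
  have a0: "0 \<le> a \<sigma>" if "\<sigma> \<in> complex_embeddings F" for \<sigma>
    unfolding a_def by (rule height_terms(1)[OF x that])
  have b0: "0 \<le> b p" if "nonzero_prime p" for p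
    unfolding b_def by (rule height_terms(2)[OF x that])
  have "(\<Sum>\<sigma>\<in>complex_embeddings F. a \<sigma>) + (\<Sum>\<^sub>\<infinity>p\<in>{p. nonzero_prime p}. b p) \<le> M"
    using M deg by (simp add: field_height_def finite_places_eq a_def b_def)
  moreover have "0 \<le> (\<Sum>\<^sub>\<infinity>p\<in>{p. nonzero_prime p}. b p)" using b0 by (intro infsum_nonneg) simp
  moreover have "0 \<le> (\<Sum>\<sigma>\<in>complex_embeddings F. a \<sigma>)" using a0 by (intro sum_nonneg)
  ultimately have aM: "(\<Sum>\<sigma>\<in>complex_embeddings F. a \<sigma>) \<le> M" and bM: "(\<Sum>\<^sub>\<infinity>p\<in>{p. nonzero_prime p}. b p) \<le> M" and M0: "0 \<le> M"
    by linarith+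
  have arch: "cmod (\<sigma> (x $ j)) \<le> exp M" if s: "\<sigma> \<in> complex_embeddings F" for \<sigma>
  proof -
    have "a \<sigma> \<le> (\<Sum>\<sigma>\<in>complex_embeddings F. a \<sigma>)"
      using s a0 finite_embeddings by (intro member_le_sum) auto
    then have "a \<sigma> \<le> M" using aM by simp
    then have "exp (a \<sigma>) \<le> exp M" by simp
    moreover have "cmod (\<sigma> (x $ j)) \<le> exp (a \<sigma>)" unfolding a_def by (rule height_terms(3)[OF x s])
    ultimately show ?thesis by linarith
  qed
  have "\<exists>m::nat. 0 < m \<and> real m \<le> exp M \<and> of_nat m * x $ j \<in> Z"
  proof (cases "x $ j = 0")
    case True
    then show ?thesis using M0 zero_Z by (intro exI[of _ 1]) simp
  next
    case False
    define T where "T = {p. nonzero_prime p \<and> place_ord F p (x $ j) < 0}"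
    define m where "m = (\<Prod>p\<in>T. place_norm F p ^ nat (- place_ord F p (x $ j)))"
    have T: "finite T" unfolding T_def by (rule finite_place_ord_neg[OF x(1) False])
    have pos: "0 < place_norm F p ^ nat (- place_ord F p (x $ j))" if "p \<in> T" for p
      using that place_norm_pos by (simp add: T_def)
    have pos': "real (place_norm F p ^ nat (- place_ord F p (x $ j))) \<noteq> 0" if "p \<in> T" for p
      using pos[OF that] by (metis less_irrefl of_nat_eq_0_iff)
    have m0: "0 < m" unfolding m_def using pos by (intro prod_pos) simp
    have "ln (real m) = (\<Sum>p\<in>T. ln (real (place_norm F p ^ nat (- place_ord F p (x $ j)))))"
      unfolding m_def of_nat_prod by (rule ln_prod[OF T pos'])
    also have "\<dots> = (\<Sum>p\<in>T. ln (place_abs F p (x $ j)))"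
      using False by (intro sum.cong refl ln_place_abs_neg[symmetric]) (auto simp: T_def)
    also have "\<dots> \<le> (\<Sum>p\<in>T. b p)"
      unfolding b_def by (intro sum_mono height_terms(4)[OF x]) (auto simp: T_def)
    also have "\<dots> \<le> (\<Sum>\<^sub>\<infinity>p\<in>{p. nonzero_prime p}. b p)"
      using T b0 height_terms(5)[OF x] by (intro finite_sum_le_infsum) (auto simp: T_def b_def)
    also have "\<dots> \<le> M" by (rule bM)
    finally have "exp (ln (real m)) \<le> exp M" by simp
    then have "real m \<le> exp M" using m0 by simp
    moreover have "of_nat m * x $ j \<in> Z" unfolding m_def T_def by (rule denominator[OF x(1) False])
    ultimately show ?thesis using m0 by blast
  qed
  then obtain m :: nat where m: "0 < m" "real m \<le> exp M" "of_nat m * x $ j \<in> Z"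
    by (elim exE conjE) (rule that)
  have "cmod (\<sigma> (of_nat m * x $ j)) \<le> exp (2 * M)" if s: "\<sigma> \<in> complex_embeddings F" for \<sigma>
  proof -
    interpret field_hom F \<sigma> by (rule field_hom_embedding[OF s])
    have "cmod (\<sigma> (of_nat m * x $ j)) = real m * cmod (\<sigma> (x $ j))"
      using x(1) by (simp add: hom_mult of_nat_closed hom_of_nat norm_mult)
    also have "\<dots> \<le> exp M * exp M" using m(2) arch[OF s] by (intro mult_mono) simp_all
    also have "\<dots> = exp (2 * M)" by (simp add: exp_add[symmetric])
    finally show ?thesis .
  qed
  then show ?thesis using m by blast
qed

end

lemma embedding_restrict:
  assumes "\<sigma> \<in> complex_embeddings L" "F \<subseteq> L" "1 \<in> F"
    "\<And>x y. x \<in> F \<Longrightarrow> y \<in> F \<Longrightarrow> x + y \<in> F" "\<And>x y. x \<in> F \<Longrightarrow> y \<in> F \<Longrightarrow> x * y \<in> F"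
  shows "restrict \<sigma> F \<in> complex_embeddings F"
  using assms by (auto simp: complex_embeddings_eq is_field_hom_def subset_iff)

lemma norm_coords_field:
  fixes P :: "'n::finite qproj"
  assumes L: "number_field L" and P: "P \<in> proj_over L"
  defines "F \<equiv> generate_field CC {norm_coords P $ i | i. True}"
  shows "number_field F" "F \<subseteq> L" "0 < field_degree F" "field_degree F \<le> field_degree L"
    "norm_coords P $ i \<in> F"
proof -
  have sub: "{norm_coords P $ i | i. True} \<subseteq> L"
    using norm_coords_over[OF _ P] L by (auto simp: number_field_def)
  show "number_field F" "F \<subseteq> L" "0 < field_degree F" "field_degree F \<le> field_degree L"
    unfolding F_def by (rule number_field_generate[OF L sub])+
  show "norm_coords P $ i \<in> F" unfolding F_def by (rule generate_field.incl) blast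
qed

lemma proj_over_exists:
  assumes "number_field K"
  obtains L where "number_field L" "K \<subseteq> L" "P \<in> proj_over L"
proof -
  obtain x where x: "hom_coords x" "proj_point x = P" by (rule proj_point_surj)
  obtain L where L: "number_field L" "K \<subseteq> L" "range (($) x) \<subseteq> L"
    by (rule number_field_extend[OF assms, of "range (($) x)"]) (use x assms in \<open>auto simp: hom_coords_def number_field_def intro!: algebraic_over\<close>)
  have "P \<in> proj_over L" using x L(3) by (auto simp: proj_over_def)
  then show ?thesis by (rule that[OF L(1,2)])
qed

lemma weil_height_nonneg: "0 \<le> weil_height P"
proof -
  obtain L where L: "number_field L" "P \<in> proj_over L"
    by (rule proj_over_exists[OF number_field_Rats])
  note F = norm_coords_field[OF L]
  obtain k where "norm_coords P $ k = 1" using norm_coords(3)[of P] by blast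
  then show ?thesis unfolding weil_height_eq
    using nfield.field_height_nonneg[OF number_field_nfield[OF F(1)], of "norm_coords P" k] F(5) by blast
qed

theorem northcott:
  assumes L: "number_field L"
  shows "finite {P :: 'n::finite qproj. P \<in> proj_over L \<and> weil_height P \<le> B}"
proof -
  interpret L: nfield L "field_degree L" by (rule number_field_nfield[OF L])
  \<comment> \<open>The field of a point in \<open>proj_over L\<close> has degree at most that of
    \<open>L\<close>, so this bound serves all points; the absolute value keeps the product monotone
    for negative \<open>B\<close>.\<close>
  define M where "M = \<bar>B\<bar> * real (field_degree L)"
  define \<Gamma> where "\<Gamma> = {x \<in> L.Z. \<forall>\<sigma>\<in>complex_embeddings L. cmod (\<sigma> x) \<le> exp (2 * M)}"
  define W where "W = (\<lambda>(\<gamma>, m). \<gamma> / of_nat m) ` (\<Gamma> \<times> {m::nat. real m \<le> exp M})"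
  have "finite {m::nat. real m \<le> exp M}"
    by (rule finite_subset[of _ "{..nat \<lfloor>exp M\<rfloor>}"]) (auto simp: le_nat_floor)
  moreover have "finite \<Gamma>" unfolding \<Gamma>_def by (rule L.finite_bounded_integers)
  ultimately have W: "finite W" by (simp add: W_def)
  have coords: "norm_coords P $ j \<in> W" if P: "P \<in> proj_over L" "weil_height P \<le> B" for P :: "'n qproj" and j
  proof -
    define F where "F = generate_field CC {norm_coords P $ i | i. True}"
    note Fp = norm_coords_field[OF L P(1), folded F_def]
    interpret F: nfield F "field_degree F" by (rule number_field_nfield[OF Fp(1)])
    obtain k where k: "norm_coords P $ k = 1" using norm_coords(3)[of P] by blast
    have "field_height F (norm_coords P) * real (field_degree F) \<le> \<bar>B\<bar> * real (field_degree L)"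
      using P(2) Fp(4) by (intro mult_mono) (auto simp: weil_height_eq F_def)
    then have "field_height F (norm_coords P) * real (field_degree F) \<le> M" by (simp add: M_def)
    from F.height_bound[OF Fp(5) k this Fp(3), of j]
    obtain m :: nat where m: "0 < m" "real m \<le> exp M" "of_nat m * norm_coords P $ j \<in> F.Z"
      "\<forall>\<sigma>\<in>complex_embeddings F. cmod (\<sigma> (of_nat m * norm_coords P $ j)) \<le> exp (2 * M)"
      by (elim exE conjE) (rule that)
    \<comment> \<open>The bounds come from embeddings of the smaller field \<open>F\<close>, and
      every embedding of \<open>L\<close> restricts to one of these.\<close>
    have "of_nat m * norm_coords P $ j \<in> \<Gamma>"
      unfolding \<Gamma>_def
    proof (intro CollectI conjI ballI)
      show "of_nat m * norm_coords P $ j \<in> L.Z" using m(3) Fp(2) by (auto simp: F.Z_def L.Z_def)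
      fix \<sigma> assume "\<sigma> \<in> complex_embeddings L"
      then have "restrict \<sigma> F \<in> complex_embeddings F"
        by (rule embedding_restrict) (use Fp(2) F.one_F F.add_F F.mult_F in auto)
      from bspec[OF m(4) this] show "cmod (\<sigma> (of_nat m * norm_coords P $ j)) \<le> exp (2 * M)"
        using m(3) by (simp add: F.Z_F)
    qed
    then show ?thesis unfolding W_def using m(1,2)
      by (intro image_eqI[of _ _ "(of_nat m * norm_coords P $ j, m)"]) simp_all
  qed
  have "finite {x :: complex ^ 'n. \<forall>i. x $ i \<in> W}"
  proof (rule finite_imageD)
    have "vec_nth ` {x :: complex ^ 'n. \<forall>i. x $ i \<in> W} \<subseteq> PiE UNIV (\<lambda>_. W)" by auto
    moreover have "finite (PiE (UNIV :: 'n set) (\<lambda>_. W))" using W by (intro finite_PiE) simp_all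
    ultimately show "finite (vec_nth ` {x :: complex ^ 'n. \<forall>i. x $ i \<in> W})" by (rule finite_subset)
    show "inj_on vec_nth {x :: complex ^ 'n. \<forall>i. x $ i \<in> W}" by (auto simp: inj_on_def Finite_Cartesian_Product.vec_eq_iff)
  qed
  then have "finite (proj_point ` {x :: complex ^ 'n. \<forall>i. x $ i \<in> W})" by (rule finite_imageI)
  moreover have "{P :: 'n qproj. P \<in> proj_over L \<and> weil_height P \<le> B} \<subseteq> proj_point ` {x :: complex ^ 'n. \<forall>i. x $ i \<in> W}"
  proof
    fix P :: "'n qproj" assume "P \<in> {P. P \<in> proj_over L \<and> weil_height P \<le> B}"
    then have "norm_coords P \<in> {x. \<forall>i. x $ i \<in> W}" using coords by simp
    then show "P \<in> proj_point ` {x :: complex ^ 'n. \<forall>i. x $ i \<in> W}"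
      by (intro image_eqI[of _ _ "norm_coords P"]) (simp_all add: norm_coords)
  qed
  ultimately show ?thesis by (rule finite_subset[rotated])
qed

section \<open>Endomorphisms of projective space\<close>

lemma algebraic_prod:
  "(\<And>i. i \<in> A \<Longrightarrow> algebraic (f i :: complex)) \<Longrightarrow> algebraic (prod f A)"
  by (induction A rule: infinite_finite_induct) (auto intro: algebraic_mult)

lemma algebraic_sum:
  "(\<And>i. i \<in> A \<Longrightarrow> algebraic (f i :: complex)) \<Longrightarrow> algebraic (sum f A)"
  by (induction A rule: infinite_finite_induct) (auto intro: algebraic_add)

lemma algebraic_power:
  "algebraic (x :: complex) \<Longrightarrow> algebraic (x ^ n)"
  by (induction n) (auto intro: algebraic_mult)

text \<open>Forms are taken as functions, so that substituting forms into forms is composition and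
  no polynomial arithmetic in several variables appears. The zero function has every degree.\<close>

inductive form_fun :: "nat \<Rightarrow> (complex ^ 'n::finite \<Rightarrow> complex) \<Rightarrow> bool" where
  zero: "form_fun d (\<lambda>x. 0)"
| add: "form_fun d f \<Longrightarrow> form_fun d g \<Longrightarrow> form_fun d (\<lambda>x. f x + g x)"
| monom: "algebraic c \<Longrightarrow> (\<Sum>i\<in>UNIV. m i) = d \<Longrightarrow> form_fun d (\<lambda>x. c * (\<Prod>i\<in>UNIV. (x $ i) ^ m i))"

lemma form_fun_sum:
  "(\<And>j. j \<in> J \<Longrightarrow> form_fun d (f j)) \<Longrightarrow> form_fun d (\<lambda>x. \<Sum>j\<in>J. f j x)"
proof (induction J rule: infinite_finite_induct)
  case (insert j J)
  then have "form_fun d (\<lambda>x. f j x + (\<Sum>j\<in>J. f j x))" by (intro form_fun.add) auto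
  then show ?case using insert.hyps by simp
qed (simp_all add: form_fun.zero)

lemma form_fun_eval:
  assumes "\<And>m. algebraic (Poly_Mapping.lookup p m)" "homogeneous d p"
  shows "form_fun d (eval_cpoly p)"
proof -
  have "form_fun d (\<lambda>x. \<Sum>m\<in>Poly_Mapping.keys p.
     Poly_Mapping.lookup p m * (\<Prod>i\<in>UNIV. (x $ i) ^ Poly_Mapping.lookup m i))"
    by (intro form_fun_sum form_fun.monom assms) (use assms(2) in \<open>auto simp: homogeneous_def\<close>)
  moreover have "eval_cpoly p = (\<lambda>x. \<Sum>m\<in>Poly_Mapping.keys p.
     Poly_Mapping.lookup p m * (\<Prod>i\<in>UNIV. (x $ i) ^ Poly_Mapping.lookup m i))"
    by (simp add: eval_cpoly_def fun_eq_iff)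
  ultimately show ?thesis by simp
qed

lemma eval_cpoly_superset:
  assumes "finite M" "Poly_Mapping.keys p \<subseteq> M"
  shows "eval_cpoly p x = (\<Sum>m\<in>M. Poly_Mapping.lookup p m * (\<Prod>i\<in>UNIV. (x $ i) ^ Poly_Mapping.lookup m i))"
  unfolding eval_cpoly_def using assms
  by (intro sum.mono_neutral_left) (auto simp: in_keys_iff)

lemma eval_cpoly_add: "eval_cpoly (p + q) x = eval_cpoly p x + eval_cpoly q x"
proof -
  let ?M = "Poly_Mapping.keys p \<union> Poly_Mapping.keys q"
  have M: "finite ?M" "Poly_Mapping.keys (p + q) \<subseteq> ?M" by (simp_all add: Poly_Mapping.keys_add)
  show ?thesis
    by (simp add: eval_cpoly_superset[OF M] eval_cpoly_superset[OF M(1), of p] eval_cpoly_superset[OF M(1), of q]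
        lookup_add sum.distrib[symmetric] ring_distribs)
qed

lemma form_fun_imp_eval:
  assumes "form_fun d f"
  shows "\<exists>p. (\<forall>m. algebraic (Poly_Mapping.lookup p m)) \<and> homogeneous d p \<and> eval_cpoly p = f"
  using assms
proof (induction rule: form_fun.induct)
  case (zero d)
  show ?case by (intro exI[of _ 0]) (simp add: homogeneous_def eval_cpoly_def fun_eq_iff)
next
  case (add d f g)
  then obtain p q where "\<forall>m. algebraic (Poly_Mapping.lookup p m)" "homogeneous d p" "eval_cpoly p = f"
    "\<forall>m. algebraic (Poly_Mapping.lookup q m)" "homogeneous d q" "eval_cpoly q = g"
    by (elim exE conjE) (rule that)
  then show ?case using Poly_Mapping.keys_add[of p q]
    by (intro exI[of _ "p + q"]) (auto simp: lookup_add homogeneous_def fun_eq_iff eval_cpoly_add intro: algebraic_add)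
next
  case (monom c m d)
  define e where "e = Abs_poly_mapping m"
  have e: "Poly_Mapping.lookup e = m" unfolding e_def by (rule lookup_Abs_poly_mapping) simp
  show ?case
  proof (intro exI[of _ "Poly_Mapping.single e c"] conjI allI)
    fix k show "algebraic (Poly_Mapping.lookup (Poly_Mapping.single e c) k)"
      using monom(1) by (simp add: lookup_single when_def)
    show "homogeneous d (Poly_Mapping.single e c)"
      using monom(2) e by (simp add: homogeneous_def)
    have "eval_cpoly (Poly_Mapping.single e c) x = c * (\<Prod>i\<in>UNIV. (x $ i) ^ m i)" for x
      by (subst eval_cpoly_superset[of "{e}"]) (simp_all add: e)
    then show "eval_cpoly (Poly_Mapping.single e c) = (\<lambda>x. c * (\<Prod>i\<in>UNIV. (x $ i) ^ m i))" by blast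
  qed
qed

lemma form_fun_mult:
  assumes "form_fun d f" "form_fun e g"
  shows "form_fun (d + e) (\<lambda>x. f x * g x)"
  using assms
proof (induction rule: form_fun.induct)
  case (zero d)
  then show ?case by (simp add: form_fun.zero)
next
  case (add d f f')
  then show ?case by (simp add: ring_distribs form_fun.add)
next
  case (monom c m d)
  show ?case using monom(3)
  proof (induction rule: form_fun.induct)
    case (zero e)
    then show ?case by (simp add: form_fun.zero)
  next
    case (add e f f')
    then show ?case by (simp add: ring_distribs form_fun.add)
  next
    case (monom c' m' e)
    have "form_fun (d + e) (\<lambda>x. (c * c') * (\<Prod>i\<in>UNIV. (x $ i) ^ (m i + m' i)))"
      using monom \<open>algebraic c\<close> \<open>(\<Sum>i\<in>UNIV. m i) = d\<close>
      by (intro form_fun.monom algebraic_mult) (simp_all add: sum.distrib)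
    then show ?case by (simp add: power_add prod.distrib mult_ac)
  qed
qed

lemma form_fun_const: "algebraic c \<Longrightarrow> form_fun 0 (\<lambda>x. c)"
  using form_fun.monom[of c "\<lambda>_. 0" 0] by simp

lemma form_fun_power: "form_fun d f \<Longrightarrow> form_fun (d * n) (\<lambda>x. f x ^ n)"
proof (induction n)
  case (Suc n)
  then show ?case using form_fun_mult[OF Suc.prems Suc.IH] by simp
qed (simp add: form_fun_const)

lemma form_fun_prod:
  "finite I \<Longrightarrow> (\<And>i. i \<in> I \<Longrightarrow> form_fun (d i) (f i)) \<Longrightarrow> form_fun (\<Sum>i\<in>I. d i) (\<lambda>x. \<Prod>i\<in>I. f i x)"
  by (induction I rule: finite_induct) (simp_all add: form_fun_const form_fun_mult)

lemma form_fun_compose: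
  assumes "form_fun d f" "\<And>i. form_fun e (g i)"
  shows "form_fun (d * e) (\<lambda>x. f (\<chi> i. g i x))"
  using assms(1)
proof (induction rule: form_fun.induct)
  case (monom c m d)
  have "form_fun (0 + (\<Sum>i\<in>UNIV. e * m i)) (\<lambda>x. c * (\<Prod>i\<in>UNIV. g i x ^ m i))"
    using monom by (intro form_fun_mult form_fun_const form_fun_prod form_fun_power assms(2)) simp_all
  also have "0 + (\<Sum>i\<in>UNIV. e * m i) = d * e" using monom(2) by (simp add: sum_distrib_left[symmetric])
  finally show ?case by simp
qed (simp_all add: form_fun.zero form_fun.add)

lemma form_fun_scale: "form_fun d f \<Longrightarrow> f (c *s x) = c ^ d * f x"
proof (induction rule: form_fun.induct)
  case (monom a m d)
  have "(\<Prod>i\<in>UNIV. c ^ m i) = c ^ d" unfolding monom(2)[symmetric] by (rule power_sum[symmetric])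
  then show ?case by (simp add: power_mult_distrib prod.distrib mult_ac)
qed (simp_all add: ring_distribs)

lemma form_fun_algebraic:
  "form_fun d f \<Longrightarrow> (\<And>i. algebraic (x $ i)) \<Longrightarrow> algebraic (f x)"
  by (induction rule: form_fun.induct)
    (auto intro!: algebraic_add algebraic_mult algebraic_prod algebraic_power)

section \<open>Restriction of forms to lines\<close>

definition alg_poly :: "complex poly \<Rightarrow> bool" where
  "alg_poly p \<longleftrightarrow> (\<forall>i. algebraic (Polynomial.coeff p i))"

lemma alg_poly_1: "alg_poly 1"
  by (simp add: alg_poly_def)

lemma alg_poly_mult: "alg_poly p \<Longrightarrow> alg_poly q \<Longrightarrow> alg_poly (p * q)"
  by (auto simp: alg_poly_def coeff_mult intro!: algebraic_sum algebraic_mult)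

lemma alg_poly_power: "alg_poly p \<Longrightarrow> alg_poly (p ^ n)"
  by (induction n) (auto intro: alg_poly_mult alg_poly_1)

lemma alg_poly_prod: "(\<And>i. i \<in> I \<Longrightarrow> alg_poly (f i)) \<Longrightarrow> alg_poly (prod f I)"
  by (induction I rule: infinite_finite_induct) (auto intro: alg_poly_mult alg_poly_1)

lemma form_fun_line:
  assumes "form_fun d f" "\<And>i. algebraic (u $ i)" "\<And>i. algebraic (v $ i)"
  shows "\<exists>p. alg_poly p \<and> (\<forall>t. poly p t = f (u + t *s v))"
  using assms(1)
proof (induction rule: form_fun.induct)
  case (zero d)
  show ?case by (intro exI[of _ 0]) (simp add: alg_poly_def)
next
  case (add d f g)
  then obtain p q where "alg_poly p" "\<forall>t. poly p t = f (u + t *s v)" "alg_poly q" "\<forall>t. poly q t = g (u + t *s v)"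
    by (elim exE conjE) (rule that)
  then show ?case by (intro exI[of _ "p + q"]) (auto simp: alg_poly_def intro: algebraic_add)
next
  case (monom c m d)
  show ?case
    by (intro exI[of _ "[:c:] * (\<Prod>i\<in>UNIV. [:u $ i, v $ i:] ^ m i)"] conjI alg_poly_mult alg_poly_prod alg_poly_power)
      (auto simp: alg_poly_def coeff_pCons poly_prod monom(1) assms split: nat.splits)
qed

section \<open>Morphisms represented by forms and uniqueness of the degree\<close>

definition rep_by :: "('n::finite \<Rightarrow> complex ^ 'n \<Rightarrow> complex) \<Rightarrow> nat \<Rightarrow> ('n qproj \<Rightarrow> 'n qproj) \<Rightarrow> bool" where
  "rep_by f d \<phi> \<longleftrightarrow> (\<forall>i. form_fun d (f i)) \<and> (\<forall>x. hom_coords x \<longrightarrow> (\<exists>i. f i x \<noteq> 0)) \<and>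
     (\<forall>x. hom_coords x \<longrightarrow> \<phi> (proj_point x) = proj_point (\<chi> i. f i x))"

lemma rep_byD:
  assumes "rep_by f d \<phi>"
  shows "form_fun d (f i)" "hom_coords x \<Longrightarrow> \<exists>i. f i x \<noteq> 0"
    "hom_coords x \<Longrightarrow> \<phi> (proj_point x) = proj_point (\<chi> i. f i x)"
  using assms unfolding rep_by_def by blast+

lemma proj_morphism_iff:
  "proj_morphism {z. algebraic z} d \<phi> \<longleftrightarrow> (\<exists>f. rep_by f d \<phi>)"
proof
  assume "proj_morphism {z. algebraic z} d \<phi>"
  then obtain F where F: "\<forall>i m. Poly_Mapping.lookup (F i) m \<in> {z. algebraic z}" "\<forall>i. homogeneous d (F i)"
     "\<forall>x. hom_coords x \<longrightarrow> (\<exists>i. eval_cpoly (F i) x \<noteq> 0)"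
     "\<forall>x. hom_coords x \<longrightarrow> \<phi> (proj_point x) = proj_point (\<chi> i. eval_cpoly (F i) x)"
    unfolding proj_morphism_def by (elim exE conjE) (rule that)
  have "form_fun d (eval_cpoly (F i))" for i using F(1,2) by (intro form_fun_eval) auto
  then have "rep_by (\<lambda>i. eval_cpoly (F i)) d \<phi>" using F(3,4) by (simp add: rep_by_def)
  then show "\<exists>f. rep_by f d \<phi>" by (intro exI[of _ "\<lambda>i. eval_cpoly (F i)"])
next
  assume "\<exists>f. rep_by f d \<phi>"
  then obtain f where f: "rep_by f d \<phi>" by (elim exE) (rule that)
  then have "\<forall>i. \<exists>p. (\<forall>m. algebraic (Poly_Mapping.lookup p m)) \<and> homogeneous d p \<and> eval_cpoly p = f i"
    by (intro allI form_fun_imp_eval) (simp add: rep_by_def)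
  then have "\<exists>F. \<forall>i. (\<forall>m. algebraic (Poly_Mapping.lookup (F i) m)) \<and> homogeneous d (F i) \<and> eval_cpoly (F i) = f i"
    by (rule choice)
  then obtain F where "\<forall>i. (\<forall>m. algebraic (Poly_Mapping.lookup (F i) m)) \<and> homogeneous d (F i) \<and> eval_cpoly (F i) = f i"
    by (elim exE) (rule that)
  then show "proj_morphism {z. algebraic z} d \<phi>"
    using f unfolding proj_morphism_def rep_by_def by (intro exI[of _ F]) simp
qed

lemma hom_coords_rep:
  assumes "rep_by f d \<phi>" "hom_coords x"
  shows "hom_coords (\<chi> i. f i x)"
proof -
  obtain i where "f i x \<noteq> 0" using assms unfolding rep_by_def by metis
  then have "(\<chi> i. f i x) \<noteq> 0" by (auto simp: Finite_Cartesian_Product.vec_eq_iff)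
  moreover have "algebraic (f i x)" for i
  proof (rule form_fun_algebraic)
    show "form_fun d (f i)" using assms(1) unfolding rep_by_def by blast
    show "algebraic (x $ i)" for i using assms(2) by (simp add: hom_coords_def)
  qed
  ultimately show ?thesis by (simp add: hom_coords_def)
qed

lemma rep_by_comp:
  assumes f: "rep_by f d \<phi>" and g: "rep_by g e \<psi>"
  shows "rep_by (\<lambda>i x. f i (\<chi> i. g i x)) (d * e) (\<phi> \<circ> \<psi>)"
  using f g hom_coords_rep[OF g] unfolding rep_by_def by (simp add: form_fun_compose)

lemma rep_by_id: "rep_by (\<lambda>i (x :: complex ^ 'n::finite). x $ i) 1 id"
proof -
  have "form_fun 1 (\<lambda>x :: complex ^ 'n. x $ i)" for i
    using form_fun.monom[of 1 "\<lambda>j. if j = i then 1 else 0" 1] by (simp add: if_distrib[of "\<lambda>n. _ ^ n"] cong: if_cong)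
  moreover have "\<exists>i. x $ i \<noteq> 0" if "hom_coords x" for x :: "complex ^ 'n"
    using that by (auto simp: hom_coords_def Finite_Cartesian_Product.vec_eq_iff)
  ultimately show ?thesis by (simp add: rep_by_def)
qed

text \<open>The absence of common zeros is known at algebraic parameters. A common root is a root of
  a nonzero polynomial with algebraic coefficients, so the absence extends to all complex
  parameters.\<close>

lemma no_common_root:
  assumes p: "\<And>i. alg_poly (p i)" and nz: "\<And>t. algebraic t \<Longrightarrow> \<exists>i. poly (p i) t \<noteq> 0"
  shows "\<exists>i. poly (p i) t \<noteq> 0"
proof (rule ccontr)
  assume *: "\<not> (\<exists>i. poly (p i) t \<noteq> 0)"
  obtain i where i: "poly (p i) 0 \<noteq> 0" using nz[of 0] by auto
  then have "p i \<noteq> 0" by auto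
  have "algebraic t"
    by (rule algebraic_root[OF _ \<open>p i \<noteq> 0\<close>]) (use p * in \<open>auto simp: alg_poly_def\<close>)
  then show False using nz * by blast
qed

text \<open>At each \<open>t\<close> some \<open>p j\<close> does not vanish, so
  \<open>p k * q j = p j * q k\<close> bounds the order of \<open>p k\<close> at \<open>t\<close> by
  that of \<open>q k\<close>. By symmetry the roots agree with multiplicity, and \<open>q k\<close>
  is a constant multiple of \<open>p k\<close>.\<close>

lemma proportional_polys:
  fixes p q :: "'i \<Rightarrow> complex poly"
  assumes p: "\<And>t. \<exists>i. poly (p i) t \<noteq> 0" and q: "\<And>t. \<exists>i. poly (q i) t \<noteq> 0"
    and eq: "\<And>i j. p i * q j = p j * q i"
  obtains c where "\<And>i. q i = Polynomial.smult c (p i)"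
proof -
  obtain k where k: "poly (p k) 0 \<noteq> 0" using p[of 0] by (elim exE) (rule that)
  then have pk: "p k \<noteq> 0" by auto
  have qk: "q k \<noteq> 0"
  proof
    assume "q k = 0"
    then have "q j = 0" for j using eq[of k j] pk by simp
    then show False using q[of 0] by simp
  qed
  have le: "Polynomial.order t (p k) \<le> Polynomial.order t (q k)"
    if p: "\<And>t. \<exists>i. poly (p i) t \<noteq> 0" and eq: "\<And>i j. p i * q j = p j * q i" and nz: "p k \<noteq> 0" "q k \<noteq> 0"
    for p q :: "'i \<Rightarrow> complex poly" and t
  proof -
    obtain j where j: "poly (p j) t \<noteq> 0" using p[of t] by (elim exE) (rule that)
    have pj: "p j \<noteq> 0" using j by auto
    have nz': "p j * q k \<noteq> 0" using pj nz by simp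
    then have nz'': "p k * q j \<noteq> 0" using eq[of k j] by simp
    have "Polynomial.order t (p k) \<le> Polynomial.order t (p k * q j)" using order_mult[OF nz''] by simp
    also have "\<dots> = Polynomial.order t (p j) + Polynomial.order t (q k)" using eq[of k j] order_mult[OF nz'] by simp
    also have "Polynomial.order t (p j) = 0" using j by (simp add: order_0I)
    finally show ?thesis by simp
  qed
  have eq': "q i * p j = q j * p i" for i j using eq[of j i] by (simp add: mult.commute)
  have "Polynomial.order t (p k) = Polynomial.order t (q k)" for t
  proof (rule antisym)
    show "Polynomial.order t (p k) \<le> Polynomial.order t (q k)" by (rule le) (fact p eq pk qk)+
    show "Polynomial.order t (q k) \<le> Polynomial.order t (p k)" by (rule le) (fact q eq' pk qk)+
  qed
  then have roots: "proots (p k) = proots (q k)" using pk qk by (intro multiset_eqI) simp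
  define c where "c = Polynomial.lead_coeff (q k) / Polynomial.lead_coeff (p k)"
  have c: "c * Polynomial.lead_coeff (p k) = Polynomial.lead_coeff (q k)" using pk by (simp add: c_def)
  have "q k = Polynomial.smult (Polynomial.lead_coeff (q k)) (\<Prod>x\<in>#proots (p k). [:- x, 1:])"
    unfolding roots by (rule complex_poly_decompose_multiset[symmetric])
  also have "\<dots> = Polynomial.smult c (Polynomial.smult (Polynomial.lead_coeff (p k)) (\<Prod>x\<in>#proots (p k). [:- x, 1:]))"
    by (simp only: smult_smult c)
  also have "\<dots> = Polynomial.smult c (p k)" by (simp only: complex_poly_decompose_multiset)
  finally have qp: "q k = Polynomial.smult c (p k)" .
  have "q i = Polynomial.smult c (p i)" for i
  proof -
    have "p k * q i = p k * Polynomial.smult c (p i)" using eq[of k i] qp by (simp add: mult.commute)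
    then show ?thesis using pk by (simp only: mult_cancel_left simp_thms)
  qed
  then show ?thesis by (rule that)
qed

text \<open>On the line through two coordinate points \<open>u\<close> and \<open>v\<close> both
  representations are tuples without common root, hence proportional by a constant \<open>c\<close>.
  In the other chart \<open>g (v + s u) = c s^(e - d) f (v + s u)\<close>, so for
  \<open>d < e\<close> the tuple \<open>g\<close> vanishes at \<open>v\<close>. The number of
  coordinates provides the line.\<close>

lemma rep_by_degree_le:
  fixes \<phi> :: "'n::finite qproj \<Rightarrow> 'n qproj"
  assumes card: "2 \<le> CARD('n)" and f: "rep_by f d \<phi>" and g: "rep_by g e \<phi>"
  shows "e \<le> d"
proof (rule ccontr)
  assume "\<not> e \<le> d"
  then have de: "d < e" by simp
  obtain a b :: 'n where ab: "a \<noteq> b"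
    using card card_le_Suc0_iff_eq[of "UNIV :: 'n set"] by fastforce
  define u where "u = (axis a 1 :: complex ^ 'n)"
  define v where "v = (axis b 1 :: complex ^ 'n)"
  have au: "algebraic (u $ i)" "algebraic (v $ i)" for i
    by (simp_all add: u_def v_def axis_def)
  have line: "hom_coords (u + t *s v)" "hom_coords (v + t *s u)" if "algebraic t" for t
  proof -
    have "(u + t *s v) $ a = 1" "(v + t *s u) $ b = 1" using ab by (simp_all add: u_def v_def axis_def)
    then have "u + t *s v \<noteq> 0" "v + t *s u \<noteq> 0" by (metis zero_index zero_neq_one)+
    then show "hom_coords (u + t *s v)" "hom_coords (v + t *s u)"
      using that au by (simp_all add: hom_coords_def algebraic_add algebraic_mult)
  qed
  have ff: "form_fun d (f i)" and gg: "form_fun e (g i)" for i by (rule rep_byD(1)[OF f] rep_byD(1)[OF g])+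
  have "\<forall>i. \<exists>p. alg_poly p \<and> (\<forall>t. poly p t = f i (u + t *s v))"
    by (intro allI form_fun_line[OF ff au])
  then obtain p where p: "\<forall>i. alg_poly (p i) \<and> (\<forall>t. poly (p i) t = f i (u + t *s v))"
    by (rule choice[THEN exE])
  have "\<forall>i. \<exists>p. alg_poly p \<and> (\<forall>t. poly p t = g i (u + t *s v))"
    by (intro allI form_fun_line[OF gg au])
  then obtain q where q: "\<forall>i. alg_poly (q i) \<and> (\<forall>t. poly (q i) t = g i (u + t *s v))"
    by (rule choice[THEN exE])
  have "\<exists>i. poly (p i) t \<noteq> 0" for t
    by (rule no_common_root) (use p rep_byD(2)[OF f line(1)] in auto)
  moreover have "\<exists>i. poly (q i) t \<noteq> 0" for t
    by (rule no_common_root) (use q rep_byD(2)[OF g line(1)] in auto)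
  moreover have "p i * q j = p j * q i" for i j
  proof -
    \<comment> \<open>Natural numbers are algebraic, so these parameters give points of the
      projective space, and there are enough of them to force a polynomial identity.\<close>
    have "poly (p i * q j - p j * q i) (of_nat n) = 0" for n
    proof -
      let ?x = "u + of_nat n *s v"
      have x: "hom_coords ?x" by (intro line rat_imp_algebraic) simp
      have "proj_point (\<chi> i. f i ?x) = proj_point (\<chi> i. g i ?x)" using rep_byD(3)[OF f x] rep_byD(3)[OF g x] by simp
      then obtain c where "(\<chi> i. g i ?x) = c *s (\<chi> i. f i ?x)"
        using proj_point_eq_iff[OF hom_coords_rep[OF f x] hom_coords_rep[OF g x]] by metis
      then have "g i ?x = c * f i ?x" for i by (simp add: Finite_Cartesian_Product.vec_eq_iff)
      then show ?thesis using p q by simp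
    qed
    then have "range of_nat \<subseteq> {t. poly (p i * q j - p j * q i) t = 0}" by auto
    moreover have "infinite (range (of_nat :: nat \<Rightarrow> complex))" by (simp add: finite_image_iff inj_of_nat)
    ultimately have "infinite {t. poly (p i * q j - p j * q i) t = 0}" using finite_subset by blast
    then have "p i * q j - p j * q i = 0" using poly_roots_finite by blast
    then show ?thesis by simp
  qed
  ultimately obtain c where c: "\<And>i. q i = Polynomial.smult c (p i)"
    using proportional_polys[of p q] by metis
  have gf: "g i (u + t *s v) = c * f i (u + t *s v)" for i t
    using p q c[of i] by (metis poly_smult)
  have "g i v = 0" for i
  proof -
    obtain P where P: "\<forall>t. poly P t = f i (v + t *s u)" using form_fun_line[OF ff au(2,1)] by metis
    obtain Q where Q: "\<forall>t. poly Q t = g i (v + t *s u)" using form_fun_line[OF gg au(2,1)] by metis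
    \<comment> \<open>Homogeneity gives the comparison for \<open>s\<close> nonzero; being
      polynomial it extends to \<open>s = 0\<close>, where the factor \<open>s ^ (e - d)\<close>
      vanishes.\<close>
    define R where "R = Q - Polynomial.smult c (Polynomial.monom 1 (e - d) * P)"
    have "poly R s = 0" if s: "s \<noteq> 0" for s
    proof -
      have eq: "v + s *s u = s *s (u + inverse s *s v)"
        using s by (simp add: Finite_Cartesian_Product.vec_eq_iff distrib_left)
      have "poly Q s = g i (s *s (u + inverse s *s v))" by (simp only: Q[rule_format] eq)
      also have "\<dots> = s ^ e * (c * f i (u + inverse s *s v))" by (simp only: form_fun_scale[OF gg] gf)
      also have "\<dots> = c * s ^ (e - d) * (s ^ d * f i (u + inverse s *s v))"
        using de by (simp add: power_add[symmetric] mult_ac) 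
      also have "s ^ d * f i (u + inverse s *s v) = poly P s"
        by (simp only: P[rule_format] eq form_fun_scale[OF ff])
      finally show ?thesis by (simp add: R_def poly_monom)
    qed
    then have "UNIV - {0} \<subseteq> {s. poly R s = 0}" by auto
    moreover have "infinite (UNIV - {0 :: complex})" by (simp add: infinite_UNIV_char_0)
    ultimately have "infinite {s. poly R s = 0}" using finite_subset by blast
    then have "R = 0" using poly_roots_finite by blast
    then have "poly R 0 = 0" by simp
    then have "poly Q 0 = 0" using de by (simp add: R_def poly_monom)
    then show ?thesis using Q by simp
  qed
  moreover have "hom_coords v" using line(2)[of 0] by simp
  ultimately show False using rep_byD(2)[OF g, of v] by blast
qed

lemma endo_degree_eq:
  fixes \<phi> :: "'n::finite qproj \<Rightarrow> 'n qproj"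
  assumes "2 \<le> CARD('n)" "rep_by f d \<phi>"
  shows "endo_degree \<phi> = d"
  unfolding endo_degree_def proj_morphism_iff
  using rep_by_degree_le[OF assms(1)] assms(2) by (intro the_equality) (auto intro: antisym)

lemma endomorphism_rep:
  fixes \<phi> :: "'n::finite qproj \<Rightarrow> 'n qproj"
  assumes "2 \<le> CARD('n)" "endomorphism \<phi>"
  obtains f where "rep_by f (endo_degree \<phi>) \<phi>"
proof -
  obtain f d where "rep_by f d \<phi>" using assms(2) by (auto simp: endomorphism_def proj_morphism_iff)
  then show ?thesis using endo_degree_eq[OF assms(1)] that by metis
qed

lemma endomorphism_comp:
  fixes \<phi> \<psi> :: "'n::finite qproj \<Rightarrow> 'n qproj"
  assumes "2 \<le> CARD('n)" "endomorphism \<phi>" "endomorphism \<psi>"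
  shows "endomorphism (\<phi> \<circ> \<psi>)" "endo_degree (\<phi> \<circ> \<psi>) = endo_degree \<phi> * endo_degree \<psi>"
proof -
  obtain f where f: "rep_by f (endo_degree \<phi>) \<phi>" by (rule endomorphism_rep[OF assms(1,2)])
  obtain g where g: "rep_by g (endo_degree \<psi>) \<psi>" by (rule endomorphism_rep[OF assms(1,3)])
  note c = rep_by_comp[OF f g]
  then show "endomorphism (\<phi> \<circ> \<psi>)" unfolding endomorphism_def proj_morphism_iff by (intro exI)
  show "endo_degree (\<phi> \<circ> \<psi>) = endo_degree \<phi> * endo_degree \<psi>" by (rule endo_degree_eq[OF assms(1) c])
qed

lemma endomorphism_id:
  assumes "2 \<le> CARD('n::finite)"
  shows "endomorphism (id :: 'n qproj \<Rightarrow> 'n qproj)" "endo_degree (id :: 'n qproj \<Rightarrow> 'n qproj) = 1"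
  using endo_degree_eq[OF assms rep_by_id] rep_by_id
  by (auto simp: endomorphism_def proj_morphism_iff)

lemma proj_over_image:
  assumes L: "number_field L" "K \<subseteq> L" and \<phi>: "defined_over K \<phi>" and P: "P \<in> proj_over L"
  shows "\<phi> P \<in> proj_over L"
proof -
  obtain d F where F: "\<forall>i m. Poly_Mapping.lookup (F i) m \<in> K"
     "\<forall>x. hom_coords x \<longrightarrow> (\<exists>i. eval_cpoly (F i) x \<noteq> 0)"
     "\<forall>x. hom_coords x \<longrightarrow> \<phi> (proj_point x) = proj_point (\<chi> i. eval_cpoly (F i) x)"
    using \<phi> unfolding defined_over_def proj_morphism_def by (elim exE conjE) (rule that)
  obtain x where x: "hom_coords x" "\<forall>i. x $ i \<in> L" "proj_point x = P" using P by (auto simp: proj_over_def)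
  interpret nfield L "field_degree L" by (rule number_field_nfield[OF L(1)])
  have L': "eval_cpoly (F i) x \<in> L" for i
    unfolding eval_cpoly_def using F(1) L(2) x(2) by (intro sum_F mult_F prod_F power_F) auto
  obtain i where "eval_cpoly (F i) x \<noteq> 0" using F(2) x(1) by metis
  then have "(\<chi> i. eval_cpoly (F i) x) \<noteq> 0" by (auto simp: Finite_Cartesian_Product.vec_eq_iff)
  then have "hom_coords (\<chi> i. eval_cpoly (F i) x)" using L' algebraic_F by (simp add: hom_coords_def)
  moreover have "\<phi> P = proj_point (\<chi> i. eval_cpoly (F i) x)" using F(3) x by auto
  ultimately show ?thesis using L' unfolding proj_over_def
    by (intro CollectI exI[of _ "\<chi> i. eval_cpoly (F i) x"]) simp
qed

section \<open>The strong law of large numbers and recurrence of words\<close>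

context sequence_space
begin

section \<open>Prepending an independent term to a random sequence\<close>

lemma prob_space_S: "prob_space S"
  by (rule prob_space_PiM) (rule M.prob_space_axioms)

interpretation MS: pair_prob_space M S by unfold_locales

text \<open>An independent first term put in front of a sequence leaves its law unchanged
  (\<open>PiM_iter\<close>), so integrals over sequences become integrals over pairs of a term and a
  tail.\<close>

lemma integrable_case_nat:
  fixes g :: "(nat \<Rightarrow> 'a) \<Rightarrow> real"
  assumes "g \<in> borel_measurable S"
  shows "integrable S g \<longleftrightarrow> integrable (M \<Otimes>\<^sub>M S) (\<lambda>(s, \<omega>). g (case_nat s \<omega>))"
    and "integral\<^sup>L S g = integral\<^sup>L (M \<Otimes>\<^sub>M S) (\<lambda>(s, \<omega>). g (case_nat s \<omega>))"
proof -
  have "integrable S g \<longleftrightarrow> integrable (distr (M \<Otimes>\<^sub>M S) S (\<lambda>(s, \<omega>). case_nat s \<omega>)) g"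
    by (simp only: PiM_iter)
  also have "\<dots> \<longleftrightarrow> integrable (M \<Otimes>\<^sub>M S) (\<lambda>x. g ((\<lambda>(s, \<omega>). case_nat s \<omega>) x))"
    using assms by (intro integrable_distr_eq) simp_all
  finally show "integrable S g \<longleftrightarrow> integrable (M \<Otimes>\<^sub>M S) (\<lambda>(s, \<omega>). g (case_nat s \<omega>))"
    by (simp add: split_def)
  have "integral\<^sup>L S g = integral\<^sup>L (distr (M \<Otimes>\<^sub>M S) S (\<lambda>(s, \<omega>). case_nat s \<omega>)) g"
    by (simp only: PiM_iter)
  also have "\<dots> = integral\<^sup>L (M \<Otimes>\<^sub>M S) (\<lambda>x. g ((\<lambda>(s, \<omega>). case_nat s \<omega>) x))"
    using assms by (intro integral_distr) simp_all
  finally show "integral\<^sup>L S g = integral\<^sup>L (M \<Otimes>\<^sub>M S) (\<lambda>(s, \<omega>). g (case_nat s \<omega>))"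
    by (simp add: split_def)
qed

lemma integrable_fst_pair:
  fixes f :: "'b \<Rightarrow> real"
  assumes "integrable N f" "prob_space M'"
  shows "integrable (N \<Otimes>\<^sub>M M') (\<lambda>x. f (fst x))"
proof -
  have "integrable (distr (N \<Otimes>\<^sub>M M') N fst) f"
    using assms(1) by (simp add: prob_space.distr_pair_fst[OF assms(2)])
  then show ?thesis by (rule integrable_distr[rotated]) simp
qed

lemma integrable_pair_snd:
  fixes g :: "(nat \<Rightarrow> 'a) \<Rightarrow> real"
  assumes "integrable S g"
  shows "integrable (M \<Otimes>\<^sub>M S) (\<lambda>x. g (snd x))"
proof -
  interpret SM: pair_prob_space S M by unfold_locales
  have "integrable (S \<Otimes>\<^sub>M M) (\<lambda>x. g (fst x))"
    by (rule integrable_fst_pair[OF assms M.prob_space_axioms])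
  from SM.integrable_product_swap[OF this] show ?thesis by (simp add: split_def)
qed

text \<open>\<open>mx f n\<close> is the maximum of \<open>0\<close> and the partial sums of \<open>f\<close> over at most \<open>n\<close> terms.\<close>

primrec mx :: "('a \<Rightarrow> real) \<Rightarrow> nat \<Rightarrow> (nat \<Rightarrow> 'a) \<Rightarrow> real" where
  "mx f 0 \<omega> = 0"
| "mx f (Suc n) \<omega> = max 0 (f (\<omega> 0) + mx f n (\<lambda>i. \<omega> (Suc i)))"

lemma mx_nonneg: "0 \<le> mx f n \<omega>"
  by (cases n) simp_all

lemma mx_Suc_ge: "mx f n \<omega> \<le> mx f (Suc n) \<omega>"
proof (induction n arbitrary: \<omega>)
  case (Suc n)
  then show ?case using Suc.IH[of "\<lambda>i. \<omega> (Suc i)"] by (simp add: max_def)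
qed simp

lemma mx_mono: "m \<le> n \<Longrightarrow> mx f m \<omega> \<le> mx f n \<omega>"
  by (rule lift_Suc_mono_le[of "\<lambda>n. mx f n \<omega>"]) (rule mx_Suc_ge)

lemma sum_le_mx: "(\<Sum>i<n. f (\<omega> i)) \<le> mx f n \<omega>"
proof (induction n arbitrary: \<omega>)
  case (Suc n)
  have "(\<Sum>i<Suc n. f (\<omega> i)) = f (\<omega> 0) + (\<Sum>i<n. f (\<omega> (Suc i)))"
    by (rule sum.lessThan_Suc_shift)
  then show ?case using Suc.IH[of "\<lambda>i. \<omega> (Suc i)"] by simp
qed simp

lemma mx_case_nat: "mx f (Suc n) (case_nat s \<omega>) = max 0 (f s + mx f n \<omega>)"
  by simp

lemma measurable_shift: "(\<lambda>\<omega> i. \<omega> (Suc i)) \<in> measurable S S"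
  by (rule measurable_PiM_single') (auto simp: space_PiM)

lemma measurable_mx:
  assumes [measurable]: "f \<in> borel_measurable M"
  shows "mx f n \<in> borel_measurable S"
proof (induction n)
  case (Suc n)
  have "(\<lambda>\<omega>. mx f n (\<lambda>i. \<omega> (Suc i))) \<in> borel_measurable S"
    by (rule measurable_compose[OF measurable_shift Suc])
  moreover have "(\<lambda>\<omega>. f (\<omega> 0)) \<in> borel_measurable S" by measurable
  ultimately have "(\<lambda>\<omega>. max 0 (f (\<omega> 0) + mx f n (\<lambda>i. \<omega> (Suc i)))) \<in> borel_measurable S" by measurable
  moreover have "mx f (Suc n) = (\<lambda>\<omega>. max 0 (f (\<omega> 0) + mx f n (\<lambda>i. \<omega> (Suc i))))" by (simp add: fun_eq_iff)
  ultimately show ?case by simp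
qed (simp add: fun_eq_iff[symmetric])

lemma integrable_mx:
  assumes f: "integrable M f"
  shows "integrable S (mx f n)"
proof (induction n)
  case 0
  have "mx f 0 = (\<lambda>_. 0)" by (simp add: fun_eq_iff)
  then show ?case by simp
next
  case (Suc n)
  have 1: "integrable (M \<Otimes>\<^sub>M S) (\<lambda>x. max 0 (f (fst x) + mx f n (snd x)))"
    by (intro integrable_max integrable_zero Bochner_Integration.integrable_add
        integrable_fst_pair[OF f prob_space_S] integrable_pair_snd[OF Suc])
  have eq: "(\<lambda>(s, \<omega>). mx f (Suc n) (case_nat s \<omega>)) = (\<lambda>x. max 0 (f (fst x) + mx f n (snd x)))"
    by (simp add: fun_eq_iff split_def)
  show ?case
    using integrable_case_nat(1)[OF measurable_mx[OF borel_measurable_integrable[OF f], of "Suc n"]] 1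
    unfolding eq by blast
qed

text \<open>Garsia's argument: on the shift invariant event \<open>A\<close> that the partial sums are unbounded,
  the nonnegative expectation of \<open>mx f (n + 1) - mx f n\<close> tends to the expectation of \<open>f\<close> over \<open>A\<close>.\<close>

lemma partial_sums_bounded:
  fixes f :: "'a \<Rightarrow> real"
  assumes f: "integrable M f" and neg: "integral\<^sup>L M f < 0"
  shows "AE \<omega> in S. \<exists>B. \<forall>n. (\<Sum>i<n. f (\<omega> i)) \<le> B"
proof -
  have fm [measurable]: "f \<in> borel_measurable M" using f by simp
  note mxm [measurable] = measurable_mx[OF fm]
  define A where "A = {\<omega> \<in> space S. \<forall>k::nat. \<exists>n. real k < mx f n \<omega>}"
  have A [measurable]: "A \<in> sets S" unfolding A_def by measurable
  \<comment> \<open>Prepending \<open>s\<close> shifts the index of the maxima and changes them by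
    at most \<open>\<bar>f s\<bar>\<close>, so unboundedness is unaffected.\<close>
  have inv: "case_nat s \<omega> \<in> A \<longleftrightarrow> \<omega> \<in> A" if s: "s \<in> space M" and \<omega>: "\<omega> \<in> space S" for s \<omega>
  proof -
    have sp: "case_nat s \<omega> \<in> space S" using s \<omega> by (auto simp: space_PiM PiE_iff split: nat.split)
    have "(\<forall>k::nat. \<exists>n. real k < mx f n (case_nat s \<omega>)) \<longleftrightarrow> (\<forall>k::nat. \<exists>n. real k < mx f n \<omega>)"
    proof (intro iffI allI)
      fix k :: nat assume *: "\<forall>k::nat. \<exists>n. real k < mx f n (case_nat s \<omega>)"
      obtain j :: nat where j: "real k + \<bar>f s\<bar> \<le> real j" using real_arch_simple by blast
      obtain n where n: "real j < mx f n (case_nat s \<omega>)" using * by blast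
      then obtain m where m: "n = Suc m" by (cases n) auto
      have "real k < mx f m \<omega>" using n j unfolding m mx_case_nat by (auto simp: max_def split: if_splits)
      then show "\<exists>n. real k < mx f n \<omega>" by blast
    next
      fix k :: nat assume *: "\<forall>k::nat. \<exists>n. real k < mx f n \<omega>"
      obtain j :: nat where j: "real k + \<bar>f s\<bar> \<le> real j" using real_arch_simple by blast
      obtain n where n: "real j < mx f n \<omega>" using * by blast
      have "real k < mx f (Suc n) (case_nat s \<omega>)" using n j unfolding mx_case_nat by (auto simp: max_def)
      then show "\<exists>n. real k < mx f n (case_nat s \<omega>)" by blast
    qed
    then show ?thesis using sp \<omega> by (simp add: A_def)
  qed
  \<comment> \<open>On \<open>A\<close> this is \<open>mx f (n + 1)\<close> of the prepended
    sequence minus \<open>mx f n\<close> of the tail, because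
    \<open>max 0 (f s + m) - m = max (- m) (f s)\<close>. It is dominated by
    \<open>\<bar>f s\<bar>\<close> since \<open>m\<close> is nonnegative.\<close>
  define h where "h = (\<lambda>n x. max (- mx f n (snd x)) (f (fst x)) * indicator A (snd x))"
  have hm [measurable]: "h n \<in> borel_measurable (M \<Otimes>\<^sub>M S)" for n unfolding h_def by measurable
  have f_int: "integrable (M \<Otimes>\<^sub>M S) (\<lambda>x. f (fst x))" by (rule integrable_fst_pair[OF f prob_space_S])
  have h_bound: "\<bar>h n x\<bar> \<le> \<bar>f (fst x)\<bar>" for n x
    using mx_nonneg[of f n "snd x"] by (auto simp: h_def indicator_def max_def)
  have h_int: "integrable (M \<Otimes>\<^sub>M S) (h n)" for n
    by (rule Bochner_Integration.integrable_bound[OF f_int hm]) (simp add: h_bound)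
  have g_int: "integrable S (\<lambda>\<omega>. mx f n \<omega> * indicator A \<omega>)" for n
    by (rule integrable_real_mult_indicator[OF A integrable_mx[OF f]])
  have h_nonneg: "0 \<le> integral\<^sup>L (M \<Otimes>\<^sub>M S) (h n)" for n
  proof -
    have "integral\<^sup>L S (\<lambda>\<omega>. mx f n \<omega> * indicator A \<omega>) \<le> integral\<^sup>L S (\<lambda>\<omega>. mx f (Suc n) \<omega> * indicator A \<omega>)"
      by (intro integral_mono g_int mult_right_mono mx_Suc_ge) simp
    also have "\<dots> = integral\<^sup>L (M \<Otimes>\<^sub>M S) (\<lambda>(s,\<omega>). mx f (Suc n) (case_nat s \<omega>) * indicator A (case_nat s \<omega>))"
      by (rule integrable_case_nat(2)) measurable
    also have "\<dots> = integral\<^sup>L (M \<Otimes>\<^sub>M S) (\<lambda>x. h n x + mx f n (snd x) * indicator A (snd x))"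
    proof (rule Bochner_Integration.integral_cong[OF refl])
      fix x assume "x \<in> space (M \<Otimes>\<^sub>M S)"
      then have "fst x \<in> space M" "snd x \<in> space S" by (auto simp: space_pair_measure)
      from inv[OF this] show "(case x of (s, \<omega>) \<Rightarrow> mx f (Suc n) (case_nat s \<omega>) * indicator A (case_nat s \<omega>)) =
        h n x + mx f n (snd x) * indicator A (snd x)"
        unfolding split_def mx_case_nat by (simp add: h_def indicator_def max_def)
    qed
    also have "\<dots> = integral\<^sup>L (M \<Otimes>\<^sub>M S) (h n) + integral\<^sup>L (M \<Otimes>\<^sub>M S) (\<lambda>x. mx f n (snd x) * indicator A (snd x))"
      by (intro Bochner_Integration.integral_add h_int integrable_pair_snd[OF g_int])
    also have "integral\<^sup>L (M \<Otimes>\<^sub>M S) (\<lambda>x. mx f n (snd x) * indicator A (snd x)) = integral\<^sup>L S (\<lambda>\<omega>. mx f n \<omega> * indicator A \<omega>)"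
      using MS.integral_snd[of "\<lambda>_ \<omega>. mx f n \<omega> * indicator A \<omega>"] integrable_pair_snd[OF g_int, of n]
      by (simp add: split_def M.prob_space)
    finally show ?thesis by simp
  qed
  have "(\<lambda>n. integral\<^sup>L (M \<Otimes>\<^sub>M S) (h n)) \<longlonglongrightarrow> integral\<^sup>L (M \<Otimes>\<^sub>M S) (\<lambda>x. f (fst x) * indicator A (snd x))"
  proof (rule integral_dominated_convergence[where w = "\<lambda>x. \<bar>f (fst x)\<bar>"])
    show "integrable (M \<Otimes>\<^sub>M S) (\<lambda>x. \<bar>f (fst x)\<bar>)" using f_int by (rule integrable_abs)
    show "AE x in M \<Otimes>\<^sub>M S. (\<lambda>n. h n x) \<longlonglongrightarrow> f (fst x) * indicator A (snd x)"
    proof (rule AE_I2)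
      fix x
      \<comment> \<open>On \<open>A\<close> the maxima grow beyond
        \<open>\<bar>f (fst x)\<bar>\<close>, after which the truncation at \<open>- mx f n\<close>
        has no effect.\<close>
      have "eventually (\<lambda>n. h n x = f (fst x) * indicator A (snd x)) sequentially"
      proof (cases "snd x \<in> A")
        case True
        obtain k :: nat where k: "\<bar>f (fst x)\<bar> \<le> real k" using real_arch_simple by blast
        obtain m where m: "real k < mx f m (snd x)" using True by (auto simp: A_def)
        have "h n x = f (fst x) * indicator A (snd x)" if "m \<le> n" for n
          using mx_mono[OF that, of f "snd x"] m k by (auto simp: h_def max_def)
        then show ?thesis unfolding eventually_sequentially by blast
      qed (simp add: h_def)
      then show "(\<lambda>n. h n x) \<longlonglongrightarrow> f (fst x) * indicator A (snd x)" by (rule tendsto_eventually)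
    qed
    show "AE x in M \<Otimes>\<^sub>M S. norm (h n x) \<le> \<bar>f (fst x)\<bar>" for n using h_bound by (intro AE_I2) simp
  qed measurable
  then have "0 \<le> integral\<^sup>L (M \<Otimes>\<^sub>M S) (\<lambda>x. f (fst x) * indicator A (snd x))"
    by (rule LIMSEQ_le_const) (use h_nonneg in blast)
  \<comment> \<open>The term and the tail are independent, so the integral factors into the negative
    mean of \<open>f\<close> and the probability of \<open>A\<close>, which must be zero.\<close>
  also have "\<dots> = (\<integral>s. (\<integral>\<omega>. f s * indicator A \<omega> \<partial>S) \<partial>M)"
  proof -
    have "integrable (M \<Otimes>\<^sub>M S) (\<lambda>x. f (fst x) * indicator A (snd x))"
      by (rule Bochner_Integration.integrable_bound[OF f_int]) (auto simp: indicator_def)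
    from MS.integral_fst'[OF this] show ?thesis by simp
  qed
  also have "\<dots> = integral\<^sup>L M f * P.prob A"
    by simp
  finally have "P.prob A = 0" using neg measure_nonneg[of S A] by (simp add: zero_le_mult_iff)
  then have "AE \<omega> in S. \<omega> \<notin> A" using P.prob_eq_0[OF A] by simp
  moreover have "AE \<omega> in S. \<omega> \<in> space S" by simp
  ultimately show ?thesis
  proof eventually_elim
    case (elim \<omega>)
    then obtain k :: nat where "\<forall>n. mx f n \<omega> \<le> real k" by (auto simp: A_def not_less)
    then have "\<forall>n. (\<Sum>i<n. f (\<omega> i)) \<le> real k" using sum_le_mx order_trans by blast
    then show ?case by blast
  qed
qed

text \<open>Subtracting slightly more than the mean leaves a negative mean, hence partial sums with
  an upper bound that vanishes after division by \<open>n\<close>. The margins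
  \<open>1 / (k + 1)\<close> are countable, so one null set serves all \<open>e\<close>.\<close>

lemma averages_eventually_le:
  fixes f :: "'a \<Rightarrow> real"
  assumes f: "integrable M f"
  shows "AE \<omega> in S. \<forall>e>0. eventually (\<lambda>n. (\<Sum>i<n. f (\<omega> i)) / real n \<le> integral\<^sup>L M f + e) sequentially"
proof -
  have "AE \<omega> in S. \<forall>k::nat. \<exists>B. \<forall>n. (\<Sum>i<n. f (\<omega> i) - (integral\<^sup>L M f + 1 / real (Suc k))) \<le> B"
  proof (subst AE_all_countable, rule allI)
    fix k :: nat
    show "AE \<omega> in S. \<exists>B. \<forall>n. (\<Sum>i<n. f (\<omega> i) - (integral\<^sup>L M f + 1 / real (Suc k))) \<le> B"
      by (rule partial_sums_bounded) (use f in \<open>auto simp: M.prob_space\<close>)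
  qed
  then show ?thesis
  proof eventually_elim
    case (elim \<omega>)
    note bounded = elim
    show ?case
    proof (intro allI impI)
      fix e :: real assume "0 < e"
      then obtain k where k: "1 / real (Suc k) < e / 2" using nat_approx_posE[of "e / 2"] by auto
      obtain B where B: "\<And>n. (\<Sum>i<n. f (\<omega> i) - (integral\<^sup>L M f + 1 / real (Suc k))) \<le> B" using bounded by metis
      have "eventually (\<lambda>n. 2 * \<bar>B\<bar> / e < real n) sequentially"
        using filterlim_real_sequentially by (simp add: filterlim_at_top_dense)
      moreover have "eventually (\<lambda>n. 0 < n) sequentially" by (rule eventually_gt_at_top)
      ultimately show "eventually (\<lambda>n. (\<Sum>i<n. f (\<omega> i)) / real n \<le> integral\<^sup>L M f + e) sequentially"
      proof eventually_elim
        case (elim n)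
        define r where "r = 1 / real (Suc k)"
        have "(\<Sum>i<n. f (\<omega> i)) - real n * (integral\<^sup>L M f + r) \<le> B"
          using B[of n] by (simp add: sum_subtractf r_def)
        moreover have "2 * \<bar>B\<bar> < real n * e" using elim(1) \<open>0 < e\<close> by (simp add: pos_divide_less_eq)
        moreover have "real n * (integral\<^sup>L M f + r) \<le> real n * (integral\<^sup>L M f + e / 2)"
          using k by (intro mult_left_mono) (simp_all add: r_def)
        moreover have "real n * (integral\<^sup>L M f + e) = real n * (integral\<^sup>L M f + e / 2) + real n * e / 2"
          by (simp add: algebra_simps)
        ultimately have "(\<Sum>i<n. f (\<omega> i)) \<le> real n * (integral\<^sup>L M f + e)" by linarith
        then show ?case using elim(2) by (simp add: pos_divide_le_eq mult.commute)
      qed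
    qed
  qed
qed

text \<open>The upper estimates for \<open>f\<close> and for \<open>- f\<close> enclose the
  averages.\<close>

theorem strong_law:
  fixes f :: "'a \<Rightarrow> real"
  assumes f: "integrable M f"
  shows "AE \<omega> in S. (\<lambda>n. (\<Sum>i<n. f (\<omega> i)) / real n) \<longlonglongrightarrow> integral\<^sup>L M f"
proof -
  have "AE \<omega> in S. \<forall>e>0. eventually (\<lambda>n. (\<Sum>i<n. - f (\<omega> i)) / real n \<le> integral\<^sup>L M (\<lambda>x. - f x) + e) sequentially"
    by (rule averages_eventually_le) (use f in simp)
  with averages_eventually_le[OF f] show ?thesis
  proof eventually_elim
    case (elim \<omega>)
    show ?case
    proof (rule tendstoI)
      fix e :: real assume "0 < e"
      then have "0 < e / 2" by simp
      with elim have "eventually (\<lambda>n. (\<Sum>i<n. f (\<omega> i)) / real n \<le> integral\<^sup>L M f + e / 2) sequentially"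
        "eventually (\<lambda>n. (\<Sum>i<n. - f (\<omega> i)) / real n \<le> integral\<^sup>L M (\<lambda>x. - f x) + e / 2) sequentially"
        by blast+
      then show "eventually (\<lambda>n. dist ((\<Sum>i<n. f (\<omega> i)) / real n) (integral\<^sup>L M f) < e) sequentially"
      proof eventually_elim
        case (elim n)
        then show ?case using \<open>0 < e\<close> by (simp add: sum_negf dist_real_def abs_less_iff)
      qed
    qed
  qed
qed

text \<open>The probability \<open>z\<close> that the word \<open>w\<close> never occurs satisfies \<open>z \<le> (1 - q) * z\<close>, where \<open>q\<close> is the
  probability that the sequence starts with \<open>w\<close>.\<close>

lemma word_recurs:
  fixes w :: "nat \<Rightarrow> 'a"
  assumes w: "\<And>i. i < m \<Longrightarrow> {w i} \<in> sets M" "\<And>i. i < m \<Longrightarrow> 0 < measure M {w i}"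
  shows "AE \<omega> in S. \<forall>k. \<exists>n\<ge>k. \<forall>i<m. \<omega> (n + i) = w i"
proof -
  interpret SS: pair_prob_space S S by unfold_locales
  have rect: "measure (S \<Otimes>\<^sub>M S) (A \<times> B) = P.prob A * P.prob B" if "A \<in> sets S" "B \<in> sets S" for A B
    using P.emeasure_pair_measure_Times[OF that] by (simp add: measure_def enn2real_mult)
  have coord: "{\<omega> \<in> space S. \<omega> j = w i} \<in> sets S" if "i < m" for i j
  proof -
    have "(\<lambda>\<omega>. \<omega> j) -` {w i} \<inter> space S \<in> sets S"
      by (rule measurable_sets[OF _ w(1)[OF that]]) simp
    also have "(\<lambda>\<omega>. \<omega> j) -` {w i} \<inter> space S = {\<omega> \<in> space S. \<omega> j = w i}" by auto
    finally show ?thesis .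
  qed
  define N where "N = (\<lambda>n. {\<omega> \<in> space S. \<forall>i\<in>{..<m}. \<omega> (n + i) = w i})"
  have N: "N n \<in> sets S" for n
    unfolding N_def by (rule sets.sets_Collect_finite_All) (simp_all add: coord)
  define W where "W = N 0"
  have W: "W \<in> sets S" unfolding W_def by (rule N)
  define V where "V = (\<lambda>k. space S - (\<Union>n\<in>{k..}. N n))"
  have "(\<Union>n\<in>{k..}. N n) \<in> sets S" for k
    using sets.countable_UN''[of "{k..}" N S] N by blast
  then have V: "V k \<in> sets S" for k unfolding V_def by (rule sets.compl_sets)
  have V_iff: "\<omega> \<in> V k \<longleftrightarrow> \<omega> \<in> space S \<and> (\<forall>n\<ge>k. \<not> (\<forall>i<m. \<omega> (n + i) = w i))" for k \<omega>
    unfolding V_def N_def by auto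
  have W_iff: "\<omega> \<in> W \<longleftrightarrow> \<omega> \<in> space S \<and> (\<forall>i<m. \<omega> i = w i)" for \<omega>
    unfolding W_def N_def by auto
  have "W = prod_emb UNIV (\<lambda>_. M) {..<m} (PiE {..<m} (\<lambda>i. {w i}))"
    by (auto simp: W_iff prod_emb_def space_PiM PiE_iff restrict_def extensional_def)
  then have "P.prob W = (\<Prod>i<m. measure M {w i})"
    using measure_PiM_emb[of "{..<m}" "\<lambda>i. {w i}"] w(1) by simp
  also have "\<dots> > 0" using w(2) by (intro prod_pos) simp
  finally have q: "P.prob W > 0" .
  have comb: "P.prob B = measure (S \<Otimes>\<^sub>M S) ((\<lambda>(\<omega>, \<omega>'). comb_seq j \<omega> \<omega>') -` B \<inter> space (S \<Otimes>\<^sub>M S))"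
    if "B \<in> sets S" for B j
    using that by (subst PiM_comb_seq[of j, symmetric]) (simp add: measure_distr[OF measurable_comb_seq])
  \<comment> \<open>A random sequence is composed of \<open>m\<close> terms of one sequence followed
    by an independent one. If \<open>w\<close> never occurs, the first does not start with
    \<open>w\<close> and the second avoids \<open>w\<close> altogether.\<close>
  have "P.prob (V 0) = measure (S \<Otimes>\<^sub>M S) ((\<lambda>(\<omega>, \<omega>'). comb_seq m \<omega> \<omega>') -` V 0 \<inter> space (S \<Otimes>\<^sub>M S))"
    by (rule comb[OF V])
  also have "\<dots> \<le> measure (S \<Otimes>\<^sub>M S) ((space S - W) \<times> V 0)"
  proof (rule SS.finite_measure_mono)
    show "(\<lambda>(\<omega>, \<omega>'). comb_seq m \<omega> \<omega>') -` V 0 \<inter> space (S \<Otimes>\<^sub>M S) \<subseteq> (space S - W) \<times> V 0"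
    proof (clarsimp simp: space_pair_measure, intro conjI)
      fix \<omega> \<omega>' assume *: "\<omega> \<in> space S" "\<omega>' \<in> space S" "comb_seq m \<omega> \<omega>' \<in> V 0"
      have n: "\<not> (\<forall>i<m. comb_seq m \<omega> \<omega>' (n + i) = w i)" for n using *(3) by (simp add: V_iff)
      show "\<omega> \<notin> W" using n[of 0] by (auto simp: W_iff comb_seq_def)
      have "\<not> (\<forall>i<m. \<omega>' (n + i) = w i)" for n using n[of "m + n"] by (simp add: comb_seq_def add.assoc)
      then show "\<omega>' \<in> V 0" using *(2) by (simp add: V_iff)
    qed
    show "(space S - W) \<times> V 0 \<in> sets (S \<Otimes>\<^sub>M S)" using W V[of 0] by simp
  qed
  also have "\<dots> = (1 - P.prob W) * P.prob (V 0)"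
    using W V[of 0] by (simp add: rect P.prob_compl)
  finally have "P.prob W * P.prob (V 0) \<le> 0" by (simp add: algebra_simps)
  then have V0: "P.prob (V 0) = 0" using q measure_nonneg[of S "V 0"] by (auto simp: mult_le_0_iff)
  have Vk: "P.prob (V k) = 0" for k
  proof -
    \<comment> \<open>Dropping the first \<open>k\<close> terms maps \<open>V k\<close> into
      \<open>V 0\<close>.\<close>
    have "P.prob (V k) = measure (S \<Otimes>\<^sub>M S) ((\<lambda>(\<omega>, \<omega>'). comb_seq k \<omega> \<omega>') -` V k \<inter> space (S \<Otimes>\<^sub>M S))"
      by (rule comb[OF V])
    also have "\<dots> \<le> measure (S \<Otimes>\<^sub>M S) (space S \<times> V 0)"
    proof (rule SS.finite_measure_mono)
      show "(\<lambda>(\<omega>, \<omega>'). comb_seq k \<omega> \<omega>') -` V k \<inter> space (S \<Otimes>\<^sub>M S) \<subseteq> space S \<times> V 0"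
      proof (clarsimp simp: space_pair_measure)
        fix \<omega> \<omega>' assume *: "\<omega>' \<in> space S" "comb_seq k \<omega> \<omega>' \<in> V k"
        have "\<not> (\<forall>i<m. comb_seq k \<omega> \<omega>' (k + n + i) = w i)" for n using *(2) by (simp add: V_iff)
        then have "\<not> (\<forall>i<m. \<omega>' (n + i) = w i)" for n by (simp add: comb_seq_def add.assoc)
        then show "\<omega>' \<in> V 0" using *(1) by (simp add: V_iff)
      qed
      show "space S \<times> V 0 \<in> sets (S \<Otimes>\<^sub>M S)" using V[of 0] by simp
    qed
    also have "\<dots> = 0" using V[of 0] V0 by (simp add: rect)
    finally show ?thesis using measure_nonneg[of S "V k"] by simp
  qed
  have "AE \<omega> in S. \<forall>k. \<omega> \<notin> V k"
    using Vk P.prob_eq_0[OF V] by (simp add: AE_all_countable)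
  moreover have "AE \<omega> in S. \<omega> \<in> space S" by simp
  ultimately show ?thesis by eventually_elim (simp add: V_iff)
qed

end

section \<open>Heights along random compositions\<close>

text \<open>Nonemptiness of \<open>S\<close> excludes the value \<open>- \<infinity>\<close> of the
  supremum, and the boundedness condition excludes \<open>\<infinity>\<close>, so a real constant
  remains.\<close>

lemma height_controlledE:
  assumes "height_controlled S" "S \<noteq> {}"
  obtains C where "0 \<le> C" "\<forall>\<phi>\<in>S. endomorphism \<phi>" "\<forall>\<phi>\<in>S. 2 \<le> endo_degree \<phi>"
    "\<forall>\<phi>\<in>S. \<forall>P. \<bar>weil_height (\<phi> P) - real (endo_degree \<phi>) * weil_height P\<bar> \<le> C"
proof -
  define s where "s = (SUP \<phi>\<in>S. height_defect \<phi>)"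
  have s: "s < \<infinity>" using assms(1) by (simp add: height_controlled_def s_def)
  have le: "ereal \<bar>weil_height (\<phi> P) - real (endo_degree \<phi>) * weil_height P\<bar> \<le> s" if "\<phi> \<in> S" for \<phi> P
  proof -
    have "ereal \<bar>weil_height (\<phi> P) - real (endo_degree \<phi>) * weil_height P\<bar> \<le> height_defect \<phi>"
      unfolding height_defect_def by (rule SUP_upper) simp
    also have "\<dots> \<le> s" unfolding s_def using that by (rule SUP_upper)
    finally show ?thesis .
  qed
  obtain \<phi>0 where "\<phi>0 \<in> S" using assms(2) by blast
  from le[OF this, of undefined] s obtain C where C: "s = ereal C" by (cases s) auto
  have "\<forall>\<phi>\<in>S. \<forall>P. \<bar>weil_height (\<phi> P) - real (endo_degree \<phi>) * weil_height P\<bar> \<le> C"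
    using le unfolding C by simp
  moreover from this \<open>\<phi>0 \<in> S\<close> have "0 \<le> C" using abs_ge_zero order_trans by blast
  moreover have "\<forall>\<phi>\<in>S. endomorphism \<phi>" using assms(1) by (simp add: height_controlled_def)
  moreover have "2 \<le> endo_degree \<phi>" if "\<phi> \<in> S" for \<phi>
  proof -
    have "2 \<le> (INF \<phi>\<in>S. enat (endo_degree \<phi>))" using assms(1) by (simp add: height_controlled_def)
    also have "\<dots> \<le> enat (endo_degree \<phi>)" using that by (rule INF_lower)
    finally show ?thesis by (simp add: numeral_eq_enat)
  qed
  ultimately show ?thesis using that by metis
qed

text \<open>Later maps act first, so the block of the sequence starting at index \<open>n\<close> is
  the inner factor.\<close>

lemma plus_iter_append: "plus_iter \<gamma> (n + m) = plus_iter \<gamma> n \<circ> plus_iter (\<lambda>i. \<gamma> (n + i)) m"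
  by (induction m) (simp_all add: comp_assoc)

lemma plus_iter_cong: "(\<And>i. i < n \<Longrightarrow> \<gamma> i = \<gamma>' i) \<Longrightarrow> plus_iter \<gamma> n = plus_iter \<gamma>' n"
  by (induction n) simp_all

lemma gen_monoid_word:
  "f \<in> gen_monoid S \<Longrightarrow> \<exists>m w. (\<forall>i<m. w i \<in> S) \<and> f = plus_iter w m"
proof (induction rule: gen_monoid.induct)
  case id
  show ?case by (intro exI[of _ 0]) simp
next
  case (gen \<phi>)
  then show ?case by (intro exI[of _ 1] exI[of _ "\<lambda>_. \<phi>"]) simp
next
  case (comp f g)
  then obtain m w k v where w: "\<forall>i<m. w i \<in> S" "f = plus_iter w m" and v: "\<forall>i<k. v i \<in> S" "g = plus_iter v k"
    by (elim exE conjE) (rule that)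
  define u where "u = (\<lambda>i. if i < m then w i else v (i - m))"
  have "plus_iter u (m + k) = f \<circ> g"
    unfolding plus_iter_append w(2) v(2)
    by (intro arg_cong2[of _ _ _ _ "(\<circ>)"] plus_iter_cong) (simp_all add: u_def)
  moreover have "\<forall>i<m + k. u i \<in> S" using w(1) v(1) by (auto simp: u_def)
  ultimately show ?case by (intro exI[of _ "m + k"] exI[of _ u]) simp
qed

lemma plus_iter_gen_monoid: "\<gamma> \<in> sequences S \<Longrightarrow> plus_iter \<gamma> n \<in> gen_monoid S"
  by (induction n) (auto simp: sequences_def intro: gen_monoid.intros)

lemma ereal_Liminf_Limsup_bounded:
  fixes a :: "nat \<Rightarrow> real"
  assumes "\<And>n. \<bar>a n - x\<bar> \<le> C"
  shows "\<exists>l u. liminf (\<lambda>n. ereal (a n)) = ereal l \<and> \<bar>l - x\<bar> \<le> C \<and>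
    limsup (\<lambda>n. ereal (a n)) = ereal u \<and> \<bar>u - x\<bar> \<le> C"
proof -
  have b: "x - C \<le> a n" "a n \<le> x + C" for n using assms[of n] by linarith+
  have 1: "ereal (x - C) \<le> liminf (\<lambda>n. ereal (a n))"
    by (rule Liminf_bounded) (simp add: b)
  have 2: "limsup (\<lambda>n. ereal (a n)) \<le> ereal (x + C)"
    by (rule Limsup_bounded) (simp add: b)
  have 3: "liminf (\<lambda>n. ereal (a n)) \<le> limsup (\<lambda>n. ereal (a n))"
    by (rule Liminf_le_Limsup) simp
  obtain l where l: "liminf (\<lambda>n. ereal (a n)) = ereal l"
    using 1 2 3 by (cases "liminf (\<lambda>n. ereal (a n))") auto
  obtain u where u: "limsup (\<lambda>n. ereal (a n)) = ereal u"
    using 1 2 3 by (cases "limsup (\<lambda>n. ereal (a n))") auto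
  show ?thesis using 1 2 3 unfolding l u by (intro exI[of _ l] exI[of _ u]) auto
qed

lemma limsup_ge_frequently:
  fixes a :: "nat \<Rightarrow> real"
  assumes "\<And>k. \<exists>n\<ge>k. c \<le> a n"
  shows "ereal c \<le> limsup (\<lambda>n. ereal (a n))"
proof (rule ccontr)
  assume "\<not> ereal c \<le> limsup (\<lambda>n. ereal (a n))"
  then have "limsup (\<lambda>n. ereal (a n)) < ereal c" by simp
  then have "eventually (\<lambda>n. ereal (a n) < ereal c) sequentially" by (rule Limsup_lessD)
  then obtain k where k: "\<And>n. n \<ge> k \<Longrightarrow> a n < c" by (auto simp: eventually_sequentially)
  obtain n where "n \<ge> k" "c \<le> a n" using assms by blast
  then show False using k[of n] by simp
qed

section \<open>Height and degree estimates along single sequences\<close>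

locale height_controlled_maps =
  fixes S :: "('n::finite qproj \<Rightarrow> 'n qproj) set" and C :: real
  assumes card: "2 \<le> CARD('n)"
    and C_nonneg: "0 \<le> C"
    and endo: "\<phi> \<in> S \<Longrightarrow> endomorphism \<phi>"
    and degree_ge_2: "\<phi> \<in> S \<Longrightarrow> 2 \<le> endo_degree \<phi>"
    and defect: "\<phi> \<in> S \<Longrightarrow> \<bar>weil_height (\<phi> P) - real (endo_degree \<phi>) * weil_height P\<bar> \<le> C"
begin

text \<open>The bound \<open>C * (deg f - 1)\<close> is additive under composition; for generators it uses that the degree is at
  least \<open>2\<close>.\<close>

lemma gen_monoid_defect:
  assumes "f \<in> gen_monoid S"
  shows "endomorphism f \<and> 1 \<le> endo_degree f \<and>
    (\<forall>P. \<bar>weil_height (f P) - real (endo_degree f) * weil_height P\<bar> \<le> C * (real (endo_degree f) - 1))"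
  using assms
proof (induction rule: gen_monoid.induct)
  case id
  show ?case by (simp add: endomorphism_id[OF card, unfolded id_def])
next
  case (gen \<phi>)
  have "C * 1 \<le> C * (real (endo_degree \<phi>) - 1)"
    using degree_ge_2[OF gen] C_nonneg by (intro mult_left_mono) simp_all
  then have "\<bar>weil_height (\<phi> P) - real (endo_degree \<phi>) * weil_height P\<bar> \<le> C * (real (endo_degree \<phi>) - 1)" for P
    using defect[OF gen, of P] by linarith
  then show ?case using endo[OF gen] degree_ge_2[OF gen] by auto
next
  case (comp f g)
  define a where "a = real (endo_degree f)"
  define b where "b = real (endo_degree g)"
  have deg: "endomorphism (f \<circ> g)" "endo_degree (f \<circ> g) = endo_degree f * endo_degree g"
    using comp by (auto intro: endomorphism_comp[OF card])
  have ab: "real (endo_degree (f \<circ> g)) = a * b" "1 \<le> endo_degree (f \<circ> g)"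
    unfolding deg(2) using comp by (simp_all add: a_def b_def)
  have "\<bar>weil_height ((f \<circ> g) P) - a * b * weil_height P\<bar> \<le> C * (a * b - 1)" for P
  proof -
    have "\<bar>weil_height (f (g P)) - a * weil_height (g P)\<bar> \<le> C * (a - 1)" using comp by (simp add: a_def)
    moreover have "\<bar>a * (weil_height (g P) - b * weil_height P)\<bar> \<le> a * (C * (b - 1))"
      unfolding abs_mult using comp by (intro mult_mono) (auto simp: a_def b_def)
    moreover have "weil_height (f (g P)) - a * b * weil_height P
      = (weil_height (f (g P)) - a * weil_height (g P)) + a * (weil_height (g P) - b * weil_height P)"
      by (simp add: algebra_simps)
    moreover have "C * (a * b - 1) = C * (a - 1) + a * (C * (b - 1))" by (simp add: algebra_simps)
    ultimately show ?thesis unfolding o_apply by linarith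
  qed
  then show ?case using deg(1) ab by (simp only: simp_thms)
qed

lemma degree_plus_iter:
  assumes "\<gamma> \<in> sequences S"
  shows "endo_degree (plus_iter \<gamma> n) = (\<Prod>i<n. endo_degree (\<gamma> i))"
proof (induction n)
  case (Suc n)
  have "endomorphism (\<gamma> n)" using assms endo by (simp add: sequences_def)
  with gen_monoid_defect[OF plus_iter_gen_monoid[OF assms, of n]]
  have "endo_degree (plus_iter \<gamma> n \<circ> \<gamma> n) = endo_degree (plus_iter \<gamma> n) * endo_degree (\<gamma> n)"
    by (intro endomorphism_comp(2)[OF card]) auto
  then show ?case unfolding plus_iter.simps Suc prod.lessThan_Suc .
qed (simp add: endomorphism_id[OF card, unfolded id_def])

lemma degree_minus_iter:
  assumes "\<gamma> \<in> sequences S"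
  shows "endomorphism (minus_iter \<gamma> n) \<and> endo_degree (minus_iter \<gamma> n) = (\<Prod>i<n. endo_degree (\<gamma> i))"
proof (induction n)
  case (Suc n)
  have "endomorphism (\<gamma> n)" using assms endo by (simp add: sequences_def)
  from endomorphism_comp[OF card this, of "minus_iter \<gamma> n"] Suc show ?case
    unfolding minus_iter.simps prod.lessThan_Suc mult.commute[of _ "endo_degree (\<gamma> n)"] by (simp only: simp_thms)
qed (simp add: endomorphism_id[OF card, unfolded id_def])

lemma degree_plus_iter_ge:
  assumes "\<gamma> \<in> sequences S"
  shows "2 ^ n \<le> endo_degree (plus_iter \<gamma> n)"
proof -
  have "(\<Prod>i<n. 2) \<le> (\<Prod>i<n. endo_degree (\<gamma> i))"
    using assms degree_ge_2 by (intro prod_mono) (simp add: sequences_def)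
  then show ?thesis using degree_plus_iter[OF assms] by simp
qed

lemma degree_plus_iter_pos: "\<gamma> \<in> sequences S \<Longrightarrow> 0 < endo_degree (plus_iter \<gamma> n)"
  by (rule less_le_trans[OF _ degree_plus_iter_ge]) simp_all

lemma height_ratio_bound:
  assumes "\<gamma> \<in> sequences S"
  shows "\<bar>height_ratio \<gamma> P n - weil_height P\<bar> \<le> C"
proof -
  define d where "d = real (endo_degree (plus_iter \<gamma> n))"
  have d: "d > 0" using degree_plus_iter_pos[OF assms] by (simp add: d_def)
  have "\<bar>weil_height (plus_iter \<gamma> n P) - d * weil_height P\<bar> \<le> C * (d - 1)"
    using gen_monoid_defect[OF plus_iter_gen_monoid[OF assms, of n]] by (simp add: d_def)
  also have "\<dots> \<le> C * d" using C_nonneg by (simp add: algebra_simps)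
  finally have "\<bar>weil_height (plus_iter \<gamma> n P) - d * weil_height P\<bar> / d \<le> C" using d by (simp add: pos_divide_le_eq)
  also have "\<bar>weil_height (plus_iter \<gamma> n P) - d * weil_height P\<bar> / d = \<bar>(weil_height (plus_iter \<gamma> n P) - d * weil_height P) / d\<bar>"
    using d by simp
  also have "(weil_height (plus_iter \<gamma> n P) - d * weil_height P) / d = height_ratio \<gamma> P n - weil_height P"
    using d by (simp add: height_ratio_def d_def[symmetric] diff_divide_distrib)
  finally show ?thesis .
qed

lemma height_ratio_nonneg: "0 \<le> height_ratio \<gamma> P n"
  by (simp add: height_ratio_def weil_height_nonneg)

text \<open>The outer map of degree \<open>a\<close> has error at most \<open>C * (a - 1)\<close>,
  so a height of \<open>C + 1\<close> grows to at least \<open>a\<close>. Dividing by the total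
  degree leaves a bound that does not depend on \<open>n\<close>.\<close>

lemma height_ratio_shift:
  assumes \<gamma>: "\<gamma> \<in> sequences S" and f: "f \<in> gen_monoid S" "C + 1 \<le> weil_height (f P)"
    and eq: "plus_iter \<gamma> (n + m) = plus_iter \<gamma> n \<circ> f"
  shows "1 / real (endo_degree f) \<le> height_ratio \<gamma> P (n + m)"
proof -
  let ?g = "plus_iter \<gamma> n"
  define a where "a = real (endo_degree ?g)"
  define b where "b = real (endo_degree f)"
  have g: "endomorphism ?g" "1 \<le> a" "\<bar>weil_height (?g (f P)) - a * weil_height (f P)\<bar> \<le> C * (a - 1)"
    using gen_monoid_defect[OF plus_iter_gen_monoid[OF \<gamma>, of n]] by (simp_all add: a_def)
  have b: "endomorphism f" "1 \<le> b" using gen_monoid_defect[OF f(1)] by (simp_all add: b_def)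
  have "a * (C + 1) \<le> a * weil_height (f P)" using f(2) g(2) by (intro mult_left_mono) simp_all
  moreover have "C * (a - 1) \<le> C * a" using C_nonneg by (simp add: algebra_simps)
  moreover have "a * (C + 1) = C * a + a" by (simp add: algebra_simps)
  ultimately have "a \<le> weil_height (?g (f P))" using g(3) by linarith
  then have "a / (a * b) \<le> weil_height (?g (f P)) / (a * b)" using g(2) b(2) by (intro divide_right_mono) simp_all
  also have "a * b = real (endo_degree (?g \<circ> f))" using endomorphism_comp(2)[OF card g(1) b(1)] by (simp add: a_def b_def)
  finally have "a / (a * b) \<le> height_ratio \<gamma> P (n + m)" unfolding height_ratio_def eq
    using endomorphism_comp(2)[OF card g(1) b(1)] by (simp add: a_def b_def)
  moreover have "a / (a * b) = 1 / b" using g(2) by simp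
  ultimately show ?thesis by (simp add: b_def)
qed

text \<open>All maps are defined over \<open>K\<close>, so the orbit stays among the points over one
  number field \<open>L\<close>, where Northcott's theorem applies.\<close>

lemma total_orbit_unbounded:
  assumes K: "number_field K" "\<forall>\<phi>\<in>S. defined_over K \<phi>" and inf: "infinite (total_orbit S P)"
  obtains f where "f \<in> gen_monoid S" "B \<le> weil_height (f P)"
proof -
  obtain L where L: "number_field L" "K \<subseteq> L" "P \<in> proj_over L" by (rule proj_over_exists[OF K(1)])
  have over: "\<forall>Q\<in>proj_over L. f Q \<in> proj_over L" if "f \<in> gen_monoid S" for f
    using that by (induction rule: gen_monoid.induct) (use proj_over_image[OF L(1,2)] K(2) in auto)
  have "\<exists>f\<in>gen_monoid S. B \<le> weil_height (f P)"
  proof (rule ccontr)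
    assume "\<not> ?thesis"
    then have "total_orbit S P \<subseteq> {Q. Q \<in> proj_over L \<and> weil_height Q \<le> B}"
      using over L(3) by (force simp: total_orbit_def)
    then show False using inf northcott[OF L(1)] finite_subset by blast
  qed
  then show ?thesis using that by blast
qed

text \<open>Heights on a finite orbit are bounded, while the degrees are at least
  \<open>2 ^ n\<close>.\<close>

lemma finite_orbit_limsup:
  assumes fin: "finite (total_orbit S P)" and \<gamma>: "\<gamma> \<in> sequences S"
  shows "limsup (\<lambda>n. ereal (height_ratio \<gamma> P n)) = 0"
proof -
  define B where "B = Max (weil_height ` total_orbit S P)"
  have "height_ratio \<gamma> P n \<le> \<bar>B\<bar> * (1 / 2) ^ n" for n
  proof -
    have "plus_iter \<gamma> n P \<in> total_orbit S P" using plus_iter_gen_monoid[OF \<gamma>] by (auto simp: total_orbit_def)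
    then have "weil_height (plus_iter \<gamma> n P) \<le> \<bar>B\<bar>"
      using fin unfolding B_def by (intro order_trans[OF Max_ge abs_ge_self]) auto
    moreover have "2 ^ n \<le> real (endo_degree (plus_iter \<gamma> n))"
      using degree_plus_iter_ge[OF \<gamma>, of n] by (metis of_nat_le_iff of_nat_numeral of_nat_power)
    ultimately have "height_ratio \<gamma> P n \<le> \<bar>B\<bar> / 2 ^ n"
      unfolding height_ratio_def by (intro frac_le) simp_all
    then show ?thesis by (simp add: power_divide)
  qed
  moreover have "(\<lambda>n. \<bar>B\<bar> * (1 / 2) ^ n) \<longlonglongrightarrow> 0"
    by (rule tendsto_mult_right_zero, rule LIMSEQ_realpow_zero) simp_all
  ultimately have "height_ratio \<gamma> P \<longlonglongrightarrow> 0"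
    by (intro tendsto_sandwich[OF _ _ tendsto_const, of 0 "height_ratio \<gamma> P"] always_eventually allI height_ratio_nonneg)
  then have "(\<lambda>n. ereal (height_ratio \<gamma> P n)) \<longlonglongrightarrow> ereal 0" by (intro tendsto_ereal)
  then show ?thesis by (simp add: lim_imp_Limsup zero_ereal_def)
qed

lemma infinite_plus_orbit:
  assumes \<gamma>: "\<gamma> \<in> sequences S" and c: "0 < c" "\<forall>k. \<exists>n\<ge>k. c \<le> height_ratio \<gamma> P n"
  shows "infinite (plus_orbit \<gamma> P)"
proof
  assume fin: "finite (plus_orbit \<gamma> P)"
  define B where "B = Max (weil_height ` plus_orbit \<gamma> P)"
  have B: "weil_height (plus_iter \<gamma> n P) \<le> B" for n
    unfolding B_def using fin by (intro Max_ge) (auto simp: plus_orbit_def)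
  obtain k where k: "B / c < 2 ^ k" using real_arch_pow[of 2 "B / c"] by auto
  obtain n where n: "n \<ge> k" "c \<le> height_ratio \<gamma> P n" using c(2) by blast
  have d: "2 ^ n \<le> real (endo_degree (plus_iter \<gamma> n))"
    using degree_plus_iter_ge[OF \<gamma>, of n] by (metis of_nat_le_iff of_nat_numeral of_nat_power)
  have "c * 2 ^ k \<le> c * 2 ^ n" using n(1) c(1) by simp
  also have "\<dots> \<le> c * real (endo_degree (plus_iter \<gamma> n))" using d c(1) by simp
  also have "\<dots> \<le> weil_height (plus_iter \<gamma> n P)"
    using n(2) degree_plus_iter_pos[OF \<gamma>, of n] by (simp add: height_ratio_def pos_le_divide_eq)
  also have "\<dots> \<le> B" by (rule B)
  finally show False using k c(1) by (simp add: pos_divide_less_eq mult.commute)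
qed

text \<open>The height is always at most \<open>U\<close> times the degree and infinitely often at
  least \<open>c\<close> times the degree; the \<open>n\<close>-th roots of both constants tend to
  one.\<close>

lemma limsup_root_height:
  assumes \<gamma>: "\<gamma> \<in> sequences S" and c: "0 < c" "\<forall>k. \<exists>n\<ge>k. c \<le> height_ratio \<gamma> P n"
    and \<delta>: "(\<lambda>n. root n (real (endo_degree (plus_iter \<gamma> n)))) \<longlonglongrightarrow> \<delta>"
  shows "limsup (\<lambda>n. ereal (root n (weil_height (plus_iter \<gamma> n P)))) = ereal \<delta>"
proof (rule antisym)
  define d where "d = (\<lambda>n. real (endo_degree (plus_iter \<gamma> n)))"
  have d: "d n > 0" for n using degree_plus_iter_pos[OF \<gamma>] by (simp add: d_def)
  have h: "weil_height (plus_iter \<gamma> n P) = height_ratio \<gamma> P n * d n" for n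
    using d[of n] by (simp add: height_ratio_def d_def)
  have lim: "(\<lambda>n. root n b * root n (d n)) \<longlonglongrightarrow> \<delta>" if "0 < b" for b
    using tendsto_mult[OF LIMSEQ_root_const[OF that] \<delta>] by (simp add: d_def)
  \<comment> \<open>The added \<open>1\<close> makes the constant positive, so that its roots tend
    to one.\<close>
  define U where "U = weil_height P + C + 1"
  have U: "0 < U" using weil_height_nonneg[of P] C_nonneg by (simp add: U_def)
  have "eventually (\<lambda>n. ereal (root n (weil_height (plus_iter \<gamma> n P))) \<le> ereal (root n U * root n (d n))) sequentially"
    using eventually_gt_at_top[of 0]
  proof eventually_elim
    case (elim n)
    have "weil_height (plus_iter \<gamma> n P) \<le> U * d n"
      unfolding h using height_ratio_bound[OF \<gamma>, of P n] d[of n] by (intro mult_right_mono) (auto simp: U_def)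
    then have "root n (weil_height (plus_iter \<gamma> n P)) \<le> root n (U * d n)" using elim by simp
    then show ?case by (simp add: real_root_mult)
  qed
  then have "limsup (\<lambda>n. ereal (root n (weil_height (plus_iter \<gamma> n P)))) \<le> limsup (\<lambda>n. ereal (root n U * root n (d n)))"
    by (rule Limsup_mono)
  also have "\<dots> = ereal \<delta>" using lim[OF U] by (intro lim_imp_Limsup tendsto_ereal) simp_all
  finally show "limsup (\<lambda>n. ereal (root n (weil_height (plus_iter \<gamma> n P)))) \<le> ereal \<delta>" .
  show "ereal \<delta> \<le> limsup (\<lambda>n. ereal (root n (weil_height (plus_iter \<gamma> n P))))"
  proof (rule dense_ge)
    fix y assume y: "limsup (\<lambda>n. ereal (root n (weil_height (plus_iter \<gamma> n P)))) < y"
    show "ereal \<delta> \<le> y"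
    proof (rule ccontr)
      assume "\<not> ereal \<delta> \<le> y"
      then have yd: "y < ereal \<delta>" by simp
      obtain r where r: "y < ereal r" "r < \<delta>" using ereal_dense2[OF yd] by auto
      have "eventually (\<lambda>n. r < root n c * root n (d n)) sequentially"
        using lim[OF c(1)] r(2) by (rule order_tendstoD(1))
      then obtain k where k: "\<And>n. n \<ge> k \<Longrightarrow> r < root n c * root n (d n)" by (auto simp: eventually_sequentially)
      have "ereal r \<le> limsup (\<lambda>n. ereal (root n (weil_height (plus_iter \<gamma> n P))))"
      proof (rule limsup_ge_frequently)
        fix j
        obtain n where n: "n \<ge> Suc (max j k)" "c \<le> height_ratio \<gamma> P n" using c(2) by blast
        have "c * d n \<le> weil_height (plus_iter \<gamma> n P)"
          unfolding h using n(2) d[of n] by (intro mult_right_mono) simp_all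
        then have "root n (c * d n) \<le> root n (weil_height (plus_iter \<gamma> n P))" using n(1) by simp
        then have "r \<le> root n (weil_height (plus_iter \<gamma> n P))"
          using k[of n] n(1) unfolding real_root_mult by linarith
        then show "\<exists>n\<ge>j. r \<le> root n (weil_height (plus_iter \<gamma> n P))" using n(1) by (intro exI[of _ n]) simp
      qed
      also have "\<dots> < y" by (rule y)
      finally show False using r(1) by simp
    qed
  qed
qed

end

section \<open>The product measure on sequences of maps\<close>

lemma sequence_space_pmf: "sequence_space (restrict_space (measure_pmf \<nu>) (set_pmf \<nu>))"
proof -
  have "prob_space (restrict_space (measure_pmf \<nu>) (set_pmf \<nu>))"
    by (intro prob_space_restrict_space) (simp_all add: emeasure_pmf)
  then show ?thesis
    unfolding sequence_space_def product_prob_space_def product_prob_space_axioms_def product_sigma_finite_def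
    by (simp add: prob_space_imp_sigma_finite)
qed

lemma restrict_pmf:
  fixes f :: "'a \<Rightarrow> real"
  shows integrable_restrict_pmf: "integrable (restrict_space (measure_pmf \<nu>) (set_pmf \<nu>)) f \<longleftrightarrow> integrable (measure_pmf \<nu>) f"
    and integral_restrict_pmf: "integral\<^sup>L (restrict_space (measure_pmf \<nu>) (set_pmf \<nu>)) f = measure_pmf.expectation \<nu> f"
proof -
  have "integrable (measure_pmf \<nu>) (\<lambda>x. indicator (set_pmf \<nu>) x *\<^sub>R f x) \<longleftrightarrow> integrable (measure_pmf \<nu>) f"
    by (intro integrable_cong_AE) (simp_all add: AE_measure_pmf_iff)
  then show "integrable (restrict_space (measure_pmf \<nu>) (set_pmf \<nu>)) f \<longleftrightarrow> integrable (measure_pmf \<nu>) f"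
    by (subst integrable_restrict_space) simp_all
  have "integral\<^sup>L (measure_pmf \<nu>) (\<lambda>x. indicator (set_pmf \<nu>) x *\<^sub>R f x) = integral\<^sup>L (measure_pmf \<nu>) f"
    by (intro integral_cong_AE) (simp_all add: AE_measure_pmf_iff)
  then show "integral\<^sup>L (restrict_space (measure_pmf \<nu>) (set_pmf \<nu>)) f = measure_pmf.expectation \<nu> f"
    by (subst integral_restrict_space) simp_all
qed

lemma prob_space_seq_measure: "prob_space (seq_measure \<nu>)"
  unfolding seq_measure_def by (rule sequence_space.prob_space_S[OF sequence_space_pmf])

lemma AE_seq_measure_sequences: "AE \<gamma> in seq_measure \<nu>. \<gamma> \<in> sequences (set_pmf \<nu>)"
  using AE_space[of "seq_measure \<nu>"] by (simp add: space_seq_measure)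

lemma seq_measure_word_recurs:
  assumes "\<forall>i<m. w i \<in> set_pmf \<nu>"
  shows "AE \<gamma> in seq_measure \<nu>. \<forall>k. \<exists>n\<ge>k. \<forall>i<m. \<gamma> (n + i) = w i"
  unfolding seq_measure_def
proof (rule sequence_space.word_recurs[OF sequence_space_pmf])
  fix i assume "i < m"
  then have i: "w i \<in> set_pmf \<nu>" using assms by simp
  then show "{w i} \<in> sets (restrict_space (measure_pmf \<nu>) (set_pmf \<nu>))"
    by (auto simp: sets_restrict_space)
  show "0 < measure (restrict_space (measure_pmf \<nu>) (set_pmf \<nu>)) {w i}"
    using i by (subst measure_restrict_space) (simp_all add: measure_pmf_single pmf_positive)
qed

theorem theorem1p4:
  fixes N :: nat
    and S :: "('n::finite qproj \<Rightarrow> 'n qproj) set"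
    and K :: "complex set"
    and \<nu> :: "('n qproj \<Rightarrow> 'n qproj) pmf"
  assumes "N \<ge> 1"
    and "CARD('n) = N + 1"
    and "height_controlled S"
    and "number_field K"
    and "\<forall>\<phi>\<in>S. defined_over K \<phi>"
    and "set_pmf \<nu> = S"
  shows
    "(\<exists>C::real. \<forall>P. \<forall>\<gamma>\<in>sequences S. \<exists>l u :: real.
        liminf (\<lambda>n. ereal (height_ratio \<gamma> P n)) = ereal l \<and> \<bar>l - weil_height P\<bar> \<le> C \<and>
        limsup (\<lambda>n. ereal (height_ratio \<gamma> P n)) = ereal u \<and> \<bar>u - weil_height P\<bar> \<le> C)
     \<and>
     (\<forall>P. (infinite (total_orbit S P) \<longleftrightarrow>
             (AE \<gamma> in seq_measure \<nu>. 0 < limsup (\<lambda>n. ereal (height_ratio \<gamma> P n)))) \<and>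
          (finite (total_orbit S P) \<longleftrightarrow>
             0 < \<P>(\<gamma> in seq_measure \<nu>. finite (plus_orbit \<gamma> P))))
     \<and>
     (integrable (measure_pmf \<nu>) (\<lambda>\<phi>. ln (real (endo_degree \<phi>))) \<longrightarrow>
        (\<forall>P. infinite (total_orbit S P) \<longrightarrow>
          (AE \<gamma> in seq_measure \<nu>.
             limsup (\<lambda>n. ereal (root n (weil_height (plus_iter \<gamma> n P)))) =
               ereal (dynamical_degree \<nu>))) \<and>
        dynamical_degree \<nu> =
          exp (measure_pmf.expectation \<nu> (\<lambda>\<phi>. ln (real (endo_degree \<phi>)))))"
proof -
  have "S \<noteq> {}" using assms(6) set_pmf_not_empty[of \<nu>] by simp
  obtain C where C: "0 \<le> C" "\<forall>\<phi>\<in>S. endomorphism \<phi>" "\<forall>\<phi>\<in>S. 2 \<le> endo_degree \<phi>"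
    "\<forall>\<phi>\<in>S. \<forall>P. \<bar>weil_height (\<phi> P) - real (endo_degree \<phi>) * weil_height P\<bar> \<le> C"
    by (rule height_controlledE[OF assms(3) \<open>S \<noteq> {}\<close>])
  interpret height_controlled_maps S C
    by unfold_locales (use assms(1,2) C in auto)
  interpret prob_space "seq_measure \<nu>" by (rule prob_space_seq_measure)
  have seq: "AE \<gamma> in seq_measure \<nu>. \<gamma> \<in> sequences S"
    using AE_seq_measure_sequences[of \<nu>] assms(6) by simp
  \<comment> \<open>The common source of the almost sure statements about infinite orbits. The
    constant found is \<open>1 / deg f\<close> with \<open>f\<close> chosen from \<open>P\<close>
    alone, the same for almost every sequence.\<close>
  have pos: "AE \<gamma> in seq_measure \<nu>. \<exists>c>0. \<forall>k. \<exists>n\<ge>k. c \<le> height_ratio \<gamma> P n"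
    if inf: "infinite (total_orbit S P)" for P
  proof -
    obtain f where f: "f \<in> gen_monoid S" "C + 1 \<le> weil_height (f P)"
      by (rule total_orbit_unbounded[OF assms(4,5) inf])
    obtain m w where w: "\<forall>i<m. w i \<in> S" "f = plus_iter w m"
      using gen_monoid_word[OF f(1)] by (elim exE conjE) (rule that)
    have "AE \<gamma> in seq_measure \<nu>. \<forall>k. \<exists>n\<ge>k. \<forall>i<m. \<gamma> (n + i) = w i"
      by (rule seq_measure_word_recurs) (use w(1) assms(6) in simp)
    then show ?thesis using seq
    proof eventually_elim
      case (elim \<gamma>)
      have "\<exists>n\<ge>k. 1 / real (endo_degree f) \<le> height_ratio \<gamma> P n" for k
      proof -
        obtain n where n: "n \<ge> k" "\<forall>i<m. \<gamma> (n + i) = w i" using elim(1) by blast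
        have "plus_iter \<gamma> (n + m) = plus_iter \<gamma> n \<circ> f"
          unfolding plus_iter_append w(2) using n(2) by (intro arg_cong2[of _ _ _ _ "(\<circ>)"] plus_iter_cong) simp_all
        from height_ratio_shift[OF elim(2) f this] n(1) show ?thesis by (intro exI[of _ "n + m"]) simp
      qed
      moreover have "0 < 1 / real (endo_degree f)" using gen_monoid_defect[OF f(1)] by simp
      ultimately show ?case by blast
    qed
  qed
  have part1: "\<exists>C::real. \<forall>P. \<forall>\<gamma>\<in>sequences S. \<exists>l u :: real.
        liminf (\<lambda>n. ereal (height_ratio \<gamma> P n)) = ereal l \<and> \<bar>l - weil_height P\<bar> \<le> C \<and>
        limsup (\<lambda>n. ereal (height_ratio \<gamma> P n)) = ereal u \<and> \<bar>u - weil_height P\<bar> \<le> C"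
    by (intro exI[of _ C] allI ballI ereal_Liminf_Limsup_bounded height_ratio_bound)
  have limsup_pos: "AE \<gamma> in seq_measure \<nu>. 0 < limsup (\<lambda>n. ereal (height_ratio \<gamma> P n))"
    if inf: "infinite (total_orbit S P)" for P
    using pos[OF inf]
  proof eventually_elim
    case (elim \<gamma>)
    then obtain c where c: "0 < c" "\<forall>k. \<exists>n\<ge>k. c \<le> height_ratio \<gamma> P n" by blast
    have "0 < ereal c" using c(1) by simp
    also have "\<dots> \<le> limsup (\<lambda>n. ereal (height_ratio \<gamma> P n))" using c(2) by (intro limsup_ge_frequently) simp
    finally show ?case .
  qed
  have inf_iff: "infinite (total_orbit S P) \<longleftrightarrow>
             (AE \<gamma> in seq_measure \<nu>. 0 < limsup (\<lambda>n. ereal (height_ratio \<gamma> P n)))" for P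
  proof
    assume *: "AE \<gamma> in seq_measure \<nu>. 0 < limsup (\<lambda>n. ereal (height_ratio \<gamma> P n))"
    show "infinite (total_orbit S P)"
    proof
      assume fin: "finite (total_orbit S P)"
      have "AE \<gamma> in seq_measure \<nu>. False"
        using * seq by eventually_elim (simp add: finite_orbit_limsup[OF fin])
      then show False by simp
    qed
  qed (rule limsup_pos)
  have fin_iff: "finite (total_orbit S P) \<longleftrightarrow> 0 < \<P>(\<gamma> in seq_measure \<nu>. finite (plus_orbit \<gamma> P))" for P
  proof
    assume fin: "finite (total_orbit S P)"
    have "plus_orbit \<gamma> P \<subseteq> total_orbit S P" if "\<gamma> \<in> space (seq_measure \<nu>)" for \<gamma>
      using plus_iter_gen_monoid[of \<gamma> S] that assms(6)
      by (auto simp: plus_orbit_def total_orbit_def space_seq_measure)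
    then have "{\<gamma> \<in> space (seq_measure \<nu>). finite (plus_orbit \<gamma> P)} = space (seq_measure \<nu>)"
      using fin finite_subset by blast
    then show "0 < \<P>(\<gamma> in seq_measure \<nu>. finite (plus_orbit \<gamma> P))" by (simp add: prob_space)
  next
    assume *: "0 < \<P>(\<gamma> in seq_measure \<nu>. finite (plus_orbit \<gamma> P))"
    define A where "A = {\<gamma> \<in> space (seq_measure \<nu>). finite (plus_orbit \<gamma> P)}"
    \<comment> \<open>A set outside the sigma-algebra has measure zero by convention, so positive
      probability yields measurability.\<close>
    have A: "A \<in> sets (seq_measure \<nu>)" using * measure_notin_sets[of A "seq_measure \<nu>"] by (auto simp: A_def)
    show "finite (total_orbit S P)"
    proof (rule ccontr)
      assume inf: "infinite (total_orbit S P)"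
      have "AE \<gamma> in seq_measure \<nu>. \<gamma> \<notin> A"
        using pos[OF inf] seq
      proof eventually_elim
        case (elim \<gamma>)
        then show ?case using infinite_plus_orbit[OF elim(2)] by (auto simp: A_def)
      qed
      then have "prob A = 0" using prob_eq_0[OF A] by simp
      then show False using * by (simp add: A_def)
    qed
  qed
  have part3: "(\<forall>P. infinite (total_orbit S P) \<longrightarrow>
          (AE \<gamma> in seq_measure \<nu>.
             limsup (\<lambda>n. ereal (root n (weil_height (plus_iter \<gamma> n P)))) =
               ereal (dynamical_degree \<nu>))) \<and>
        dynamical_degree \<nu> =
          exp (measure_pmf.expectation \<nu> (\<lambda>\<phi>. ln (real (endo_degree \<phi>))))"
    if int: "integrable (measure_pmf \<nu>) (\<lambda>\<phi>. ln (real (endo_degree \<phi>)))"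
  proof -
    define E where "E = measure_pmf.expectation \<nu> (\<lambda>\<phi>. ln (real (endo_degree \<phi>)))"
    have "AE \<gamma> in seq_measure \<nu>. (\<lambda>n. (\<Sum>i<n. ln (real (endo_degree (\<gamma> i)))) / real n) \<longlonglongrightarrow> E"
      using sequence_space.strong_law[OF sequence_space_pmf, of \<nu> "\<lambda>\<phi>. ln (real (endo_degree \<phi>))"] int
      unfolding seq_measure_def E_def by (simp add: integrable_restrict_pmf integral_restrict_pmf)
    then have roots: "AE \<gamma> in seq_measure \<nu>. (\<lambda>n. root n (real (\<Prod>i<n. endo_degree (\<gamma> i)))) \<longlonglongrightarrow> exp E"
      using seq
    proof eventually_elim
      case (elim \<gamma>)
      have "(\<lambda>n. exp ((\<Sum>i<n. ln (real (endo_degree (\<gamma> i)))) / real n)) \<longlonglongrightarrow> exp E"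
        using elim(1) by (rule tendsto_exp)
      \<comment> \<open>At index zero the two sides differ: \<open>root 0\<close> is zero, while the
        exponential is one.\<close>
      moreover have "eventually (\<lambda>n. exp ((\<Sum>i<n. ln (real (endo_degree (\<gamma> i)))) / real n) =
         root n (real (\<Prod>i<n. endo_degree (\<gamma> i)))) sequentially"
        using eventually_gt_at_top[of 0]
      proof eventually_elim
        case (elim n)
        have d: "real (endo_degree (\<gamma> i)) > 0" for i
          using degree_ge_2[of "\<gamma> i"] \<open>\<gamma> \<in> sequences S\<close> by (simp add: sequences_def)
        have pos: "0 < real (\<Prod>i<n. endo_degree (\<gamma> i))" using d by (simp add: prod_pos)
        have "ln (real (\<Prod>i<n. endo_degree (\<gamma> i))) = (\<Sum>i<n. ln (real (endo_degree (\<gamma> i))))"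
          unfolding of_nat_prod using d by (intro ln_prod) (auto simp: less_imp_neq[symmetric])
        then show ?case using elim pos d
          by (simp add: root_powr_inverse powr_def divide_inverse mult.commute)
      qed
      ultimately show ?case by (rule Lim_transform_eventually)
    qed
    \<comment> \<open>Degrees multiply regardless of the order of composition, so both kinds of
      iterates have the same degree.\<close>
    have plus: "AE \<gamma> in seq_measure \<nu>. (\<lambda>n. root n (real (endo_degree (plus_iter \<gamma> n)))) \<longlonglongrightarrow> exp E"
      using roots seq by eventually_elim (simp add: degree_plus_iter)
    have minus: "AE \<gamma> in seq_measure \<nu>. (\<lambda>n. root n (real (endo_degree (minus_iter \<gamma> n)))) \<longlonglongrightarrow> exp E"
      using roots seq by eventually_elim (simp add: degree_minus_iter)
    have dd: "dynamical_degree \<nu> = exp E"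
      unfolding dynamical_degree_def
    proof (rule the_equality)
      fix \<delta> assume *: "(AE \<gamma> in seq_measure \<nu>. (\<lambda>n. root n (real (endo_degree (minus_iter \<gamma> n)))) \<longlonglongrightarrow> \<delta>) \<and>
        (AE \<gamma> in seq_measure \<nu>. (\<lambda>n. root n (real (endo_degree (plus_iter \<gamma> n)))) \<longlonglongrightarrow> \<delta>)"
      then have "AE \<gamma> in seq_measure \<nu>. (\<lambda>n. root n (real (endo_degree (plus_iter \<gamma> n)))) \<longlonglongrightarrow> \<delta>" by blast
      \<comment> \<open>Both limits hold on a common set of full measure, which is not empty in a
        probability space; this fixes the value of the definite description.\<close>
      with plus have "AE \<gamma> in seq_measure \<nu>. \<delta> = exp E"
        by eventually_elim (rule LIMSEQ_unique)
      then show "\<delta> = exp E" by simp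
    qed (use plus minus in blast)
    have "AE \<gamma> in seq_measure \<nu>. limsup (\<lambda>n. ereal (root n (weil_height (plus_iter \<gamma> n P)))) = ereal (exp E)"
      if inf: "infinite (total_orbit S P)" for P
      using pos[OF inf] plus seq
    proof eventually_elim
      case (elim \<gamma>)
      then obtain c where c: "0 < c" "\<forall>k. \<exists>n\<ge>k. c \<le> height_ratio \<gamma> P n" by blast
      show ?case by (rule limsup_root_height[OF elim(3) c elim(2)])
    qed
    then show ?thesis using dd by (simp add: E_def)
  qed
  show ?thesis using part1 inf_iff fin_iff part3 by blast
qed

end
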